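(* Let $a,b,c\in\mathbb{Z}^{+}$ with $\gcd(a,b,c)=1$. Then the form $$f(x,y,z):=ax^2+by^2+cT_z$$ is asymptotically universal if and only if both of the following conditions hold: (1) $-2bc\,R\,a'$, $-2ac\,R\,b'$, and $-ab\,R\,c'$. (2) Either $4\nmid c$, or both $4\| c$ and $2\| ab$.
   Context: $\mathbb{N}=\{0,1,2,\ldots\}$ and $\mathbb{Z}^{+}=\{1,2,3,\ldots\}$. For $x\in\mathbb{Z}$, $T_x=x(x+1)/2$. For a form $f(x,y,z)$ as in the claim, with variables ranging over $\mathbb{Z}$, put $E(f)=\{n\in\mathbb{N}: f(x,y,z)=n \text{ has no solution } x,y,z\in\mathbb{Z}\}$. The form $f$ is asymptotically universal if $E(f)$ has asymptotic density zero, i.e. $\lim_{N\to\infty}\frac1N|\{1\le n\le N: n=f(x,y,z)\text{ for some }x,y,z\in\mathbb{Z}\}|=1$. For a positive integer $n$, $v_2(n)$ is the 2-adic order of $n$ and $n'=n/2^{v_2(n)}$ is the odd part of $n$; $2^k\|n$ means $v_2(n)=k$. For $u\in\mathbb{Z}$ and $m\in\mathbb{Z}^+$, $u\,R\,m$ means that $\gcd(u,m)=1$ and the congruence $x^2\equiv u\pmod m$ is solvable in $\mathbb{Z}$. *)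

theory Defs
  imports Complex_Main "HOL-Number_Theory.Number_Theory"
begin

definition triangular :: "int \<Rightarrow> int" where
  "triangular x = x * (x + 1) div 2"

definition exceptional_set :: "(int \<Rightarrow> int \<Rightarrow> int \<Rightarrow> int) \<Rightarrow> nat set" where
  "exceptional_set f = {n. \<not> (\<exists>x y z. f x y z = int n)}"

definition has_asymptotic_density :: "nat set \<Rightarrow> real \<Rightarrow> bool" where
  "has_asymptotic_density S d \<longleftrightarrow> (\<lambda>N. real (card (S \<inter> {1..N})) / real N) \<longlonglongrightarrow> d"

definition asymptotically_universal :: "(int \<Rightarrow> int \<Rightarrow> int \<Rightarrow> int) \<Rightarrow> bool" where
  "asymptotically_universal f \<longleftrightarrow> has_asymptotic_density (exceptional_set f) 0"

lemma asymptotically_universal_iff: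
  "asymptotically_universal f \<longleftrightarrow>
    (\<lambda>N. real (card {n. 1 \<le> n \<and> n \<le> N \<and> (\<exists>x y z. int n = f x y z)}) / real N) \<longlonglongrightarrow> 1"
proof -
  define A where "A N = exceptional_set f \<inter> {1..N}" for N :: nat
  define B where "B N = {n. 1 \<le> n \<and> n \<le> N \<and> (\<exists>x y z. int n = f x y z)}" for N :: nat
  define e where "e N = real (card (A N)) / real N" for N
  define r where "r N = real (card (B N)) / real N" for N
  have mem: "n \<in> exceptional_set f \<longleftrightarrow> \<not> (\<exists>x y z. int n = f x y z)" for n
    unfolding exceptional_set_def mem_Collect_eq by (subst eq_commute) (rule refl)
  have sum: "e N = 1 - r N" if "N > 0" for N
  proof -
    have un: "{1..N} = A N \<union> B N" and disj: "A N \<inter> B N = {}"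
      unfolding A_def B_def set_eq_iff Int_iff Un_iff mem by auto
    have "finite (A N \<union> B N)"
      unfolding un[symmetric] by (rule finite_atLeastAtMost)
    then have "card (A N \<union> B N) = card (A N) + card (B N)"
      by (intro card_Un_disjoint disj) (rule finite_subset[rotated], assumption, blast)+
    then have "real N = real (card (A N)) + real (card (B N))"
      unfolding un[symmetric] by simp
    then show ?thesis
      using that unfolding e_def r_def by (simp add: field_simps)
  qed
  have "e \<longlonglongrightarrow> 0 \<longleftrightarrow> (\<lambda>N. 1 - r N) \<longlonglongrightarrow> 0"
    by (intro tendsto_cong eventually_mono[OF eventually_gt_at_top[of 0]] sum)
  also have "\<dots> \<longleftrightarrow> r \<longlonglongrightarrow> 1"
  proof
    assume "(\<lambda>N. 1 - r N) \<longlonglongrightarrow> 0"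
    from tendsto_diff[OF tendsto_const[of 1] this] show "r \<longlonglongrightarrow> 1" by simp
  next
    assume "r \<longlonglongrightarrow> 1"
    from tendsto_diff[OF tendsto_const[of 1] this] show "(\<lambda>N. 1 - r N) \<longlonglongrightarrow> 0" by simp
  qed
  finally show ?thesis
    unfolding asymptotically_universal_def has_asymptotic_density_def e_def r_def A_def B_def .
qed

abbreviation v2 :: "int \<Rightarrow> nat" where
  "v2 n \<equiv> multiplicity 2 n"

definition odd_part :: "int \<Rightarrow> int" where
  "odd_part n = n div 2 ^ v2 n"

text \<open>\<open>two_power_exact k n\<close> is \<open>2^k \<parallel> n\<close>; thus \<open>4 \<parallel> n\<close> is the case \<open>k = 2\<close>.\<close>

definition two_power_exact :: "nat \<Rightarrow> int \<Rightarrow> bool" where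
  "two_power_exact k n \<longleftrightarrow> v2 n = k"

text \<open>The modulus is the first argument of \<^const>\<open>QuadRes\<close>.\<close>

definition R_rel :: "int \<Rightarrow> int \<Rightarrow> bool" where
  "R_rel u m \<longleftrightarrow> gcd u m = 1 \<and> QuadRes m u"

end

(* The conditions make 8 a x^2 + 8 b y^2 + c w^2 isotropic at every odd prime, which produces, for
   every residue class, a solution at which the form is smooth in two chosen variables modulo
   every small prime. Fixing such a solution modulo a multiple of V = product of the primes up to M
   turns the problem into one about an inhomogeneous polynomial
     G = sum over i of (a_i k_i + V b_i k_i^2)
   with gcd(a_1, a_2, V) = 1. With k_1, k_2 in an interval of length X and k_3 in [L, L1), where X is
   a power of L strictly between L^(1/2) and L, the number of collisions G(k) = G(k') is at most
   (1 + O(1/M)) times its mean value: for d = k_3 - k_3' the collisions are the solutions of a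
   congruence modulo 2 V b_3 d, which is small compared with X, and the densities of these
   congruences are bounded by a truncated divisor sum. Cauchy-Schwarz then shows that G misses a
   proportion O(1/M) of the integers. Conversely, a residue class not met by the form is an
   obstruction of positive density. *)

theory Submission
  imports Defs "HOL-Analysis.Convex" "HOL-Real_Asymp.Real_Asymp"
begin

section \<open>Sums over complete residue systems\<close>

text \<open>Two demands fix the window for \<open>X\<close>. A collision whose third variables
  differ by \<open>d > 0\<close> has \<open>d * L\<close> at most of order \<open>X^2\<close>, so
  the modulus \<open>2 * V * b3 * d\<close> is small against \<open>X\<close> only if
  \<open>X\<close> is small against \<open>L\<close>. Collisions with equal third variables number
  about \<open>X^2 * L * (log X)^2\<close>; to be negligible against the main term
  \<open>X^4\<close> they need \<open>X\<close> large against \<open>L^(1/2)\<close>.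

  The loss of order \<open>1/M\<close> at fixed \<open>M\<close> comes from the primes above
  \<open>M\<close>, which are controlled only on average. The number of residue classes depends on
  \<open>M\<close>, but for each \<open>M\<close> it is finite, so the classes are added up first
  and \<open>M\<close> tends to infinity afterwards.

  The prime 3 is the local obstacle. A residue may have solutions modulo 3 only at points where the
  gradient points along the third variable; then \<open>x\<close> and \<open>y\<close> exchange
  roles. The choice of the distinguished variable therefore depends on the residue class. At 2
  nothing similar happens: the triangular variable always contributes an odd linear coefficient, and
  solvability modulo 8 is enough.\<close>

lemma sum_periodic_shift:
  fixes F :: "int \<Rightarrow> 'b :: comm_monoid_add"
  assumes m: "m > 0" and per: "\<And>x. F (x + m) = F x"
  shows "(\<Sum>h\<in>{0..<m}. F (h + w)) = (\<Sum>h\<in>{0..<m}. F h)"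
proof -
  have per1: "F (x + m * int k) = F x" for x k
  proof (induction k)
    case (Suc k)
    have "F (x + m * int (Suc k)) = F ((x + m * int k) + m)"
      by (simp add: algebra_simps)
    with Suc per show ?case by simp
  qed simp
  have per': "F (x + m * k) = F x" for x k
  proof (cases "k \<ge> 0")
    case True
    then show ?thesis using per1[of x "nat k"] by simp
  next
    case False
    then show ?thesis using per1[of "x + m * k" "nat (- k)"] by simp
  qed
  have mod: "F (x mod m) = F x" for x
    using per'[of "x mod m" "x div m"] by simp
  have "bij_betw (\<lambda>h. (h + w) mod m) {0..<m} {0..<m}"
    using m by (intro bij_betwI[where g = "\<lambda>h. (h - w) mod m"]) (auto simp: mod_simps)
  from sum.reindex_bij_betw[OF this, of F] show ?thesis
    by (simp add: mod)
qed

text \<open>Two solutions \<open>i\<close> differ by a multiple of \<open>r = n div gcd A n\<close>,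
  so \<open>i div r\<close> separates them.\<close>

lemma sum_dvd_linear_le:
  fixes A C m n :: int
  assumes n: "n > 0" and m: "m > 0" and nm: "n dvd m"
  shows "(\<Sum>i\<in>{0..<m}. of_bool (n dvd A * i + C)) \<le> real_of_int m * real_of_int (gcd A n) / real_of_int n"
proof -
  define g where "g = gcd A n"
  define r where "r = n div g"
  have g: "g > 0" "g dvd n" "g dvd A" using n by (auto simp: g_def)
  have nr: "n = r * g" using g by (simp add: r_def)
  have r: "r > 0" using n g nr by (metis zero_less_mult_pos2)
  obtain q where q: "m = n * q" using nm by auto
  have q0: "q > 0" using q m n by (metis zero_less_mult_pos)
  let ?S = "{i\<in>{0..<m}. n dvd A * i + C}"
  have cl: "i mod r = j mod r" if "i \<in> ?S" "j \<in> ?S" for i j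
  proof -
    have "n dvd (A * i + C) - (A * j + C)" using that by (intro dvd_diff) auto
    moreover have "A = A div g * g" using g by simp
    then have "(A * i + C) - (A * j + C) = (A div g) * (i - j) * g"
      by (metis add_diff_cancel_right mult.assoc mult.commute right_diff_distrib)
    ultimately have "r * g dvd (A div g) * (i - j) * g" using nr by simp
    then have "r dvd (A div g) * (i - j)" using g by simp
    moreover have "coprime r (A div g)"
      using n unfolding r_def g_def by (metis coprime_commute div_gcd_coprime gcd_eq_0_iff less_irrefl)
    ultimately have "r dvd i - j" using coprime_dvd_mult_right_iff by blast
    then show ?thesis by (simp add: mod_eq_dvd_iff)
  qed
  have "card ?S \<le> card {0..<q * g}"
  proof (rule card_inj_on_le)
    show "inj_on (\<lambda>i. i div r) ?S"
    proof (rule inj_onI)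
      fix i j assume ij: "i \<in> ?S" "j \<in> ?S" "i div r = j div r"
      show "i = j" using cl[OF ij(1,2)] ij(3) by (metis div_mult_mod_eq)
    qed
    have "i div r < q * g" if "i < m" for i
    proof -
      have "r * (i div r) \<le> i" using r by (simp add: minus_mod_eq_mult_div[symmetric])
      also have "i < r * (q * g)" using that q nr by (simp add: algebra_simps)
      finally show ?thesis using r by simp
    qed
    then show "(\<lambda>i. i div r) ` ?S \<subseteq> {0..<q * g}"
      using r by (auto simp: pos_imp_zdiv_nonneg_iff)
  qed simp
  then have "int (card ?S) \<le> q * g"
    using mult_pos_pos[OF q0 g(1)] by simp
  then have "real (card ?S) \<le> real_of_int (q * g)"
    by linarith
  moreover have "real_of_int (q * g) = real_of_int m * real_of_int g / real_of_int n"
    using q n by (simp add: field_simps)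
  moreover have "(\<Sum>i\<in>{0..<m}. of_bool (n dvd A * i + C)) = real (card ?S)"
    by (simp add: of_bool_def sum.If_cases Int_def)
  ultimately show ?thesis by (simp add: g_def)
qed

text \<open>Summing over \<open>i\<close> first leaves the solvability condition
  \<open>gcd A n dvd B * j + C\<close>, again a linear congruence; the factor \<open>gcd A n\<close>
  from the first sum cancels against the modulus of the second.\<close>

lemma sum_dvd_linear2_le:
  fixes A B C m n :: int
  assumes n: "n > 0" and m: "m > 0" and nm: "n dvd m"
  shows "(\<Sum>i\<in>{0..<m}. \<Sum>j\<in>{0..<m}. of_bool (n dvd A * i + B * j + C))
           \<le> real_of_int m ^ 2 * real_of_int (gcd B (gcd A n)) / real_of_int n"
proof -
  define g where "g = gcd A n"
  have g: "g > 0" "g dvd n" "g dvd A" using n by (auto simp: g_def)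
  have gm: "g dvd m" using g nm by (meson dvd_trans)
  have "(\<Sum>i\<in>{0..<m}. \<Sum>j\<in>{0..<m}. of_bool (n dvd A * i + B * j + C))
      = (\<Sum>j\<in>{0..<m}. \<Sum>i\<in>{0..<m}. (of_bool (n dvd A * i + (B * j + C)) :: real))"
    by (subst sum.swap) (simp add: add.assoc)
  also have "\<dots> \<le> (\<Sum>j\<in>{0..<m}. of_bool (g dvd B * j + C) * (real_of_int m * real_of_int g / real_of_int n))"
  proof (rule sum_mono)
    fix j
    show "(\<Sum>i\<in>{0..<m}. of_bool (n dvd A * i + (B * j + C)))
        \<le> of_bool (g dvd B * j + C) * (real_of_int m * real_of_int g / real_of_int n)"
    proof (cases "g dvd B * j + C")
      case True
      then show ?thesis using sum_dvd_linear_le[OF n m nm, of A "B * j + C"] by (simp add: g_def)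
    next
      case False
      have "\<not> n dvd A * i + (B * j + C)" for i
        using False g by (metis dvd_add_right_iff dvd_mult2 dvd_trans)
      then show ?thesis using False by simp
    qed
  qed
  also have "\<dots> = (\<Sum>j\<in>{0..<m}. of_bool (g dvd B * j + C)) * (real_of_int m * real_of_int g / real_of_int n)"
    by (simp only: sum_distrib_right)
  also have "\<dots> \<le> (real_of_int m * real_of_int (gcd B g) / real_of_int g) * (real_of_int m * real_of_int g / real_of_int n)"
    using n m g by (intro mult_right_mono sum_dvd_linear_le gm) auto
  also have "\<dots> = real_of_int m ^ 2 * real_of_int (gcd B (gcd A n)) / real_of_int n"
    using g by (simp add: g_def power2_eq_square)
  finally show ?thesis .
qed

definition sum4 :: "int \<Rightarrow> (int \<Rightarrow> int \<Rightarrow> int \<Rightarrow> int \<Rightarrow> real) \<Rightarrow> real" where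
  "sum4 m F = (\<Sum>i\<in>{0..<m}. \<Sum>i'\<in>{0..<m}. \<Sum>j\<in>{0..<m}. \<Sum>j'\<in>{0..<m}. F i i' j j')"

lemma sum4_mono:
  "(\<And>i i' j j'. F i i' j j' \<le> H i i' j j') \<Longrightarrow> sum4 m F \<le> sum4 m H"
  unfolding sum4_def by (intro sum_mono)

lemma sum4_shift:
  assumes m: "m > 0"
    and "\<And>i i' j j'. F (i + m) i' j j' = F i i' j j'" "\<And>i i' j j'. F i (i' + m) j j' = F i i' j j'"
    and "\<And>i i' j j'. F i i' (j + m) j' = F i i' j j'" "\<And>i i' j j'. F i i' j (j' + m) = F i i' j j'"
  shows "sum4 m (\<lambda>i i' j j'. F (i + x) (i' + x') (j + y) (j' + y')) = sum4 m F"
proof -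
  have "sum4 m (\<lambda>i i' j j'. F (i + x) (i' + x') (j + y) (j' + y'))
     = sum4 m (\<lambda>i i' j j'. F (i + x) (i' + x') (j + y) j')"
    unfolding sum4_def by (intro sum.cong refl sum_periodic_shift m assms)
  also have "\<dots> = sum4 m (\<lambda>i i' j j'. F (i + x) (i' + x') j j')"
    unfolding sum4_def
    by (intro sum.cong refl sum_periodic_shift[where F = "\<lambda>j. \<Sum>j'\<in>{0..<m}. F _ _ j j'"] m) (simp add: assms)
  also have "\<dots> = sum4 m (\<lambda>i i' j j'. F (i + x) i' j j')"
    unfolding sum4_def
    by (intro sum.cong refl
      sum_periodic_shift[where F = "\<lambda>i'. \<Sum>j\<in>{0..<m}. \<Sum>j'\<in>{0..<m}. F _ i' j j'"] m) (simp add: assms)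
  also have "\<dots> = sum4 m F"
    unfolding sum4_def
    by (intro sum_periodic_shift[where F = "\<lambda>i. \<Sum>i'\<in>{0..<m}. \<Sum>j\<in>{0..<m}. \<Sum>j'\<in>{0..<m}. F i i' j j'"] m)
       (simp add: assms)
  finally show ?thesis .
qed

text \<open>Once the differences \<open>u\<close>, \<open>w\<close> of the two points are fixed, the
  polynomial \<open>S\<close> introduced below is linear in \<open>i\<close> and \<open>j\<close>,
  which brings it within reach of \<open>sum_dvd_linear2_le\<close>.\<close>

lemma sum4_differences:
  assumes m: "m > 0"
    and "\<And>i i' j j'. F i (i' + m) j j' = F i i' j j'" "\<And>i i' j j'. F i i' j (j' + m) = F i i' j j'"
  shows "sum4 m F = (\<Sum>u\<in>{0..<m}. \<Sum>w\<in>{0..<m}. \<Sum>i\<in>{0..<m}. \<Sum>j\<in>{0..<m}. F i (u + i) j (w + j))"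
proof -
  have "sum4 m F = sum4 m (\<lambda>i i' j j'. F i i' j (j' + j))"
    unfolding sum4_def by (intro sum.cong refl sum_periodic_shift[symmetric] m assms)
  also have "\<dots> = sum4 m (\<lambda>i i' j j'. F i (i' + i) j (j' + j))"
    unfolding sum4_def
    by (intro sum.cong refl
      sum_periodic_shift[where F = "\<lambda>i'. \<Sum>j\<in>{0..<m}. \<Sum>j'\<in>{0..<m}. F _ i' j (j' + j)", symmetric] m)
      (simp add: assms)
  also have "\<dots> = (\<Sum>u\<in>{0..<m}. \<Sum>i\<in>{0..<m}. \<Sum>j\<in>{0..<m}. \<Sum>w\<in>{0..<m}. F i (u + i) j (w + j))"
    unfolding sum4_def by (rule sum.swap)
  also have "\<dots> = (\<Sum>u\<in>{0..<m}. \<Sum>i\<in>{0..<m}. \<Sum>w\<in>{0..<m}. \<Sum>j\<in>{0..<m}. F i (u + i) j (w + j))"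
    by (intro sum.cong refl sum.swap)
  also have "\<dots> = (\<Sum>u\<in>{0..<m}. \<Sum>w\<in>{0..<m}. \<Sum>i\<in>{0..<m}. \<Sum>j\<in>{0..<m}. F i (u + i) j (w + j))"
    by (intro sum.cong refl sum.swap)
  finally show ?thesis .
qed

lemma sum4_sum: "(\<Sum>t\<in>A. sum4 m (F t)) = sum4 m (\<lambda>i i' j j'. \<Sum>t\<in>A. F t i i' j j')"
  unfolding sum4_def
  apply (subst sum.swap, rule sum.cong[OF refl])
  apply (subst sum.swap, rule sum.cong[OF refl])
  apply (subst sum.swap, rule sum.cong[OF refl])
  apply (rule sum.swap)
  done

section \<open>Density of the collision congruence modulo \<open>2 * V * b3 * d\<close>\<close>

lemma split_coprime_part:
  fixes m V :: int
  assumes "m > 0" and V: "V > 0"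
  shows "\<exists>m1 m2. m = m1 * m2 \<and> m1 > 0 \<and> m2 > 0 \<and> coprime m2 V \<and> (\<forall>c. coprime c V \<longrightarrow> coprime c m1)"
  using assms(1)
proof (induction "nat m" arbitrary: m rule: less_induct)
  case less
  show ?case
  proof (cases "coprime m V")
    case True
    then show ?thesis using less.prems by (intro exI[of _ 1] exI[of _ m]) auto
  next
    case False
    \<comment> \<open>Common factors with \<open>V\<close> are moved into \<open>m1\<close> one gcd
      at a time. A number coprime to \<open>V\<close> is coprime to the divisor \<open>g\<close> of
      \<open>V\<close>, so the property required of \<open>m1\<close> survives without any prime
      factorization.\<close>
    define g where "g = gcd m V"
    have g: "g > 1" using False less.prems by (simp add: g_def coprime_iff_gcd_eq_1 order_less_le) (metis int_one_le_iff_zero_less gcd_pos_int less_irrefl)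
    obtain m' where m': "m = g * m'" unfolding g_def by (meson dvdE gcd_dvd1)
    have m'0: "m' > 0" using m' less.prems g by (simp add: zero_less_mult_iff)
    have "m' < m" using m' g m'0 by simp
    then obtain m1 m2 where *: "m' = m1 * m2" "m1 > 0" "m2 > 0" "coprime m2 V" "\<forall>c. coprime c V \<longrightarrow> coprime c m1"
      using less.hyps[of m'] m'0 by auto
    have "coprime c (g * m1)" if "coprime c V" for c
      using that * coprime_divisors[of c c g V] by (simp add: g_def)
    then show ?thesis using * m' g by (intro exI[of _ "g * m1"] exI[of _ m2]) auto
  qed
qed

text \<open>The third variable is the distinguished one: the non-degeneracy assumption concerns the first two.\<close>

locale qform =
  fixes V a1 a2 a3 b1 b2 b3 :: int
  assumes V_pos: "V > 0"
    and a_nonneg: "a1 \<ge> 0" "a2 \<ge> 0" "a3 \<ge> 0"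
    and b_pos: "b1 > 0" "b2 > 0" "b3 > 0"
    and coprime_a: "coprime (gcd a1 a2) V"
    and prime_dvd_V: "\<And>p. prime p \<Longrightarrow> p dvd 2 * b1 * b2 * b3 \<Longrightarrow> p dvd V"
begin

definition Q :: "int \<Rightarrow> int \<Rightarrow> int" where
  "Q i j = a1 * i + V * b1 * i\<^sup>2 + a2 * j + V * b2 * j\<^sup>2"

definition S :: "int \<Rightarrow> int \<Rightarrow> int \<Rightarrow> int \<Rightarrow> int" where
  "S i i' j j' = Q i' j' - Q i j"

text \<open>The divisor function of exponent -1 at the part of \<open>d\<close> coprime to
  \<open>V\<close>. It plays the role of a singular series for the collision equation, in which only
  the primes outside \<open>V\<close> contribute.\<close>

definition sigma_inv :: "int \<Rightarrow> real" where
  "sigma_inv d = (\<Sum>e\<in>{e. e > 0 \<and> e dvd d \<and> coprime e V}. 1 / real_of_int e)"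

lemma S_eq: "S i i' j j' = (i' - i) * (a1 + V * b1 * (i + i')) + (j' - j) * (a2 + V * b2 * (j + j'))"
  by (simp add: S_def Q_def power2_eq_square algebra_simps)

lemma S_cong:
  assumes "m dvd i - x" "m dvd i' - x'" "m dvd j - y" "m dvd j' - y'"
  shows "m dvd S i i' j j' - S x x' y y'"
proof -
  have "[S i i' j j' = S x x' y y'] (mod m)"
    unfolding S_eq using assms by (intro cong_add cong_mult cong_diff cong_refl) (auto simp: cong_iff_dvd_diff)
  then show ?thesis by (simp add: cong_iff_dvd_diff)
qed

lemma dvd_S_diff_cong:
  assumes "n dvd m" "m dvd i - x" "m dvd i' - x'" "m dvd j - y" "m dvd j' - y'"
  shows "n dvd S i i' j j' - k \<longleftrightarrow> n dvd S x x' y y' - k"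
proof -
  have "n dvd (S i i' j j' - k) - (S x x' y y' - k)"
    using S_cong[OF assms(2-)] assms(1) by (simp add: dvd_trans)
  then show ?thesis by (metis dvd_diff_commute dvd_add_right_iff diff_add_cancel)
qed

lemma coprime_V_imp:
  assumes "coprime n V"
  shows "coprime n (2 * b1 * b2 * b3 * V)"
proof (rule ccontr)
  assume "\<not> ?thesis"
  then obtain c where c: "c dvd n" "c dvd 2 * b1 * b2 * b3 * V" "\<not> is_unit c"
    by (rule not_coprimeE)
  have "2 * b1 * b2 * b3 * V \<noteq> 0" using b_pos V_pos by auto
  then have "c \<noteq> 0" using c(2) by auto
  then obtain p where "prime p" "p dvd c" using c(3) prime_divisor_exists by blast
  with c have p: "prime p" "p dvd n" "p dvd 2 * b1 * b2 * b3 * V" by (auto intro: dvd_trans)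
  then have "p dvd V" using prime_dvd_V prime_dvd_mult_iff by blast
  with p assms show False by (meson coprime_common_divisor not_prime_unit)
qed

text \<open>For fixed differences \<open>u\<close>, \<open>w\<close> the congruence is linear in
  \<open>i\<close>, \<open>j\<close>, and its coefficients are \<open>u\<close>, \<open>w\<close> up
  to units modulo \<open>n\<close>; its density is \<open>gcd(u, w, n) / n\<close>. The gcd is one
  of the terms in the sum of all common divisors \<open>e\<close>, and averaging \<open>e\<close>
  over the pairs \<open>u\<close>, \<open>w\<close> divisible by \<open>e\<close> gives
  \<open>1 / e\<close>.\<close>

lemma sum4_dvd_S_le:
  assumes n: "n > 0" and nm: "n dvd m" and m: "m > 0" and cop: "coprime n V"
  shows "sum4 m (\<lambda>i i' j j'. of_bool (n dvd S i i' j j'))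
         \<le> real_of_int m ^ 4 / real_of_int n * (\<Sum>e\<in>{e. e > 0 \<and> e dvd n}. 1 / real_of_int e)"
proof -
  let ?D = "{e. e > 0 \<and> e dvd n}"
  have finD: "finite ?D" using n by (intro finite_subset[OF _ finite_divisors_int[of n]]) auto
  have c1: "coprime n (2 * V * b1)" and c2: "coprime n (2 * V * b2)"
    using coprime_V_imp[OF cop] by auto
  have "sum4 m (\<lambda>i i' j j'. of_bool (n dvd S i i' j j'))
     = (\<Sum>u\<in>{0..<m}. \<Sum>w\<in>{0..<m}. \<Sum>i\<in>{0..<m}. \<Sum>j\<in>{0..<m}. of_bool (n dvd S i (u + i) j (w + j)))"
  proof (rule sum4_differences[OF m])
    show "of_bool (n dvd S i (i' + m) j j') = (of_bool (n dvd S i i' j j') :: real)" for i i' j j'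
      using dvd_S_diff_cong[OF nm, of i i "i' + m" i' j j j' j' 0] by simp
    show "of_bool (n dvd S i i' j (j' + m)) = (of_bool (n dvd S i i' j j') :: real)" for i i' j j'
      using dvd_S_diff_cong[OF nm, of i i i' i' j j "j' + m" j' 0] by simp
  qed
  also have "\<dots> \<le> (\<Sum>u\<in>{0..<m}. \<Sum>w\<in>{0..<m}. real_of_int m ^ 2 / real_of_int n *
       (\<Sum>e\<in>?D. real_of_int e * (of_bool (e dvd u) * of_bool (e dvd w))))"
  proof (intro sum_mono)
    fix u w
    have "(\<Sum>i\<in>{0..<m}. \<Sum>j\<in>{0..<m}. of_bool (n dvd S i (u + i) j (w + j)))
       = (\<Sum>i\<in>{0..<m}. \<Sum>j\<in>{0..<m}. (of_bool (n dvd (2 * V * b1 * u) * i + (2 * V * b2 * w) * j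
            + (u * (a1 + V * b1 * u) + w * (a2 + V * b2 * w))) :: real))"
      by (intro sum.cong refl arg_cong[where f = of_bool] arg_cong[where f = "(dvd) n"])
         (simp add: S_eq algebra_simps)
    also have "\<dots> \<le> real_of_int m ^ 2 * real_of_int (gcd (2 * V * b2 * w) (gcd (2 * V * b1 * u) n)) / real_of_int n"
      by (rule sum_dvd_linear2_le[OF n m nm])
    also have "gcd (2 * V * b2 * w) (gcd (2 * V * b1 * u) n) = gcd w (gcd u n)"
    proof -
      have "gcd (2 * V * b1 * u) n = gcd u n"
        using c1 by (simp add: gcd_mult_left_left_cancel coprime_commute)
      moreover have "gcd (2 * V * b2 * w) (gcd u n) = gcd w (gcd u n)"
        using c2 by (intro gcd_mult_left_left_cancel) (meson coprime_commute coprime_divisors dvd_refl gcd_dvd2)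
      ultimately show ?thesis by simp
    qed
    also have "real_of_int (gcd w (gcd u n)) \<le> (\<Sum>e\<in>?D. real_of_int e * (of_bool (e dvd u) * of_bool (e dvd w)))"
    proof -
      let ?g = "gcd w (gcd u n)"
      have g: "?g \<in> ?D" using n by (auto intro: gcd_dvdI2)
      have "real_of_int ?g = real_of_int ?g * (of_bool (?g dvd u) * of_bool (?g dvd w))"
        by (auto intro: gcd_dvdI2)
      also have "\<dots> \<le> (\<Sum>e\<in>?D. real_of_int e * (of_bool (e dvd u) * of_bool (e dvd w)))"
        using finD g by (intro member_le_sum) auto
      finally show ?thesis .
    qed
    finally show "(\<Sum>i\<in>{0..<m}. \<Sum>j\<in>{0..<m}. of_bool (n dvd S i (u + i) j (w + j)))
      \<le> real_of_int m ^ 2 / real_of_int n * (\<Sum>e\<in>?D. real_of_int e * (of_bool (e dvd u) * of_bool (e dvd w)))"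
      using n m by (simp add: mult_left_mono divide_right_mono)
  qed
  also have "\<dots> = real_of_int m ^ 2 / real_of_int n * (\<Sum>e\<in>?D. real_of_int e *
       ((\<Sum>u\<in>{0..<m}. of_bool (e dvd u)) * (\<Sum>w\<in>{0..<m}. of_bool (e dvd w))))"
    unfolding sum_distrib_left[symmetric] sum_product
    by (subst sum.swap, subst (2) sum.swap, subst sum.swap) (simp only: sum_distrib_left mult.assoc mult.commute mult.left_commute)
  also have "\<dots> \<le> real_of_int m ^ 2 / real_of_int n * (\<Sum>e\<in>?D. real_of_int e *
       ((real_of_int m / real_of_int e) * (real_of_int m / real_of_int e)))"
  proof (intro mult_left_mono sum_mono)
    fix e assume e: "e \<in> ?D"
    have *: "(\<Sum>u\<in>{0..<m}. of_bool (e dvd u)) \<le> real_of_int m / real_of_int e"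
    proof -
      have "e dvd m" using e nm by (auto intro: dvd_trans)
      then show ?thesis using sum_dvd_linear_le[of e m 1 0] e m by simp
    qed
    show "(\<Sum>u\<in>{0..<m}. of_bool (e dvd u)) * (\<Sum>w\<in>{0..<m}. of_bool (e dvd w))
       \<le> (real_of_int m / real_of_int e) * (real_of_int m / real_of_int e)"
      using e m by (intro mult_mono *) (auto intro!: sum_nonneg)
  qed (use n in auto)
  also have "\<dots> = real_of_int m ^ 2 / real_of_int n * (\<Sum>e\<in>?D. real_of_int m ^ 2 * (1 / real_of_int e))"
    by (intro arg_cong[where f = "\<lambda>x. _ * x"] sum.cong refl) (auto simp: power2_eq_square)
  also have "\<dots> = real_of_int m ^ 4 / real_of_int n * (\<Sum>e\<in>?D. 1 / real_of_int e)"
    by (simp only: sum_distrib_left[symmetric]) (simp add: power2_eq_square power4_eq_xxxx)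
  finally show ?thesis .
qed

text \<open>The part \<open>m2\<close> of \<open>m\<close> coprime to \<open>V\<close> divides
  \<open>d\<close>, hence also \<open>k\<close>, so modulo \<open>m2\<close> the congruence is the
  homogeneous one of \<open>sum4_dvd_S_le\<close>. The complementary part \<open>m1\<close> costs no
  more than the expected factor \<open>1 / m1\<close>, because the linear part of \<open>Q\<close>
  is nondegenerate modulo every prime of \<open>V\<close>.\<close>

lemma sum4_dvd_S_shifted_le:
  assumes d: "d > 0" and m_def: "m = 2 * V * b3 * d" and k: "d dvd k"
  shows "sum4 m (\<lambda>i i' j j'. of_bool (m dvd S (i + x) (i' + x') (j + y) (j' + y') - k))
         \<le> real_of_int m ^ 3 * sigma_inv d"
proof -
  define F where "F i i' j j' = (of_bool (m dvd S i i' j j' - k) :: real)" for i i' j j'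
  have m: "m > 0" using d V_pos b_pos by (simp add: m_def)
  obtain m1 m2 where m12: "m = m1 * m2" "m1 > 0" "m2 > 0" "coprime m2 V"
      "\<And>c. coprime c V \<Longrightarrow> coprime c m1"
    using split_coprime_part[OF m V_pos] by blast
  have "coprime m2 (2 * V * b3)" using coprime_V_imp[OF m12(4)] by auto
  moreover have "m2 dvd 2 * V * b3 * d" using m12(1) m_def by (metis dvd_triv_right)
  ultimately have m2d: "m2 dvd d" using coprime_dvd_mult_right_iff by blast
  have m2k: "m2 dvd k" using m2d k by (rule dvd_trans)
  \<comment> \<open>The aim is a direction \<open>(l1, l2)\<close> along which the linear part of
    \<open>Q\<close> has slope 1 modulo \<open>V\<close>; it exists because \<open>gcd a1 a2\<close>
    is a unit modulo \<open>V\<close>.\<close>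
  obtain r s where rs: "r * gcd a1 a2 + s * V = 1"
    using bezout_int[of "gcd a1 a2" V] coprime_a by (metis coprime_iff_gcd_eq_1)
  obtain l1' l2' where l': "l1' * a1 + l2' * a2 = gcd a1 a2" using bezout_int by blast
  define l1 where "l1 = r * l1'"
  define l2 where "l2 = r * l2'"
  have "r * (l1' * a1 + l2' * a2) + s * V = 1" using rs l' by simp
  then have l: "l1 * a1 + l2 * a2 = 1 - s * V" unfolding l1_def l2_def by (simp add: algebra_simps)
  have per: "F i i' j j' = F x x' y y'"
    if "m dvd i - x" "m dvd i' - x'" "m dvd j - y" "m dvd j' - y'" for i i' j j' x x' y y'
    unfolding F_def using dvd_S_diff_cong[OF dvd_refl that] by simp
  have shift: "sum4 m (\<lambda>i i' j j'. F (i + x) (i' + x') (j + y) (j' + y')) = sum4 m F" for x x' y y'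
    by (rule sum4_shift[OF m]) (rule per; simp)+
  \<comment> \<open>Moving \<open>(i', j')\<close> by \<open>m2 t (l1, l2)\<close> preserves \<open>S\<close> modulo \<open>m2\<close> and, as \<open>t\<close> varies, hits every residue
      modulo \<open>m1\<close> at most once.\<close>
  have "real_of_int m1 * sum4 m F = (\<Sum>t\<in>{0..<m1}. sum4 m F)" using m12 by simp
  also have "\<dots> = (\<Sum>t\<in>{0..<m1}. sum4 m (\<lambda>i i' j j'. F (i + 0) (i' + m2 * l1 * t) (j + 0) (j' + m2 * l2 * t)))"
    by (simp only: shift)
  also have "\<dots> = sum4 m (\<lambda>i i' j j'. \<Sum>t\<in>{0..<m1}. F i (i' + m2 * l1 * t) j (j' + m2 * l2 * t))"
    by (simp add: sum4_sum)
  also have "\<dots> \<le> sum4 m (\<lambda>i i' j j'. of_bool (m2 dvd S i i' j j'))"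
  proof (rule sum4_mono)
    fix i i' j j'
    let ?St = "\<lambda>t. S i (i' + m2 * l1 * t) j (j' + m2 * l2 * t)"
    let ?A = "{t \<in> {0..<m1}. m dvd ?St t - k}"
    have m2S: "m2 dvd ?St t - k \<longleftrightarrow> m2 dvd S i i' j j'" for t
    proof -
      have "m2 dvd ?St t - k \<longleftrightarrow> m2 dvd S i i' j j' - k"
        by (rule dvd_S_diff_cong[OF dvd_refl]) auto
      also have "\<dots> \<longleftrightarrow> m2 dvd S i i' j j'" using m2k by (metis dvd_diff_right_iff diff_add_cancel dvd_add_left_iff)
      finally show ?thesis .
    qed
    have "s' = t" if "s' \<in> ?A" "t \<in> ?A" for s' t
    proof -
      \<comment> \<open>\<open>m2 * c\<close> is the slope of \<open>S\<close> between the two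
        parameter values. Since \<open>c\<close> is 1 modulo \<open>V\<close> and \<open>m2\<close>
        is coprime to \<open>V\<close>, the product is a unit modulo \<open>m1\<close>.\<close>
      define c where "c = 1 + V * (l1 * b1 * (2 * i' + m2 * l1 * (s' + t)) + l2 * b2 * (2 * j' + m2 * l2 * (s' + t)) - s)"
      have "?St t - ?St s' = (t - s') * m2 * ((l1 * a1 + l2 * a2) +
          V * (l1 * b1 * (2 * i' + m2 * l1 * (s' + t)) + l2 * b2 * (2 * j' + m2 * l2 * (s' + t))))"
        by (simp add: S_def Q_def power2_eq_square algebra_simps)
      also have "\<dots> = (t - s') * (m2 * c)" unfolding l c_def by (simp add: algebra_simps)
      finally have diff: "?St t - ?St s' = (t - s') * (m2 * c)" .
      have "m dvd ?St t - k" "m dvd ?St s' - k" using that by auto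
      then have "m dvd (?St t - k) - (?St s' - k)" by (rule dvd_diff)
      moreover have "(?St t - k) - (?St s' - k) = (t - s') * (m2 * c)" using diff by simp
      moreover have "m1 dvd m" by (simp add: m12(1))
      ultimately have "m1 dvd (t - s') * (m2 * c)" by (metis dvd_trans)
      moreover have "coprime (m2 * c) V"
        using m12(4) unfolding c_def coprime_mult_left_iff
        by (metis coprimeI dvd_add_left_iff dvd_mult2)
      then have "coprime (m2 * c) m1" by (rule m12(5))
      then have "coprime m1 (m2 * c)" by (rule coprime_commute[THEN iffD1])
      ultimately have "m1 dvd t - s'" using coprime_dvd_mult_left_iff by blast
      then have "t mod m1 = s' mod m1" by (simp add: mod_eq_dvd_iff)
      then show "s' = t" using that by simp
    qed
    moreover have "finite ?A" by (rule finite_subset[of _ "{0..<m1}"]) auto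
    ultimately have "card ?A \<le> Suc 0" using card_le_Suc0_iff_eq[of ?A] by blast
    then have "real (card ?A) \<le> 1" by linarith
    moreover have "real (card ?A) = 0" if "\<not> m2 dvd S i i' j j'"
    proof -
      have "?A = {}" using that m2S m12(1) by (auto dest: dvd_mult_right)
      then show ?thesis by (simp only: card.empty)
    qed
    ultimately have cardA: "real (card ?A) \<le> of_bool (m2 dvd S i i' j j')"
      by (cases "m2 dvd S i i' j j'") (simp_all only: of_bool_eq order_refl simp_thms)
    have "(\<Sum>t\<in>{0..<m1}. F i (i' + m2 * l1 * t) j (j' + m2 * l2 * t)) = real (card ?A)"
      by (simp add: F_def of_bool_def sum.If_cases Int_def)
    then show "(\<Sum>t\<in>{0..<m1}. F i (i' + m2 * l1 * t) j (j' + m2 * l2 * t)) \<le> of_bool (m2 dvd S i i' j j')"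
      using cardA by (rule ord_eq_le_trans)
  qed
  also have "\<dots> \<le> real_of_int m ^ 4 / real_of_int m2 * (\<Sum>e\<in>{e. e > 0 \<and> e dvd m2}. 1 / real_of_int e)"
    using m12 m by (intro sum4_dvd_S_le) auto
  also have "\<dots> \<le> real_of_int m ^ 4 / real_of_int m2 * sigma_inv d"
    unfolding sigma_inv_def
  proof (intro mult_left_mono sum_mono2)
    show "finite {e. e > 0 \<and> e dvd d \<and> coprime e V}"
      using d by (intro finite_subset[OF _ finite_divisors_int[of d]]) auto
    show "{e. e > 0 \<and> e dvd m2} \<subseteq> {e. e > 0 \<and> e dvd d \<and> coprime e V}"
      using m2d m12(4) by (auto intro: dvd_trans coprime_divisors[of _ m2 V V])
  qed (use m12 in auto)
  finally have "real_of_int m1 * sum4 m F \<le> real_of_int m ^ 4 / real_of_int m2 * sigma_inv d" .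
  then have "sum4 m F \<le> real_of_int m ^ 4 / (real_of_int m1 * real_of_int m2) * sigma_inv d"
    using m12 by (simp add: field_simps)
  also have "real_of_int m1 * real_of_int m2 = real_of_int m" using m12 by simp
  also have "real_of_int m ^ 4 / real_of_int m = real_of_int m ^ 3" using m by (simp add: power4_eq_xxxx power3_eq_cube)
  finally have "sum4 m F \<le> real_of_int m ^ 3 * sigma_inv d" .
  then have "sum4 m (\<lambda>i i' j j'. F (i + x) (i' + x') (j + y) (j' + y')) \<le> real_of_int m ^ 3 * sigma_inv d"
    by (simp only: shift)
  then show ?thesis by (simp only: F_def)
qed

end

section \<open>Averages of truncated divisor sums\<close>

lemma sum_inverse_int_le:
  fixes k0 k1 :: int
  assumes "1 \<le> k0" "k0 \<le> k1"
  shows "(\<Sum>k\<in>{k0..k1}. 1 / real_of_int k) \<le> 1 / real_of_int k0 + ln (real_of_int k1 / real_of_int k0)"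
  using assms(2)
proof (induction k1 rule: int_ge_induct)
  case (step k)
  have k: "k \<ge> 1" using step assms by simp
  have "ln (real_of_int k / real_of_int (k + 1)) \<le> real_of_int k / real_of_int (k + 1) - 1"
    using k by (intro ln_le_minus_one) auto
  also have "\<dots> = - (1 / real_of_int (k + 1))" using k by (simp add: field_simps)
  finally have "1 / real_of_int (k + 1) \<le> ln (real_of_int (k + 1)) - ln (real_of_int k)"
    using k by (simp add: ln_div)
  moreover have "{k0..k + 1} = insert (k + 1) {k0..k}" using step by auto
  ultimately show ?case using step assms by (simp add: ln_div)
qed (use assms in simp)

text \<open>The error is a bound for the first term of the sum. The alternative 1 covers
  \<open>a < 1\<close>, which occurs below when \<open>a\<close> is divided by a divisor
  \<open>e\<close> exceeding it.\<close>

lemma sum_inverse_real_interval_le: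
  fixes a b :: real
  assumes a: "0 < a" "a \<le> b"
  shows "(\<Sum>k\<in>{k::int. k \<ge> 1 \<and> a \<le> real_of_int k \<and> real_of_int k \<le> b}. 1 / real_of_int k) \<le> ln (b / a) + min 1 (1 / a)"
proof -
  define k0 where "k0 = max 1 \<lceil>a\<rceil>"
  define k1 where "k1 = \<lfloor>b\<rfloor>"
  have eq: "{k::int. k \<ge> 1 \<and> a \<le> real_of_int k \<and> real_of_int k \<le> b} = {k0..k1}"
    unfolding k0_def k1_def by (auto simp: ceiling_le_iff le_floor_iff)
  have ln: "0 \<le> ln (b / a)" using a by simp
  show ?thesis
  proof (cases "k0 \<le> k1")
    case True
    have "real_of_int \<lceil>a\<rceil> \<le> real_of_int k0" by (simp add: k0_def)
    then have k0: "a \<le> real_of_int k0" using le_of_int_ceiling[of a] by linarith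
    have k0': "1 \<le> real_of_int k0" and k1: "real_of_int k1 \<le> b"
      by (auto simp: k0_def k1_def)
    note k0 = k0' k0
    have "1 / real_of_int k0 \<le> min 1 (1 / a)"
      using k0 a by (auto simp: field_simps)
    moreover have "ln (real_of_int k1 / real_of_int k0) \<le> ln (b / a)"
    proof (rule ln_mono)
      show "0 < real_of_int k1 / real_of_int k0" using True k0 by auto
      show "real_of_int k1 / real_of_int k0 \<le> b / a"
        using True k0 k1 a by (intro frac_le) auto
    qed
    ultimately show ?thesis using sum_inverse_int_le[of k0 k1] True k0 unfolding eq
      by linarith
  next
    case False
    then show ?thesis unfolding eq using ln a by simp
  qed
qed

lemma sum_inverse_squares_le:
  fixes M n :: nat
  assumes "M \<ge> 1"
  shows "(\<Sum>e\<in>{M<..M + n}. 1 / real e ^ 2) \<le> 1 / real M - 1 / real (M + n)"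
proof (induction n)
  case (Suc n)
  have eq: "{M<..M + Suc n} = insert (M + Suc n) {M<..M + n}" by auto
  have "1 / real (M + Suc n) ^ 2 \<le> 1 / real (M + n) - 1 / real (M + Suc n)"
  proof -
    define x where "x = real (M + n)"
    have x: "x > 0" "real (M + Suc n) = x + 1" using assms by (auto simp: x_def)
    have "1 / (x + 1) ^ 2 \<le> 1 / (x * (x + 1))"
      using x by (intro divide_left_mono) (auto simp: power2_eq_square)
    also have "\<dots> = 1 / x - 1 / (x + 1)" using x by (simp add: field_simps)
    finally show ?thesis by (simp only: x x_def[symmetric])
  qed
  with Suc show ?case unfolding eq by simp
qed simp

lemma sum_inverse_three_halves_le:
  "n \<ge> 1 \<Longrightarrow> (\<Sum>e\<in>{1..n}. 1 / (real e * sqrt (real e))) \<le> 3 - 2 / sqrt (real n)"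
proof (induction n rule: dec_induct)
  case (step n)
  define x where "x = sqrt (real n)"
  define y where "y = sqrt (real (Suc n))"
  have xy: "0 < x" "x \<le> y" "0 < y" "y * y = x * x + 1" "y * y = real (Suc n)"
    using step by (auto simp: x_def y_def)
  have "1 / (y * y * y) \<le> 2 / x - 2 / y"
  proof -
    have "2 / x - 2 / y = 2 * (y - x) / (x * y)"
      using xy by (simp add: field_simps)
    also have "\<dots> = 2 * (y - x) * (y + x) / (x * y * (y + x))"
      using xy by simp
    also have "(y - x) * (y + x) = 1" using xy by (simp add: algebra_simps)
    then have "2 * (y - x) * (y + x) = 2" by (simp only: mult.assoc)
    also have "2 / (x * y * (y + x)) \<ge> 2 / (y * y * (y + y))"
      using xy by (intro divide_left_mono mult_mono mult_pos_pos add_mono) auto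
    moreover have "2 / (y * y * (y + y)) = 1 / (y * y * y)"
      by (simp add: mult_2[symmetric])
    ultimately show ?thesis by simp
  qed
  moreover have "(\<Sum>e\<in>{1..Suc n}. 1 / (real e * sqrt (real e)))
      = 1 / (y * y * y) + (\<Sum>e\<in>{1..n}. 1 / (real e * sqrt (real e)))"
    unfolding xy(5) by (simp add: y_def)
  ultimately show ?case using step.IH unfolding x_def[symmetric] y_def[symmetric] by linarith
qed simp

context qform
begin

lemma coprime_gt:
  assumes "\<And>p. prime p \<Longrightarrow> p \<le> int M \<Longrightarrow> p dvd V" "coprime e V" "e > 1"
  shows "e > int M"
proof -
  obtain p where p: "prime p" "p dvd e" using assms(3) prime_divisor_exists[of e] by auto
  then have "p \<le> e" using assms(3) by (intro zdvd_imp_le) auto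
  moreover have "\<not> p dvd V" using p assms(2) by (meson coprime_common_divisor not_prime_unit)
  ultimately show ?thesis using assms(1)[OF p(1)] by linarith
qed

text \<open>Writing \<open>d = e * k\<close> and summing over \<open>k\<close> first gives
  \<open>1 / e^2\<close> times a logarithm that does not depend on \<open>e\<close>. Since an
  \<open>e\<close> coprime to \<open>V\<close> is either 1 or larger than \<open>M\<close>, the
  squares sum to at most \<open>1 + 1 / M\<close>. The error is needed in two forms: bounded for
  every \<open>a\<close>, and decaying for large \<open>a\<close>.\<close>

lemma sum_sigma_inv_le:
  fixes a b :: real and M :: nat
  assumes M: "M \<ge> 1" "\<And>p. prime p \<Longrightarrow> p \<le> int M \<Longrightarrow> p dvd V" and ab: "0 < a" "a \<le> b"
  shows "(\<Sum>d\<in>{d::int. d \<ge> 1 \<and> a \<le> real_of_int d \<and> real_of_int d \<le> b}. sigma_inv d / real_of_int d)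
          \<le> (1 + 1 / M) * ln (b / a) + min 2 (3 / sqrt a)"
proof -
  let ?K = "\<lambda>e::int. {k::int. k \<ge> 1 \<and> a / real_of_int e \<le> real_of_int k \<and> real_of_int k \<le> b / real_of_int e}"
  let ?D = "{d::int. d \<ge> 1 \<and> a \<le> real_of_int d \<and> real_of_int d \<le> b}"
  define E where "E = {e::int. e \<ge> 1 \<and> e \<le> b \<and> coprime e V}"
  define n where "n = nat \<lfloor>b\<rfloor> + 1"
  have finD: "finite ?D" by (rule finite_subset[of _ "{1..\<lfloor>b\<rfloor>}"]) (auto simp: le_floor_iff)
  have finE: "finite E" unfolding E_def by (rule finite_subset[of _ "{1..\<lfloor>b\<rfloor>}"]) (auto simp: le_floor_iff)
  have finK: "finite (?K e)" for e
    by (rule finite_subset[of _ "{1..\<lfloor>b / real_of_int e\<rfloor>}"]) (auto simp: le_floor_iff)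
  have E_n: "nat e \<in> {1..n}" "int (nat e) = e" if "e \<in> E" for e
    using that unfolding E_def n_def by (auto simp: le_floor_iff nat_le_iff) linarith
  have "(\<Sum>d\<in>?D. sigma_inv d / real_of_int d)
      = (\<Sum>d\<in>?D. \<Sum>e\<in>{e. e > 0 \<and> e dvd d \<and> coprime e V}. 1 / (real_of_int e * real_of_int d))"
    by (simp add: sigma_inv_def sum_divide_distrib)
  also have "\<dots> = (\<Sum>(d, e)\<in>(SIGMA d:?D. {e. e > 0 \<and> e dvd d \<and> coprime e V}). 1 / (real_of_int e * real_of_int d))"
  proof (intro sum.Sigma finD ballI)
    fix d assume "d \<in> ?D"
    then show "finite {e. e > 0 \<and> e dvd d \<and> coprime e V}"
      by (intro finite_subset[OF _ finite_divisors_int[of d]]) auto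
  qed
  also have "\<dots> = (\<Sum>(e, k)\<in>(SIGMA e:E. ?K e).
       1 / (real_of_int e * real_of_int (e * k)))"
  proof (rule sum.reindex_bij_witness[where i = "\<lambda>(e, k). (e * k, e)" and j = "\<lambda>(d, e). (e, d div e)"], goal_cases)
    case (1 x) then show ?case by auto
  next
    case (2 x)
    obtain d e where x: "x = (d, e)" by force
    obtain k where k: "d = e * k" using 2 x by auto
    have e: "e \<ge> 1" and d: "d \<ge> 1" "a \<le> real_of_int d" "real_of_int d \<le> b" "coprime e V" using 2 x by auto
    have k1: "k \<ge> 1" using k d e by (metis int_one_le_iff_zero_less zero_less_mult_pos)
    have "real_of_int e \<le> real_of_int e * real_of_int k" using e k1 by simp
    then have "real_of_int e \<le> b" using d k by simp
    then show ?case using x e k d k1 by (auto simp: E_def field_simps)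
  next
    case (3 x) then show ?case by (auto simp: E_def)
  next
    case (4 x)
    obtain e k where x: "x = (e, k)" by force
    have ek: "e \<ge> 1" "k \<ge> 1" using 4 x by (auto simp: E_def)
    then have "e * k \<ge> 1" by (metis int_one_le_iff_zero_less mult_pos_pos)
    then show ?case using 4 x ek by (auto simp: E_def field_simps)
  next
    case (5 x) then show ?case by auto
  qed
  also have "\<dots> = (\<Sum>e\<in>E. \<Sum>k\<in>?K e.
       1 / (real_of_int e * real_of_int (e * k)))"
    using finE finK by (intro sum.Sigma[symmetric]) auto
  also have "\<dots> = (\<Sum>e\<in>E. 1 / real_of_int e ^ 2 *
      (\<Sum>k\<in>?K e. 1 / real_of_int k))"
    unfolding sum_distrib_left by (intro sum.cong refl) (simp add: power2_eq_square)
  also have "\<dots> \<le> (\<Sum>e\<in>E. 1 / real_of_int e ^ 2 * (ln (b / a) + min 1 (real_of_int e / a)))"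
  proof (intro sum_mono mult_left_mono)
    fix e assume e: "e \<in> E"
    have "(\<Sum>k\<in>?K e. 1 / real_of_int k)
       \<le> ln ((b / real_of_int e) / (a / real_of_int e)) + min 1 (1 / (a / real_of_int e))"
      using ab e by (intro sum_inverse_real_interval_le) (auto simp: E_def divide_right_mono)
    then show "(\<Sum>k\<in>?K e. 1 / real_of_int k)
       \<le> ln (b / a) + min 1 (real_of_int e / a)" using e by (simp add: E_def)
  qed simp
  also have "\<dots> = (\<Sum>e\<in>E. 1 / real_of_int e ^ 2) * ln (b / a)
       + (\<Sum>e\<in>E. 1 / real_of_int e ^ 2 * min 1 (real_of_int e / a))"
    by (simp only: distrib_left sum.distrib sum_distrib_right)
  finally have main: "(\<Sum>d\<in>?D. sigma_inv d / real_of_int d) \<le> (\<Sum>e\<in>E. 1 / real_of_int e ^ 2) * ln (b / a)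
       + (\<Sum>e\<in>E. 1 / real_of_int e ^ 2 * min 1 (real_of_int e / a))" .
  have sq: "(\<Sum>e\<in>E. 1 / real_of_int e ^ 2) \<le> 1 + 1 / M"
  proof -
    have "(\<Sum>e\<in>E. 1 / real_of_int e ^ 2) = (\<Sum>e\<in>nat ` E. 1 / real e ^ 2)"
      by (subst sum.reindex) (auto simp: E_def inj_on_def)
    also have "\<dots> \<le> (\<Sum>e\<in>insert 1 {M<..M + n}. 1 / real e ^ 2)"
    proof (rule sum_mono2)
      show "nat ` E \<subseteq> insert 1 {M<..M + n}"
      proof
        fix e' assume "e' \<in> nat ` E"
        then obtain e where e: "e \<in> E" "e' = nat e" by auto
        show "e' \<in> insert 1 {M<..M + n}"
          using coprime_gt[of M e] M(2) E_n[OF e(1)] e by (cases "e = 1") (auto simp: E_def)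
      qed
    qed auto
    also have "\<dots> \<le> 1 + (\<Sum>e\<in>{M<..M + n}. 1 / real e ^ 2)"
      using M by (subst sum.insert) auto
    also have "\<dots> \<le> 1 + 1 / M" using sum_inverse_squares_le[OF M(1), of n] by (simp add: order_trans)
    finally show ?thesis .
  qed
  have "(\<Sum>e\<in>E. 1 / real_of_int e ^ 2 * min 1 (real_of_int e / a)) \<le> (\<Sum>e\<in>E. 1 / real_of_int e ^ 2)"
    by (intro sum_mono) (simp add: divide_right_mono)
  also have "\<dots> \<le> 2" using sq M by (simp add: order_trans[OF sq] field_simps)
  finally have e1: "(\<Sum>e\<in>E. 1 / real_of_int e ^ 2 * min 1 (real_of_int e / a)) \<le> 2" .
  have "(\<Sum>e\<in>E. 1 / real_of_int e ^ 2 * min 1 (real_of_int e / a))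
      \<le> (\<Sum>e\<in>E. 1 / (real_of_int e * sqrt (real_of_int e)) * (1 / sqrt a))"
  proof (intro sum_mono)
    fix e assume e: "e \<in> E"
    define x where "x = sqrt (real_of_int e)"
    define y where "y = sqrt a"
    have xy: "x > 0" "y > 0" "real_of_int e = x * x" "a = y * y" using e ab by (auto simp: x_def y_def E_def)
    \<comment> \<open>This is \<open>min 1 t \<le> sqrt t\<close> for \<open>t = e / a\<close>. It
      leaves the convergent sum of \<open>e\<close> to the power -3/2 together with a factor that
      tends to zero as \<open>a\<close> grows.\<close>
    have "min 1 (x * x / (y * y)) \<le> x / y"
    proof (cases "x \<le> y")
      case True
      then have "x / y * (x / y) \<le> x / y * 1" using xy by (intro mult_left_mono) auto
      then show ?thesis by simp
    next
      case False
      then show ?thesis using xy by (simp add: min.coboundedI1)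
    qed
    then have "1 / (x * x) ^ 2 * min 1 (x * x / (y * y)) \<le> 1 / (x * x) ^ 2 * (x / y)"
      by (intro mult_left_mono) auto
    also have "\<dots> = 1 / ((x * x) * x) * (1 / y)" using xy by (simp add: power2_eq_square)
    finally show "1 / real_of_int e ^ 2 * min 1 (real_of_int e / a) \<le> 1 / (real_of_int e * sqrt (real_of_int e)) * (1 / sqrt a)"
      unfolding x_def[symmetric] y_def[symmetric] unfolding xy(3,4) .
  qed
  also have "\<dots> = (\<Sum>e\<in>nat ` E. 1 / (real e * sqrt (real e))) * (1 / sqrt a)"
    by (simp only: sum_distrib_right[symmetric], subst sum.reindex) (auto simp: E_def inj_on_def)
  also have "\<dots> \<le> (\<Sum>e\<in>{1..n}. 1 / (real e * sqrt (real e))) * (1 / sqrt a)"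
    using E_n ab by (intro mult_right_mono sum_mono2) auto
  also have "\<dots> \<le> 3 * (1 / sqrt a)"
  proof (rule mult_right_mono)
    show "(\<Sum>e\<in>{1..n}. 1 / (real e * sqrt (real e))) \<le> 3"
      by (rule order_trans[OF sum_inverse_three_halves_le]) (auto simp: n_def)
  qed (use ab in simp)
  finally have e2: "(\<Sum>e\<in>E. 1 / real_of_int e ^ 2 * min 1 (real_of_int e / a)) \<le> 3 / sqrt a" by simp
  have "(\<Sum>e\<in>E. 1 / real_of_int e ^ 2) * ln (b / a) \<le> (1 + 1 / M) * ln (b / a)"
    using sq ab by (intro mult_right_mono) auto
  with main e1 e2 show ?thesis by simp
qed

end

section \<open>Counting pairs with a prescribed difference\<close>

lemma card_multiples_le:
  fixes r Y :: int
  assumes r: "r \<ge> 1" and Y: "Y \<ge> 0"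
  shows "real (card {x\<in>{1..Y}. r dvd x}) \<le> real_of_int Y / real_of_int r"
proof -
  have "card {x\<in>{1..Y}. r dvd x} \<le> card {1..Y div r}"
  proof (rule card_inj_on_le[where f = "\<lambda>x. x div r"])
    show "inj_on (\<lambda>x. x div r) {x\<in>{1..Y}. r dvd x}"
      using r by (intro inj_onI) (auto elim!: dvdE)
    show "(\<lambda>x. x div r) ` {x\<in>{1..Y}. r dvd x} \<subseteq> {1..Y div r}"
    proof safe
      fix x assume x: "x \<in> {1..Y}" "r dvd x"
      then obtain k where k: "x = r * k" by auto
      have "k > 0" using x k r by (metis atLeastAtMost_iff int_one_le_iff_zero_less zero_less_mult_pos)
      then show "x div r \<in> {1..Y div r}" using x k r zdiv_mono1[of x Y r] by auto
    qed
  qed simp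
  moreover have "0 \<le> Y div r" using r Y by (simp add: pos_imp_zdiv_nonneg_iff)
  ultimately have "int (card {x\<in>{1..Y}. r dvd x}) \<le> Y div r" by simp
  then have "real (card {x\<in>{1..Y}. r dvd x}) \<le> real_of_int (Y div r)" by linarith
  also have "\<dots> \<le> real_of_int Y / real_of_int r" by (rule real_of_int_div4)
  finally show ?thesis .
qed

text \<open>Given \<open>u\<close> and \<open>w\<close>, the variable \<open>t\<close> must be a
  multiple of \<open>u div gcd u w\<close>, which leaves at most \<open>Y * gcd u w / u\<close>
  values. Bounding the gcd by the sum of the common divisors and summing over \<open>w\<close> turns
  the count into \<open>X * Y\<close> times the sum of \<open>1 / u\<close> over pairs of
  \<open>u\<close> and a divisor of it, and this is at most the square of a harmonic sum.\<close>

lemma card_dvd_triples_le: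
  fixes X Y :: int
  assumes X: "X \<ge> 1" and Y: "Y \<ge> 0"
  shows "real (card {(u, w, t). u \<in> {1..X} \<and> w \<in> {1..X} \<and> t \<in> {1..Y} \<and> u dvd w * t})
          \<le> X * Y * (1 + ln X) ^ 2"
proof -
  have "{(u, w, t). u \<in> {1..X} \<and> w \<in> {1..X} \<and> t \<in> {1..Y} \<and> u dvd w * t}
     = (SIGMA u:{1..X}. SIGMA w:{1..X}. {t\<in>{1..Y}. u dvd w * t})" by auto
  moreover have fin: "finite {t\<in>{1..Y}. u dvd w * t}" for u w
    by (rule finite_subset[of _ "{1..Y}"]) auto
  have "card (SIGMA w:{1..X}. {t\<in>{1..Y}. u dvd w * t}) = (\<Sum>w\<in>{1..X}. card {t\<in>{1..Y}. u dvd w * t})" for u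
    by (intro card_SigmaI ballI fin finite_atLeastAtMost_int)
  moreover have "card (SIGMA u:{1..X}. SIGMA w:{1..X}. {t\<in>{1..Y}. u dvd w * t})
      = (\<Sum>u\<in>{1..X}. card (SIGMA w:{1..X}. {t\<in>{1..Y}. u dvd w * t}))"
    by (intro card_SigmaI ballI finite_SigmaI fin finite_atLeastAtMost_int)
  ultimately have "real (card {(u, w, t). u \<in> {1..X} \<and> w \<in> {1..X} \<and> t \<in> {1..Y} \<and> u dvd w * t})
     = (\<Sum>u\<in>{1..X}. \<Sum>w\<in>{1..X}. real (card {t\<in>{1..Y}. u dvd w * t}))"
    by (simp only: of_nat_sum)
  also have "\<dots> \<le> (\<Sum>u\<in>{1..X}. \<Sum>w\<in>{1..X}. (real_of_int Y / real_of_int u) *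
       (\<Sum>e\<in>{e\<in>{1..X}. e dvd u}. real_of_int e * of_bool (e dvd w)))"
  proof (intro sum_mono)
    fix u w assume u: "u \<in> {1..X}" and w: "w \<in> {1..X}"
    define g where "g = gcd u w"
    have g: "g > 0" "g dvd u" "g dvd w" using u by (auto simp: g_def)
    define r where "r = u div g"
    have ur: "u = r * g" using g by (simp add: r_def)
    have r: "r \<ge> 1" using u g ur by (metis atLeastAtMost_iff int_one_le_iff_zero_less zero_less_mult_pos2)
    have "u dvd w * t \<Longrightarrow> r dvd t" for t
    proof -
      assume "u dvd w * t"
      moreover have "w * t = ((w div g) * t) * g" using g by simp
      ultimately have "r * g dvd ((w div g) * t) * g" using ur by simp
      then have "r dvd (w div g) * t" using g by simp
      moreover have "coprime r (w div g)"
        using u unfolding r_def g_def by (intro div_gcd_coprime) auto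
      ultimately show "r dvd t" using coprime_dvd_mult_right_iff by blast
    qed
    then have "card {t\<in>{1..Y}. u dvd w * t} \<le> card {t\<in>{1..Y}. r dvd t}"
      by (intro card_mono finite_subset[OF _ finite_atLeastAtMost_int[of 1 Y]]) auto
    then have "real (card {t\<in>{1..Y}. u dvd w * t}) \<le> real_of_int Y / real_of_int r"
      using card_multiples_le[OF r Y] by linarith
    also have "\<dots> = (real_of_int Y / real_of_int u) * real_of_int g"
      using g r unfolding ur by simp
    also have "\<dots> \<le> (real_of_int Y / real_of_int u) *
       (\<Sum>e\<in>{e\<in>{1..X}. e dvd u}. real_of_int e * of_bool (e dvd w))"
    proof (rule mult_left_mono)
      have "g \<le> u" using g u by (intro zdvd_imp_le) auto
      then have "g \<in> {e\<in>{1..X}. e dvd u}" using g u by auto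
      then have "real_of_int g * of_bool (g dvd w) \<le> (\<Sum>e\<in>{e\<in>{1..X}. e dvd u}. real_of_int e * of_bool (e dvd w))"
        by (intro member_le_sum finite_subset[OF _ finite_atLeastAtMost_int[of 1 X]]) auto
      then show "real_of_int g \<le> (\<Sum>e\<in>{e\<in>{1..X}. e dvd u}. real_of_int e * of_bool (e dvd w))"
        using g by simp
    qed (use u Y in auto)
    finally show "real (card {t\<in>{1..Y}. u dvd w * t}) \<le> (real_of_int Y / real_of_int u) *
       (\<Sum>e\<in>{e\<in>{1..X}. e dvd u}. real_of_int e * of_bool (e dvd w))" .
  qed
  also have "\<dots> = (\<Sum>u\<in>{1..X}. (real_of_int Y / real_of_int u) *
       (\<Sum>e\<in>{e\<in>{1..X}. e dvd u}. real_of_int e * (\<Sum>w\<in>{1..X}. of_bool (e dvd w))))"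
    by (simp only: sum_distrib_left[symmetric], subst sum.swap) (simp only: sum_distrib_left[symmetric])
  also have "\<dots> \<le> (\<Sum>u\<in>{1..X}. (real_of_int Y / real_of_int u) *
       (\<Sum>e\<in>{e\<in>{1..X}. e dvd u}. real_of_int X))"
  proof (intro sum_mono mult_left_mono)
    fix u e assume e: "e \<in> {e\<in>{1..X}. e dvd u}"
    have "(\<Sum>w\<in>{1..X}. of_bool (e dvd w)) = real (card {w\<in>{1..X}. e dvd w})"
      by (simp add: of_bool_def sum.If_cases Int_def)
    also have "\<dots> \<le> real_of_int X / real_of_int e" using e X by (intro card_multiples_le) auto
    finally have "real_of_int e * (\<Sum>w\<in>{1..X}. of_bool (e dvd w)) \<le> real_of_int e * (real_of_int X / real_of_int e)"
      using e by (intro mult_left_mono) auto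
    then show "real_of_int e * (\<Sum>w\<in>{1..X}. of_bool (e dvd w)) \<le> real_of_int X" using e by simp
  qed (use Y in auto)
  also have "\<dots> = X * Y * (\<Sum>u\<in>{1..X}. \<Sum>e\<in>{e\<in>{1..X}. e dvd u}. 1 / real_of_int u)"
    by (simp add: sum_distrib_left mult_ac)
  also have "(\<Sum>u\<in>{1..X}. \<Sum>e\<in>{e\<in>{1..X}. e dvd u}. 1 / real_of_int u)
     = (\<Sum>e\<in>{1..X}. \<Sum>u\<in>{u\<in>{1..X}. e dvd u}. 1 / real_of_int u)"
    by (rule sum.swap_restrict) auto
  also have "\<dots> \<le> (\<Sum>e\<in>{1..X}. \<Sum>f\<in>{1..X}. 1 / real_of_int e * (1 / real_of_int f))"
  proof (intro sum_mono)
    fix e assume e: "e \<in> {1..X}"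
    have inj: "inj_on (\<lambda>u. u div e) {u\<in>{1..X}. e dvd u}"
      using e by (intro inj_onI) (auto elim!: dvdE)
    have "(\<Sum>u\<in>{u\<in>{1..X}. e dvd u}. 1 / real_of_int u)
       = (\<Sum>u\<in>{u\<in>{1..X}. e dvd u}. 1 / real_of_int e * (1 / real_of_int (u div e)))"
      using e by (intro sum.cong refl) (auto elim!: dvdE)
    also have "\<dots> = (\<Sum>f\<in>(\<lambda>u. u div e) ` {u\<in>{1..X}. e dvd u}. 1 / real_of_int e * (1 / real_of_int f))"
      by (simp only: sum.reindex[OF inj] o_def)
    also have "\<dots> \<le> (\<Sum>f\<in>{1..X}. 1 / real_of_int e * (1 / real_of_int f))"
    proof (rule sum_mono2)
      show "(\<lambda>u. u div e) ` {u\<in>{1..X}. e dvd u} \<subseteq> {1..X}"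
      proof safe
        fix x assume x: "x \<in> {1..X}" "e dvd x"
        then obtain k where k: "x = e * k" by auto
        have "k > 0" using x k e by (metis atLeastAtMost_iff int_one_le_iff_zero_less zero_less_mult_pos)
        moreover have "k \<le> e * k" using e calculation mult_right_mono[of 1 e k] by auto
        then have "k \<le> X" using x k by simp
        ultimately show "x div e \<in> {1..X}" using x k e by auto
      qed
    qed (use e in auto)
    finally show "(\<Sum>u\<in>{u\<in>{1..X}. e dvd u}. 1 / real_of_int u)
       \<le> (\<Sum>f\<in>{1..X}. 1 / real_of_int e * (1 / real_of_int f))" .
  qed
  also have "\<dots> = (\<Sum>e\<in>{1..X}. 1 / real_of_int e) ^ 2"
    by (simp add: sum_product power2_eq_square)
  also have "\<dots> \<le> (1 + ln X) ^ 2"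
    using sum_inverse_int_le[of 1 X] X by (intro power_mono sum_nonneg) auto
  finally show ?thesis using X Y by (simp add: mult_left_mono)
qed

text \<open>The lower corner \<open>B\<close> is a margin: a vector of \<open>box4 B X\<close>
  translated down by less than \<open>B\<close> in each coordinate stays in
  \<open>box4 0 X\<close>.\<close>

definition box4 :: "int \<Rightarrow> int \<Rightarrow> (int \<times> int \<times> int \<times> int) set" where
  "box4 B X = {B..<X} \<times> {B..<X} \<times> {B..<X} \<times> {B..<X}"

lemma finite_box4 [simp]: "finite (box4 B X)"
  by (simp add: box4_def)

lemma card_box4: "0 \<le> X \<Longrightarrow> real (card (box4 0 X)) = real_of_int X ^ 4"
  by (simp add: box4_def card_cartesian_product power4_eq_xxxx)

lemma sum_box4: "(\<Sum>(i, i', j, j')\<in>box4 0 m. F i i' j j') = sum4 m F"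
  by (simp add: box4_def sum4_def sum.cartesian_product)

context qform
begin

text \<open>\<open>C * X\<close> bounds the sum of the two partial derivatives of \<open>Q\<close>
  on the box, whence the factor 2; the same constant bounds \<open>Q\<close> itself by
  \<open>C * X\<^sup>2\<close>.\<close>

definition C :: int where "C = a1 + a2 + 2 * V * (b1 + b2)"

definition Sv :: "int \<times> int \<times> int \<times> int \<Rightarrow> int" where
  "Sv = (\<lambda>(i, i', j, j'). S i i' j j')"

lemma Q_le:
  assumes "0 \<le> i" "i \<le> X" "0 \<le> j" "j \<le> X" "X \<ge> 1"
  shows "0 \<le> Q i j" "Q i j \<le> C * X\<^sup>2"
proof -
  have XX: "i \<le> X\<^sup>2" "j \<le> X\<^sup>2" "i\<^sup>2 \<le> X\<^sup>2" "j\<^sup>2 \<le> X\<^sup>2"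
  proof -
    have "X \<le> X\<^sup>2" using mult_left_mono[of 1 X X] assms by (simp add: power2_eq_square)
    then show "i \<le> X\<^sup>2" "j \<le> X\<^sup>2" using assms by linarith+
    show "i\<^sup>2 \<le> X\<^sup>2" "j\<^sup>2 \<le> X\<^sup>2" using assms by (auto intro: power_mono)
  qed
  have "Q i j \<le> a1 * X\<^sup>2 + V * b1 * X\<^sup>2 + a2 * X\<^sup>2 + V * b2 * X\<^sup>2"
    unfolding Q_def using XX a_nonneg b_pos V_pos
    by (intro add_mono mult_left_mono) (auto intro!: mult_nonneg_nonneg)
  also have "\<dots> \<le> C * X\<^sup>2"
    unfolding C_def using V_pos b_pos by (auto simp: algebra_simps intro!: add_nonneg_nonneg mult_nonneg_nonneg)
  finally show "Q i j \<le> C * X\<^sup>2" .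
  show "0 \<le> Q i j" unfolding Q_def using assms a_nonneg b_pos V_pos by auto
qed

lemma Q_diff_le:
  assumes "0 \<le> h" "h \<le> m" "h \<le> i" "i \<le> X" "0 \<le> h'" "h' \<le> m" "h' \<le> j" "j \<le> X" "X \<ge> 1"
  shows "0 \<le> Q i j - Q (i - h) (j - h')" "Q i j - Q (i - h) (j - h') \<le> m * (C * X)"
proof -
  have eq: "Q i j - Q (i - h) (j - h') = h * (a1 + V * b1 * (2 * i - h)) + h' * (a2 + V * b2 * (2 * j - h'))"
    by (simp add: Q_def power2_eq_square algebra_simps)
  have nn: "0 \<le> a1 + V * b1 * (2 * i - h)" "0 \<le> a2 + V * b2 * (2 * j - h')"
    using assms a_nonneg V_pos b_pos by auto
  show "0 \<le> Q i j - Q (i - h) (j - h')" unfolding eq using nn assms by auto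
  have le: "a + V * b * (2 * i - h) \<le> a * X + V * b * (2 * X)"
    if "a \<ge> 0" "b > 0" "0 \<le> h" "i \<le> X" for a b i h
  proof (rule add_mono)
    show "a \<le> a * X" using mult_left_mono[of 1 X a] that assms by simp
    show "V * b * (2 * i - h) \<le> V * b * (2 * X)" using that V_pos by (intro mult_left_mono) auto
  qed
  have "h * (a1 + V * b1 * (2 * i - h)) \<le> m * (a1 * X + V * b1 * (2 * X))"
    using assms nn a_nonneg b_pos by (intro mult_mono[OF _ le]) auto
  moreover have "h' * (a2 + V * b2 * (2 * j - h')) \<le> m * (a2 * X + V * b2 * (2 * X))"
    using assms nn a_nonneg b_pos by (intro mult_mono[OF _ le]) auto
  ultimately have "h * (a1 + V * b1 * (2 * i - h)) + h' * (a2 + V * b2 * (2 * j - h'))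
     \<le> m * (a1 * X + V * b1 * (2 * X)) + m * (a2 * X + V * b2 * (2 * X))"
    by (rule add_mono)
  also have "\<dots> = m * (C * X)" by (simp add: C_def algebra_simps)
  finally show "Q i j - Q (i - h) (j - h') \<le> m * (C * X)" unfolding eq .
qed

text \<open>Averaging over all translations by \<open>{0..<m}\<^sup>4\<close> replaces the congruence by its density, at the cost of
  slightly enlarging the box and the range of \<open>S\<close>.\<close>

lemma card_congruence_le:
  assumes d: "d > 0" and m_def: "m = 2 * V * b3 * d" and k: "d dvd k" and mB: "m \<le> B"
  shows "real_of_int m * card {v\<in>box4 B X. lo \<le> Sv v \<and> Sv v \<le> hi \<and> m dvd Sv v - k}
     \<le> sigma_inv d * card {v\<in>box4 0 X. lo - m * (C * X) \<le> Sv v \<and> Sv v \<le> hi + m * (C * X)}"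
proof -
  have m: "m > 0" using d V_pos b_pos by (simp add: m_def)
  define N where "N = {v\<in>box4 B X. lo \<le> Sv v \<and> Sv v \<le> hi \<and> m dvd Sv v - k}"
  define W where "W = {v\<in>box4 0 X. lo - m * (C * X) \<le> Sv v \<and> Sv v \<le> hi + m * (C * X)}"
  define P where "P = (\<lambda>(x, x', y, y') (h, h', g, g'). m dvd S (h + x) (h' + x') (g + y) (g' + y') - k)"
  have finW: "finite W" unfolding W_def by simp
  have step: "real (card N) \<le> (\<Sum>w\<in>W. of_bool (P w h))" if h: "h \<in> box4 0 m" for h
  proof -
    obtain h1 h2 h3 h4 where h_eq: "h = (h1, h2, h3, h4)" by (metis prod_cases4)
    have hb: "0 \<le> h1" "h1 < m" "0 \<le> h2" "h2 < m" "0 \<le> h3" "h3 < m" "0 \<le> h4" "h4 < m"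
      using h unfolding h_eq box4_def by auto
    let ?f = "\<lambda>(i, i', j, j'). (i - h1, i' - h2, j - h3, j' - h4)"
    have "card N \<le> card {w\<in>W. P w h}"
    proof (rule card_inj_on_le[where f = ?f])
      show "inj_on ?f N" by (rule inj_onI) auto
      show "?f ` N \<subseteq> {w\<in>W. P w h}"
      proof
        fix w assume "w \<in> ?f ` N"
        then obtain i i' j j' where v: "(i, i', j, j') \<in> N" and w: "w = (i - h1, i' - h2, j - h3, j' - h4)"
          by auto
        have b: "B \<le> i" "i < X" "B \<le> i'" "i' < X" "B \<le> j" "j < X" "B \<le> j'" "j' < X"
          and S: "lo \<le> S i i' j j'" "S i i' j j' \<le> hi" "m dvd S i i' j j' - k"
          using v by (auto simp: N_def box4_def Sv_def)
        \<comment> \<open>Both increments of \<open>Q\<close> lie between 0 and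
          \<open>m * (C * X)\<close>, so their difference widens the range of \<open>S\<close> by
          \<open>m * (C * X)\<close> on either side and not by twice that.\<close>
        have "S i i' j j' - S (i - h1) (i' - h2) (j - h3) (j' - h4)
            = (Q i' j' - Q (i' - h2) (j' - h4)) - (Q i j - Q (i - h1) (j - h3))"
          by (simp add: S_def)
        moreover have "0 \<le> Q i' j' - Q (i' - h2) (j' - h4)"
          by (rule Q_diff_le(1)[where m = m and X = X]; use b hb mB m in linarith)
        moreover have "Q i' j' - Q (i' - h2) (j' - h4) \<le> m * (C * X)"
          by (rule Q_diff_le(2)[where m = m and X = X]; use b hb mB m in linarith)
        moreover have "0 \<le> Q i j - Q (i - h1) (j - h3)"
          by (rule Q_diff_le(1)[where m = m and X = X]; use b hb mB m in linarith)
        moreover have "Q i j - Q (i - h1) (j - h3) \<le> m * (C * X)"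
          by (rule Q_diff_le(2)[where m = m and X = X]; use b hb mB m in linarith)
        ultimately show "w \<in> {w\<in>W. P w h}"
          using b S hb mB by (auto simp: w W_def P_def h_eq box4_def Sv_def)
      qed
    qed (use finW in simp)
    moreover have "(\<Sum>w\<in>W. of_bool (P w h)) = real (card {w\<in>W. P w h})"
      using finW by (simp add: of_bool_def sum.If_cases Int_def)
    ultimately show ?thesis by simp
  qed
  have "real_of_int m ^ 4 * card N = (\<Sum>h\<in>box4 0 m. real (card N))"
    using m by (simp add: card_box4)
  also have "\<dots> \<le> (\<Sum>h\<in>box4 0 m. \<Sum>w\<in>W. of_bool (P w h))"
    by (intro sum_mono step)
  also have "\<dots> = (\<Sum>w\<in>W. \<Sum>h\<in>box4 0 m. of_bool (P w h))"
    by (rule sum.swap)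
  also have "\<dots> \<le> (\<Sum>w\<in>W. real_of_int m ^ 3 * sigma_inv d)"
  proof (rule sum_mono)
    fix w assume "w \<in> W"
    obtain x x' y y' where w: "w = (x, x', y, y')" by (metis prod_cases4)
    have "(\<Sum>h\<in>box4 0 m. of_bool (P w h))
        = (\<Sum>(h, h', g, g')\<in>box4 0 m. of_bool (m dvd S (h + x) (h' + x') (g + y) (g' + y') - k))"
      by (intro sum.cong refl) (auto simp: P_def w)
    also have "\<dots> \<le> real_of_int m ^ 3 * sigma_inv d"
      unfolding sum_box4 by (rule sum4_dvd_S_shifted_le[OF d m_def k])
    finally show "(\<Sum>h\<in>box4 0 m. of_bool (P w h)) \<le> real_of_int m ^ 3 * sigma_inv d" .
  qed
  also have "\<dots> = real_of_int m ^ 3 * (sigma_inv d * card W)" by simp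
  finally have "real_of_int m ^ 3 * (m * card N) \<le> real_of_int m ^ 3 * (sigma_inv d * card W)"
    by (simp add: power_numeral_reduce mult_ac)
  then show ?thesis using m unfolding N_def W_def by simp
qed

end

section \<open>Vectors with small, positive or zero difference \<open>S\<close>\<close>

lemma card_quadratic_interval_le:
  fixes \<alpha> \<beta> :: int and c z :: real
  assumes "\<alpha> \<ge> 0" "\<beta> \<ge> 1" "z \<ge> 0"
  shows "real (card {x\<in>{0..<X}. c < of_int (\<alpha> * x + \<beta> * x\<^sup>2) \<and> of_int (\<alpha> * x + \<beta> * x\<^sup>2) \<le> c + z}) \<le> 1 + sqrt z"
proof -
  let ?A = "{x\<in>{0..<X}. c < of_int (\<alpha> * x + \<beta> * x\<^sup>2) \<and> of_int (\<alpha> * x + \<beta> * x\<^sup>2) \<le> c + z}"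
  have fin: "finite ?A" by (rule finite_subset[of _ "{0..<X}"]) auto
  show ?thesis
  proof (cases "?A = {}")
    case True
    then show ?thesis using assms by (simp only: card.empty) simp
  next
    case False
    define x0 where "x0 = Min ?A"
    have x0: "x0 \<in> ?A" unfolding x0_def using fin False by (rule Min_in)
    have "?A \<subseteq> {x0..x0 + \<lfloor>sqrt z\<rfloor>}"
    proof
      fix x assume x: "x \<in> ?A"
      have le: "x0 \<le> x" unfolding x0_def using fin x by (rule Min_le)
      \<comment> \<open>Above the least solution \<open>x0\<close> the polynomial grows at least as
        fast as \<open>(x - x0)\<^sup>2\<close>, because \<open>\<alpha>\<close> and
        \<open>x0\<close> are nonnegative and \<open>\<beta> \<ge> 1\<close>. So all solutions lie
        within \<open>sqrt z\<close> of \<open>x0\<close>.\<close>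
      have "(x - x0)\<^sup>2 \<le> \<beta> * (x - x0)\<^sup>2" using assms by (simp add: mult_le_cancel_right1)
      also have "\<dots> \<le> \<beta> * (x - x0) * (x + x0)"
        using assms le x0 by (auto simp: power2_eq_square mult.assoc intro!: mult_left_mono)
      also have "\<dots> \<le> \<alpha> * (x - x0) + \<beta> * (x - x0) * (x + x0)" using assms le by simp
      also have "\<dots> = (\<alpha> * x + \<beta> * x\<^sup>2) - (\<alpha> * x0 + \<beta> * x0\<^sup>2)"
        by (simp add: power2_eq_square algebra_simps)
      finally have "real_of_int ((x - x0)\<^sup>2) \<le> of_int ((\<alpha> * x + \<beta> * x\<^sup>2) - (\<alpha> * x0 + \<beta> * x0\<^sup>2))"
        by (simp only: of_int_le_iff)
      also have "\<dots> \<le> z"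
        using x x0 by auto
      finally have "real_of_int (x - x0) \<le> sqrt z"
        using le by (intro real_le_rsqrt) auto
      then have "x - x0 \<le> \<lfloor>sqrt z\<rfloor>" by (simp only: le_floor_iff)
      with le show "x \<in> {x0..x0 + \<lfloor>sqrt z\<rfloor>}" by simp
    qed
    then have "card ?A \<le> card {x0..x0 + \<lfloor>sqrt z\<rfloor>}" by (intro card_mono) auto
    also have "\<dots> = nat (\<lfloor>sqrt z\<rfloor> + 1)" by simp
    finally have "int (card ?A) \<le> \<lfloor>sqrt z\<rfloor> + 1" using assms by (simp add: le_nat_iff)
    then have "real (card ?A) \<le> real_of_int \<lfloor>sqrt z\<rfloor> + 1" by linarith
    then show ?thesis using of_int_floor_le[of "sqrt z"] by linarith
  qed
qed

context qform
begin

lemma card_S_small: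
  assumes X: "X \<ge> 0" and z: "z \<ge> 0"
  shows "real (card {v\<in>box4 0 X. 0 < Sv v \<and> real_of_int (Sv v) \<le> z}) \<le> real_of_int X ^ 3 * (1 + sqrt z)"
proof -
  let ?I = "{0..<X} \<times> {0..<X} \<times> {0..<X}"
  define F where "F = (\<lambda>(i, j, j'). {i'\<in>{0..<X}. 0 < S i i' j j' \<and> real_of_int (S i i' j j') \<le> z})"
  have fin: "finite (F t)" for t unfolding F_def by (cases t) (auto intro: finite_subset[OF _ finite_atLeastLessThan_int[of 0 X]])
  have "card {v\<in>box4 0 X. 0 < Sv v \<and> real_of_int (Sv v) \<le> z} \<le> card (SIGMA t:?I. F t)"
  proof (rule card_inj_on_le[where f = "\<lambda>(i, i', j, j'). ((i, j, j'), i')"])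
    show "finite (SIGMA t:?I. F t)" using fin by (intro finite_SigmaI) auto
  qed (auto simp: inj_on_def box4_def Sv_def F_def)
  also have "\<dots> = (\<Sum>t\<in>?I. card (F t))" using fin by (intro card_SigmaI) auto
  finally have "real (card {v\<in>box4 0 X. 0 < Sv v \<and> real_of_int (Sv v) \<le> z}) \<le> (\<Sum>t\<in>?I. real (card (F t)))"
    by (simp only: of_nat_sum[symmetric] of_nat_le_iff)
  also have "\<dots> \<le> (\<Sum>t\<in>?I. 1 + sqrt z)"
  proof (rule sum_mono)
    fix t :: "int \<times> int \<times> int"
    obtain i j j' where t: "t = (i, j, j')" by (metis prod_cases3)
    define c where "c = Q i j - a2 * j' - V * b2 * j'\<^sup>2"
    have S: "S i i' j j' = (a1 * i' + V * b1 * i'\<^sup>2) - c" for i'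
      by (simp add: S_def Q_def c_def)
    have "F t = {x\<in>{0..<X}. real_of_int c < of_int (a1 * x + (V * b1) * x\<^sup>2) \<and>
             of_int (a1 * x + (V * b1) * x\<^sup>2) \<le> real_of_int c + z}"
    proof -
      have "0 < S i x j j' \<longleftrightarrow> real_of_int c < of_int (a1 * x + (V * b1) * x\<^sup>2)"
        "real_of_int (S i x j j') \<le> z \<longleftrightarrow> of_int (a1 * x + (V * b1) * x\<^sup>2) \<le> real_of_int c + z" for x
        unfolding S by (simp only: of_int_less_iff) linarith+
      then show ?thesis unfolding F_def t by simp
    qed
    moreover have "V * b1 \<ge> 1" using mult_pos_pos[OF V_pos b_pos(1)] by linarith
    ultimately show "real (card (F t)) \<le> 1 + sqrt z"
      using card_quadratic_interval_le[OF a_nonneg(1) _ z, of "V * b1" X "real_of_int c"] by simp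
  qed
  also have "\<dots> = real_of_int X ^ 3 * (1 + sqrt z)"
    using X by (simp add: card_cartesian_product power3_eq_cube)
  finally show ?thesis .
qed

text \<open>Exchanging the two points negates \<open>Sv\<close>. The factor 2 matters: the two
  orders of the third variables are counted separately, and without it the bound for the second
  moment would be twice the mean value.\<close>

lemma card_S_pos:
  assumes X: "X \<ge> 0"
  shows "2 * real (card {v\<in>box4 0 X. 0 < Sv v}) \<le> real_of_int X ^ 4"
proof -
  let ?P = "{v\<in>box4 0 X. 0 < Sv v}" and ?N = "{v\<in>box4 0 X. Sv v < 0}"
  have "bij_betw (\<lambda>(i, i', j, j'). (i', i, j', j)) ?P ?N"
    by (rule bij_betwI[where g = "\<lambda>(i, i', j, j'). (i', i, j', j)"]) (auto simp: box4_def Sv_def S_def)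
  then have "card ?P = card ?N" by (rule bij_betw_same_card)
  moreover have "card ?P + card ?N = card (?P \<union> ?N)"
    by (rule card_Un_disjoint[symmetric]) (auto intro: finite_subset[OF _ finite_box4])
  moreover have "card (?P \<union> ?N) \<le> card (box4 0 X)" by (rule card_mono) auto
  ultimately have "2 * card ?P \<le> card (box4 0 X)" by linarith
  then have "2 * real (card ?P) \<le> real (card (box4 0 X))" by linarith
  then show ?thesis using card_box4[OF X] by simp
qed

text \<open>By \<open>S_eq\<close>, a zero off the diagonal is an equality of two products of
  positive factors once \<open>i' < i\<close> is assumed; the case \<open>i < i'\<close> is
  symmetric and accounts for the factor 2. The left factor \<open>i - i'\<close> divides the right
  product, and the triple of this factor and the two right factors determines the vector, since the
  equation returns the remaining factor. So \<open>card_dvd_triples_le\<close> applies.\<close>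

lemma card_S_zero:
  assumes X: "X \<ge> 1"
  shows "real (card {v\<in>box4 0 X. Sv v = 0}) \<le> real_of_int X ^ 2 * (1 + 2 * C * (1 + ln X) ^ 2)"
proof -
  let ?Z = "{v\<in>box4 0 X. Sv v = 0}"
  let ?D = "(\<lambda>(i, j). (i, i, j, j)) ` ({0..<X} \<times> {0..<X})"
  let ?P = "{v\<in>?Z. case v of (i, i', j, j') \<Rightarrow> i' < i}"
  let ?P' = "{v\<in>?Z. case v of (i, i', j, j') \<Rightarrow> i < i'}"
  let ?T = "{(u, w, t). u \<in> {1..X} \<and> w \<in> {1..X} \<and> t \<in> {1..C * X} \<and> u dvd w * t}"
  let ?f = "\<lambda>(i, i', j, j'). (i - i', j' - j, a2 + V * b2 * (j + j'))"
  have pos: "V * b1 > 0" "V * b2 > 0" using V_pos b_pos by auto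
  have "?Z \<subseteq> ?D \<union> (?P \<union> ?P')"
  proof
    fix v assume v: "v \<in> ?Z"
    obtain i i' j j' where v_eq: "v = (i, i', j, j')" by (metis prod_cases4)
    have b: "0 \<le> i" "i < X" "0 \<le> i'" "i' < X" "0 \<le> j" "j < X" "0 \<le> j'" "j' < X" "S i i' j j' = 0"
      using v by (auto simp: v_eq box4_def Sv_def)
    show "v \<in> ?D \<union> (?P \<union> ?P')"
    proof (cases "i = i'")
      case True
      have "j = j'"
      proof (rule ccontr)
        assume "j \<noteq> j'"
        then have "j + j' > 0" using b by linarith
        then have "a2 + V * b2 * (j + j') > 0" using a_nonneg pos by (simp add: add_nonneg_pos)
        then show False using b(9) True \<open>j \<noteq> j'\<close> by (simp add: S_eq)
      qed
      then show ?thesis using True b v_eq by auto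
    next
      case False
      then show ?thesis using v v_eq by auto
    qed
  qed
  then have "card ?Z \<le> card (?D \<union> (?P \<union> ?P'))" by (intro card_mono) auto
  also have "\<dots> \<le> card ?D + card (?P \<union> ?P')" by (rule card_Un_le)
  also have "\<dots> \<le> card ?D + (card ?P + card ?P')" by (intro add_left_mono card_Un_le)
  also have "card ?P' = card ?P"
  proof (rule bij_betw_same_card)
    show "bij_betw (\<lambda>(i, i', j, j'). (i', i, j', j)) ?P' ?P"
      by (rule bij_betwI[where g = "\<lambda>(i, i', j, j'). (i', i, j', j)"]) (auto simp: box4_def Sv_def S_def)
  qed
  also have "card ?D \<le> card ({0..<X} \<times> {0..<X})" by (rule card_image_le) simp
  also have "card ({0..<X} \<times> {0..<X}) = nat X ^ 2" by (simp add: card_cartesian_product power2_eq_square)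
  also have "card ?P \<le> card ?T"
  proof (rule card_inj_on_le[where f = ?f])
    have eq: "(i - i') * (a1 + V * b1 * (i + i')) = (j' - j) * (a2 + V * b2 * (j + j'))"
      if "S i i' j j' = 0" for i i' j j'
      using that by (simp add: S_eq algebra_simps)
    show "inj_on ?f ?P"
    proof (rule inj_onI)
      fix v w assume v: "v \<in> ?P" and w: "w \<in> ?P"
        and f: "?f v
              = ?f w"
      obtain i i' j j' where v_eq: "v = (i, i', j, j')" by (metis prod_cases4)
      obtain k k' l l' where w_eq: "w = (k, k', l, l')" by (metis prod_cases4)
      have vS: "S i i' j j' = 0" "i' < i" and wS: "S k k' l l' = 0" "k' < k"
        using v w by (auto simp: v_eq w_eq Sv_def)
      have f1: "i - i' = k - k'" and f2: "j' - j = l' - l"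
        and f3: "a2 + V * b2 * (j + j') = a2 + V * b2 * (l + l')"
        using f by (auto simp: v_eq w_eq)
      have "V * b2 * (j + j') = V * b2 * (l + l')" using f3 by linarith
      then have "j + j' = l + l'" using pos(2) by (metis mult_cancel_left less_irrefl)
      moreover have "(i - i') * (a1 + V * b1 * (i + i')) = (k - k') * (a1 + V * b1 * (k + k'))"
        using eq[OF vS(1)] eq[OF wS(1)] f2 f3 by simp
      then have "a1 + V * b1 * (i + i') = a1 + V * b1 * (k + k')" using f1 vS(2) by simp
      then have "V * b1 * (i + i') = V * b1 * (k + k')" by linarith
      then have "i + i' = k + k'" using pos(1) by (metis mult_cancel_left less_irrefl)
      ultimately show "v = w" using f1 f2 unfolding v_eq w_eq by simp
    qed
    show "?f ` ?P \<subseteq> ?T"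
    proof
      fix t assume "t \<in> ?f ` ?P"
      then obtain i i' j j' where v: "(i, i', j, j') \<in> ?P"
        and t: "t = (i - i', j' - j, a2 + V * b2 * (j + j'))" by auto
      have b: "0 \<le> i" "i < X" "0 \<le> i'" "i' < i" "0 \<le> j" "j < X" "0 \<le> j'" "j' < X" "S i i' j j' = 0"
        using v by (auto simp: box4_def Sv_def)
      have "a1 + V * b1 * (i + i') > 0" using a_nonneg pos b by (simp add: add_nonneg_pos)
      then have "(j' - j) * (a2 + V * b2 * (j + j')) > 0" using eq[OF b(9)] b by (metis diff_gt_0_iff_gt mult_pos_pos)
      moreover have nn: "a2 + V * b2 * (j + j') \<ge> 0" using a_nonneg pos b by simp
      ultimately have p: "j' - j > 0" "a2 + V * b2 * (j + j') > 0" by (auto simp: zero_less_mult_iff)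
      have "a2 + V * b2 * (j + j') \<le> a2 * X + V * b2 * (2 * X)"
        using a_nonneg pos b X mult_left_mono[of 1 X a2] by (intro add_mono mult_left_mono) auto
      also have "\<dots> \<le> C * X"
      proof -
        have "0 \<le> a1 * X + V * b1 * (2 * X)" using a_nonneg pos X by simp
        then show ?thesis by (simp add: C_def algebra_simps)
      qed
      finally have "a2 + V * b2 * (j + j') \<le> C * X" .
      moreover have "i - i' dvd (j' - j) * (a2 + V * b2 * (j + j'))" using eq[OF b(9)] by (metis dvd_triv_left)
      ultimately show "t \<in> ?T" using b p unfolding t by auto
    qed
    show "finite ?T" by (rule finite_subset[of _ "{1..X} \<times> {1..X} \<times> {1..C * X}"]) auto
  qed
  finally have "card ?Z \<le> nat X ^ 2 + (card ?T + card ?T)" by simp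
  then have "real (card ?Z) \<le> real (nat X ^ 2) + 2 * real (card ?T)" by linarith
  also have "real (nat X ^ 2) = real_of_int X ^ 2" using X by simp
  also have "real (card ?T) \<le> X * (C * X) * (1 + ln X) ^ 2"
  proof -
    have "C * X \<ge> 0" using X a_nonneg V_pos b_pos by (simp add: C_def)
    from card_dvd_triples_le[OF X this] show ?thesis by simp
  qed
  finally show ?thesis by (simp add: power2_eq_square algebra_simps)
qed

end

section \<open>Second moment and the unrepresented values in a block\<close>

lemma card_square_le_collisions:
  assumes fin: "finite A"
  shows "real (card A) ^ 2 \<le> real (card (f ` A)) * real (card {(x, y). x \<in> A \<and> y \<in> A \<and> f x = f y})"
proof -
  let ?r = "\<lambda>n. card {x\<in>A. f x = n}"
  have sub: "finite {x\<in>A. f x = n}" for n using fin by simp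
  have "card A = (\<Sum>n\<in>f ` A. ?r n)"
    using card_UN_disjoint[of "f ` A" "\<lambda>n. {x\<in>A. f x = n}"] fin sub
    by (subst card_UN_disjoint[symmetric]) (auto intro!: arg_cong[where f = card])
  then have "real (card A) ^ 2 = (\<Sum>n\<in>f ` A. 1 * real (?r n)) ^ 2" by simp
  also have "\<dots> \<le> (\<Sum>n\<in>f ` A. 1\<^sup>2) * (\<Sum>n\<in>f ` A. real (?r n) ^ 2)"
    by (rule Cauchy_Schwarz_ineq_sum)
  also have "(\<Sum>n\<in>f ` A. real (?r n) ^ 2) = real (card (\<Union>n\<in>f ` A. {x\<in>A. f x = n} \<times> {x\<in>A. f x = n}))"
    using fin by (subst card_UN_disjoint) (auto simp: card_cartesian_product power2_eq_square)
  also have "(\<Union>n\<in>f ` A. {x\<in>A. f x = n} \<times> {x\<in>A. f x = n}) = {(x, y). x \<in> A \<and> y \<in> A \<and> f x = f y}"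
    by auto
  finally show ?thesis by simp
qed

context qform
begin

definition T :: "int \<Rightarrow> int" where "T k = a3 * k + V * b3 * k\<^sup>2"

lemma T_diff: "T k - T k' = (k - k') * (a3 + V * b3 * (k + k'))"
  by (simp add: T_def power2_eq_square algebra_simps)

text \<open>For each \<open>d = k - k'\<close> the collisions are relaxed to a congruence on
  \<open>v\<close> and a size condition on \<open>Sv v\<close>, counted by
  \<open>card_congruence_le\<close>. Interchanging the sums, a fixed \<open>v\<close> meets
  \<open>sigma_inv d / d\<close> for \<open>d\<close> between \<open>Sv v / s1\<close> and
  \<open>Sv v / s0\<close>. This range always has the same ratio, so the logarithm does not depend
  on \<open>v\<close>.\<close>

lemma card_offdiagonal_le:
  fixes B X L L1 :: int and M :: nat and \<kappa> :: real
  assumes X: "1 \<le> X" and B: "0 \<le> B" and L: "C * X < L" "C * X\<^sup>2 \<le> B * L" "L < L1"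
    and M: "M \<ge> 1" "\<And>p. prime p \<Longrightarrow> p \<le> int M \<Longrightarrow> p dvd V" and k: "\<kappa> > 0"
  defines "s0 \<equiv> 2 * V * b3 * (L - C * X)" and "s1 \<equiv> a3 + 2 * V * b3 * (L1 + C * X)"
  shows "real (card {(v, k, k'). v \<in> box4 B X \<and> k \<in> {L..<L1} \<and> k' \<in> {L..<L1} \<and> k' < k \<and> Sv v = T k - T k'})
    \<le> 1 / (2 * V * b3) * (X ^ 4 / 2 * ((1 + 1 / M) * ln (s1 / s0) + 3 / sqrt \<kappa>)
        + 2 * (X ^ 3 * (1 + sqrt (\<kappa> * s1))))"
proof -
  \<comment> \<open>Larger \<open>d\<close> do not occur, because a collision forces \<open>2 * V *
    b3 * d * L \<le> Sv v \<le> C * X\<^sup>2 \<le> B * L\<close>. This keeps the modulus within the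
    margin \<open>B\<close>.\<close>
  define D where "D = {d. 1 \<le> d \<and> 2 * V * b3 * d \<le> B}"
  define m where "m d = 2 * V * b3 * d" for d
  \<comment> \<open>\<open>T (k' + d) - T k'\<close> equals \<open>kap d + m d * k'\<close>. Keeping
    only the congruence modulo \<open>m d\<close> forgets \<open>k'\<close>, which is harmless since
    \<open>d\<close> and \<open>v\<close> determine it.\<close>
  define kap where "kap d = d * (a3 + V * b3 * d)" for d
  define N where "N d = {v\<in>box4 B X. d * (2 * V * b3 * L) \<le> Sv v \<and> Sv v \<le> d * (a3 + 2 * V * b3 * L1) \<and> m d dvd Sv v - kap d}" for d
  \<comment> \<open>\<open>s0\<close> and \<open>s1\<close> bound the quotient of
    \<open>T k - T k'\<close> by \<open>d\<close>, after the widening by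
    \<open>m d * (C * X)\<close> that \<open>card_congruence_le\<close> costs.\<close>
  define W where "W d = {v\<in>box4 0 X. d * s0 \<le> Sv v \<and> Sv v \<le> d * s1}" for d
  define P where "P = {v\<in>box4 0 X. 0 < Sv v}"
  define lg where "lg = (1 + 1 / M) * ln (s1 / s0)"
  have Vb: "V * b3 > 0" using V_pos b_pos by simp
  have C0: "C * X \<ge> 0" using X a_nonneg V_pos b_pos by (simp add: C_def)
  have L0: "L > 0" using L C0 by linarith
  have s0: "s0 > 0" unfolding s0_def using Vb L by (simp add: zero_less_mult_iff)
  have s01: "s0 \<le> s1"
  proof -
    have "2 * (V * b3) * (L - C * X) \<le> 2 * (V * b3) * (L1 + C * X)" using Vb L C0 by (intro mult_left_mono; linarith)
    then show ?thesis unfolding s0_def s1_def using a_nonneg by (simp add: mult.assoc)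
  qed
  have lg0: "lg \<ge> 0" unfolding lg_def using s0 s01 by simp
  have finD: "finite D"
  proof (rule finite_subset)
    show "D \<subseteq> {1..B}"
    proof
      fix d assume d: "d \<in> D"
      have "1 * d \<le> 2 * V * b3 * d" using d Vb by (intro mult_right_mono) (auto simp: D_def)
      also have "\<dots> \<le> B" using d by (simp only: D_def mem_Collect_eq)
      finally show "d \<in> {1..B}" using d by (auto simp: D_def)
    qed
  qed simp
  have finN: "finite (N d)" and finW: "finite (W d)" for d by (auto simp: N_def W_def)
  have finP: "finite P" by (simp add: P_def)
  have "card {(v, k, k'). v \<in> box4 B X \<and> k \<in> {L..<L1} \<and> k' \<in> {L..<L1} \<and> k' < k \<and> Sv v = T k - T k'}
      \<le> card (SIGMA d:D. N d)" (is "card ?O \<le> _")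
  proof (rule card_inj_on_le[where f = "\<lambda>(v, k, k'). (k - k', v)"])
    show "inj_on (\<lambda>(v, k, k'). (k - k', v)) ?O"
    proof (rule inj_onI)
      fix x y assume x: "x \<in> ?O" and y: "y \<in> ?O"
        and eq: "(\<lambda>(v, k, k'). (k - k', v)) x = (\<lambda>(v, k, k'). (k - k', v)) y"
      obtain v k k' where x_eq: "x = (v, k, k')" by (metis prod_cases3)
      obtain w l l' where y_eq: "y = (w, l, l')" by (metis prod_cases3)
      have e: "k - k' = l - l'" "v = w" "k' < k" using eq x by (auto simp: x_eq y_eq)
      have "(k - k') * (a3 + V * b3 * (k + k')) = (l - l') * (a3 + V * b3 * (l + l'))"
        using x y e(2) unfolding x_eq y_eq by (auto simp: T_diff)
      then have "a3 + V * b3 * (k + k') = a3 + V * b3 * (l + l')" using e by simp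
      then have "V * b3 * (k + k') = V * b3 * (l + l')" by linarith
      then have "k + k' = l + l'" using Vb by (metis mult_cancel_left less_irrefl)
      then show "x = y" using e by (simp add: x_eq y_eq)
    qed
    show "(\<lambda>(v, k, k'). (k - k', v)) ` ?O \<subseteq> (SIGMA d:D. N d)"
    proof
      fix z assume "z \<in> (\<lambda>(v, k, k'). (k - k', v)) ` ?O"
      then obtain v k k' where o: "v \<in> box4 B X" "L \<le> k" "k < L1" "L \<le> k'" "k' < L1" "k' < k" "Sv v = T k - T k'"
        and z: "z = (k - k', v)" by auto
      define d where "d = k - k'"
      have d: "d \<ge> 1" using o by (simp add: d_def)
      have S: "Sv v = d * (a3 + V * b3 * (k + k'))" using o(7) by (simp add: T_diff d_def)
      have "V * b3 * (2 * L) \<le> V * b3 * (k + k')" using o Vb by (intro mult_left_mono) auto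
      then have "2 * V * b3 * L \<le> a3 + V * b3 * (k + k')" using a_nonneg by (simp add: mult_ac)
      then have lo: "d * (2 * V * b3 * L) \<le> Sv v" unfolding S using d by (intro mult_left_mono) auto
      have "V * b3 * (k + k') \<le> V * b3 * (2 * L1)" using o Vb by (intro mult_left_mono) auto
      then have "a3 + V * b3 * (k + k') \<le> a3 + 2 * V * b3 * L1" by (simp add: mult_ac)
      then have hi: "Sv v \<le> d * (a3 + 2 * V * b3 * L1)" unfolding S using d by (intro mult_left_mono) auto
      obtain i i' j j' where v: "v = (i, i', j, j')" by (metis prod_cases4)
      have b: "0 \<le> i" "i \<le> X" "0 \<le> i'" "i' \<le> X" "0 \<le> j" "j \<le> X" "0 \<le> j'" "j' \<le> X"
        using o(1) B by (auto simp: v box4_def)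
      have "Sv v \<le> C * X\<^sup>2"
        using Q_le(1)[of i X j] Q_le(2)[of i' X j'] b X by (simp add: v Sv_def S_def)
      then have "m d * L \<le> B * L" using lo L(2) by (simp add: m_def mult_ac)
      then have "m d \<le> B" using L0 by simp
      then have dD: "d \<in> D" using d by (simp add: D_def m_def)
      have "Sv v - kap d = m d * k'" unfolding S kap_def m_def d_def by (simp add: algebra_simps)
      then have "m d dvd Sv v - kap d" by simp
      then show "z \<in> (SIGMA d:D. N d)" using dD lo hi o(1) unfolding z d_def[symmetric] N_def by simp
    qed
    show "finite (SIGMA d:D. N d)" using finD finN by (intro finite_SigmaI) auto
  qed
  also have "\<dots> = (\<Sum>d\<in>D. card (N d))" using finD finN by (intro card_SigmaI) auto
  finally have "real (card ?O) \<le> (\<Sum>d\<in>D. real (card (N d)))"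
    by (simp only: of_nat_sum[symmetric] of_nat_le_iff)
  also have "\<dots> \<le> (\<Sum>d\<in>D. 1 / (2 * V * b3) * (\<Sum>v\<in>P. sigma_inv d / d * of_bool (v \<in> W d)))"
  proof (rule sum_mono)
    fix d assume "d \<in> D"
    then have d: "d > 0" "m d \<le> B" by (auto simp: D_def m_def)
    have md: "real_of_int (m d) = 2 * V * b3 * d" "real_of_int (m d) > 0"
      using d(1) Vb by (auto simp: m_def zero_less_mult_iff)
    have "real_of_int (m d) * card (N d) \<le> sigma_inv d * card {v\<in>box4 0 X. d * (2 * V * b3 * L) - m d * (C * X) \<le> Sv v
         \<and> Sv v \<le> d * (a3 + 2 * V * b3 * L1) + m d * (C * X)}"
      unfolding N_def by (rule card_congruence_le[OF d(1) _ _ d(2)]) (auto simp: m_def kap_def)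
    also have "{v\<in>box4 0 X. d * (2 * V * b3 * L) - m d * (C * X) \<le> Sv v
         \<and> Sv v \<le> d * (a3 + 2 * V * b3 * L1) + m d * (C * X)} = W d"
      unfolding W_def m_def s0_def s1_def by (simp add: algebra_simps)
    also have "real (card (W d)) = (\<Sum>v\<in>P. of_bool (v \<in> W d))"
    proof -
      have "W d \<subseteq> P"
      proof
        fix v assume v: "v \<in> W d"
        have "0 < d * s0" using d s0 by simp
        then show "v \<in> P" using v by (auto simp: W_def P_def)
      qed
      then have "W d = P \<inter> {v. v \<in> W d}" by auto
      then show ?thesis using finP by (simp add: of_bool_def sum.If_cases)
    qed
    finally have "real (card (N d)) \<le> sigma_inv d / m d * (\<Sum>v\<in>P. of_bool (v \<in> W d))"
      using md by (simp add: field_simps)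
    then show "real (card (N d)) \<le> 1 / (2 * V * b3) * (\<Sum>v\<in>P. sigma_inv d / d * of_bool (v \<in> W d))"
      unfolding md by (simp only: sum_distrib_left[symmetric]) (simp add: mult_ac)
  qed
  also have "\<dots> = 1 / (2 * V * b3) * (\<Sum>v\<in>P. \<Sum>d\<in>D. sigma_inv d / d * of_bool (v \<in> W d))"
    by (simp only: sum.swap[of _ D P] sum_distrib_left)
  also have "\<dots> \<le> 1 / (2 * V * b3) * (\<Sum>v\<in>P. (lg + 3 / sqrt \<kappa>) + 2 * of_bool (real_of_int (Sv v) \<le> \<kappa> * s1))"
  proof (intro mult_left_mono sum_mono)
    fix v assume v: "v \<in> P"
    define a where "a = Sv v / s1"
    define b where "b = Sv v / s0"
    have S: "Sv v > 0" using v by (simp add: P_def)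
    have ab: "0 < a" "a \<le> b" unfolding a_def b_def using S s0 s01 by (auto intro!: divide_left_mono)
    have fin: "finite {d::int. d \<ge> 1 \<and> a \<le> real_of_int d \<and> real_of_int d \<le> b}"
      by (rule finite_subset[of _ "{1..\<lfloor>b\<rfloor>}"]) (auto simp: le_floor_iff)
    have sig0: "sigma_inv d \<ge> 0" for d by (auto simp: sigma_inv_def intro!: sum_nonneg)
    have "(\<Sum>d\<in>D. sigma_inv d / d * of_bool (v \<in> W d)) = (\<Sum>d\<in>{d\<in>D. v \<in> W d}. sigma_inv d / d)"
      using finD by (simp add: of_bool_def sum.If_cases if_distrib Int_def cong: if_cong)
    also have "\<dots> \<le> (\<Sum>d\<in>{d::int. d \<ge> 1 \<and> a \<le> real_of_int d \<and> real_of_int d \<le> b}. sigma_inv d / d)"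
    proof (rule sum_mono2[OF fin])
      show "{d\<in>D. v \<in> W d} \<subseteq> {d::int. d \<ge> 1 \<and> a \<le> real_of_int d \<and> real_of_int d \<le> b}"
      proof
        fix d assume "d \<in> {d\<in>D. v \<in> W d}"
        then have d: "d \<in> D" "v \<in> W d" by auto
        have "1 \<le> d" using d(1) by (simp add: D_def)
        have "real_of_int (d * s0) \<le> Sv v" "Sv v \<le> real_of_int (d * s1)"
          using d(2) unfolding W_def by (simp_all only: of_int_le_iff mem_Collect_eq)
        then have "a \<le> d" "d \<le> b" unfolding a_def b_def using s0 s01 by (auto simp: field_simps)
        with \<open>1 \<le> d\<close> show "d \<in> {d::int. d \<ge> 1 \<and> a \<le> real_of_int d \<and> real_of_int d \<le> b}" by simp
      qed
    qed (use sig0 in auto)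
    also have "\<dots> \<le> (1 + 1 / M) * ln (b / a) + min 2 (3 / sqrt a)"
      by (rule sum_sigma_inv_le[OF M ab])
    also have "b / a = s1 / s0" unfolding a_def b_def using S s0 s01 by simp
    \<comment> \<open>The parameter \<open>\<kappa>\<close> separates the bulk, where
      \<open>a > \<kappa>\<close> makes the error small, from the few vectors with small
      \<open>Sv v\<close>, where the error 2 is accepted.\<close>
    also have "min 2 (3 / sqrt a) \<le> 3 / sqrt \<kappa> + 2 * of_bool (real_of_int (Sv v) \<le> \<kappa> * s1)"
    proof (cases "real_of_int (Sv v) \<le> \<kappa> * s1")
      case True
      then show ?thesis using k by (simp add: min.coboundedI1)
    next
      case False
      then have "\<kappa> \<le> a" unfolding a_def using s0 s01 by (simp add: field_simps)
      then have "3 / sqrt a \<le> 3 / sqrt \<kappa>" using k by (intro divide_left_mono) auto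
      then show ?thesis using False by simp
    qed
    finally show "(\<Sum>d\<in>D. sigma_inv d / d * of_bool (v \<in> W d)) \<le> (lg + 3 / sqrt \<kappa>) + 2 * of_bool (real_of_int (Sv v) \<le> \<kappa> * s1)"
      by (simp add: lg_def)
  qed (use V_pos b_pos in auto)
  also have "(\<Sum>v\<in>P. (lg + 3 / sqrt \<kappa>) + 2 * of_bool (real_of_int (Sv v) \<le> \<kappa> * s1))
     = card P * (lg + 3 / sqrt \<kappa>) + 2 * real (card {v\<in>P. real_of_int (Sv v) \<le> \<kappa> * s1})"
    using finP by (simp add: sum.distrib sum_distrib_left[symmetric] of_bool_def sum.If_cases Int_def)
  also have "1 / (2 * V * b3) * (card P * (lg + 3 / sqrt \<kappa>) + 2 * real (card {v\<in>P. real_of_int (Sv v) \<le> \<kappa> * s1}))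
     \<le> 1 / (2 * V * b3) * (X ^ 4 / 2 * (lg + 3 / sqrt \<kappa>) + 2 * (X ^ 3 * (1 + sqrt (\<kappa> * s1))))"
  proof (intro mult_left_mono add_mono mult_right_mono)
    show "real (card P) \<le> X ^ 4 / 2" using card_S_pos[of X] X by (simp add: P_def)
    show "real (card {v\<in>P. real_of_int (Sv v) \<le> \<kappa> * s1}) \<le> X ^ 3 * (1 + sqrt (\<kappa> * s1))"
      using card_S_small[of X "\<kappa> * s1"] X k s0 s01 by (simp add: P_def conj_assoc)
  qed (use V_pos b_pos lg0 k in auto)
  finally show ?thesis unfolding lg_def by simp
qed


definition G :: "int \<times> int \<times> int \<Rightarrow> int" where
  "G = (\<lambda>(i, j, k). Q i j + T k)"

definition offdiag_bound :: "nat \<Rightarrow> real \<Rightarrow> int \<Rightarrow> int \<Rightarrow> int \<Rightarrow> real" where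
  "offdiag_bound M \<kappa> X L L1 =
     1 / real_of_int (2 * V * b3) *
      (real_of_int X ^ 4 / 2 * ((1 + 1 / real M) *
           ln (real_of_int (a3 + 2 * V * b3 * (L1 + C * X)) / real_of_int (2 * V * b3 * (L - C * X)))
         + 3 / sqrt \<kappa>)
       + 2 * (real_of_int X ^ 3 * (1 + sqrt (\<kappa> * real_of_int (a3 + 2 * V * b3 * (L1 + C * X))))))"

lemma second_moment_le:
  fixes B X L L1 :: int and M :: nat and \<kappa> :: real
  assumes X: "1 \<le> X" and B: "0 \<le> B" and L: "C * X < L" "C * X\<^sup>2 \<le> B * L" "L < L1"
    and M: "M \<ge> 1" "\<And>p. prime p \<Longrightarrow> p \<le> int M \<Longrightarrow> p dvd V" and k: "\<kappa> > 0"
  defines "Box \<equiv> {B..<X} \<times> {B..<X} \<times> {L..<L1}"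
  shows "real (card {(x, y). x \<in> Box \<and> y \<in> Box \<and> G x = G y})
    \<le> (X ^ 2 * (1 + 2 * C * (1 + ln X) ^ 2)) * (L1 - L) + 2 * offdiag_bound M \<kappa> X L L1"
proof -
  let ?O = "{(v, k, k'). v \<in> box4 B X \<and> k \<in> {L..<L1} \<and> k' \<in> {L..<L1} \<and> k' < k \<and> Sv v = T k - T k'}"
  let ?O' = "{(v, k, k'). v \<in> box4 B X \<and> k \<in> {L..<L1} \<and> k' \<in> {L..<L1} \<and> k < k' \<and> Sv v = T k - T k'}"
  let ?Z = "{v\<in>box4 0 X. Sv v = 0}"
  let ?E = "{(v, k, k'). v \<in> box4 B X \<and> k \<in> {L..<L1} \<and> k' = k \<and> Sv v = 0}"
  let ?A = "{(v, k, k'). v \<in> box4 B X \<and> k \<in> {L..<L1} \<and> k' \<in> {L..<L1} \<and> Sv v = T k - T k'}"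
  have fin: "finite (box4 B X \<times> {L..<L1} \<times> {L..<L1})" by simp
  have finA: "finite ?A" by (rule finite_subset[OF _ fin]) auto
  have "card {(x, y). x \<in> Box \<and> y \<in> Box \<and> G x = G y} \<le> card ?A"
  proof (rule card_inj_on_le[where f = "\<lambda>((i, j, k), (i', j', k')). ((i, i', j, j'), k, k')"])
    show "inj_on (\<lambda>((i, j, k), (i', j', k')). ((i, i', j, j'), k, k')) {(x, y). x \<in> Box \<and> y \<in> Box \<and> G x = G y}"
      by (auto simp: inj_on_def)
    show "(\<lambda>((i, j, k), (i', j', k')). ((i, i', j, j'), k, k')) ` {(x, y). x \<in> Box \<and> y \<in> Box \<and> G x = G y} \<subseteq> ?A"
      by (auto simp: Box_def G_def box4_def Sv_def S_def)
  qed (rule finA)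
  also have "?A \<subseteq> ?E \<union> (?O \<union> ?O')"
  proof
    fix x assume x: "x \<in> ?A"
    obtain v k k' where x_eq: "x = (v, k, k')" by (metis prod_cases3)
    show "x \<in> ?E \<union> (?O \<union> ?O')"
      using x unfolding x_eq by (cases k k' rule: linorder_cases) auto
  qed
  then have "card ?A \<le> card (?E \<union> (?O \<union> ?O'))"
    by (intro card_mono finite_subset[OF _ fin]) auto
  also have "\<dots> \<le> card ?E + card (?O \<union> ?O')" by (rule card_Un_le)
  also have "\<dots> \<le> card ?E + (card ?O + card ?O')" by (intro add_left_mono card_Un_le)
  also have "card ?O' = card ?O"
  proof (rule bij_betw_same_card)
    show "bij_betw (\<lambda>((i, i', j, j'), k, k'). ((i', i, j', j), k', k)) ?O' ?O"
      by (rule bij_betwI[where g = "\<lambda>((i, i', j, j'), k, k'). ((i', i, j', j), k', k)"])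
         (auto simp: box4_def Sv_def S_def)
  qed
  also have "card ?E \<le> card (?Z \<times> {L..<L1})"
  proof (rule card_inj_on_le[where f = "\<lambda>(v, k, k'). (v, k)"])
    show "(\<lambda>(v, k, k'). (v, k)) ` ?E \<subseteq> ?Z \<times> {L..<L1}"
      using B by (auto simp: box4_def)
  qed (auto simp: inj_on_def)
  also have "card (?Z \<times> {L..<L1}) = card ?Z * nat (L1 - L)" by (simp add: card_cartesian_product)
  finally have "card {(x, y). x \<in> Box \<and> y \<in> Box \<and> G x = G y} \<le> card ?Z * nat (L1 - L) + (card ?O + card ?O)" by simp
  then have "real (card {(x, y). x \<in> Box \<and> y \<in> Box \<and> G x = G y})
     \<le> real (card ?Z * nat (L1 - L) + (card ?O + card ?O))" by (simp only: of_nat_le_iff)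
  also have "\<dots> = real (card ?Z) * (L1 - L) + 2 * real (card ?O)" using L(3) by simp
  also have "\<dots> \<le> (X ^ 2 * (1 + 2 * C * (1 + ln X) ^ 2)) * (L1 - L) + 2 * offdiag_bound M \<kappa> X L L1"
  proof (intro add_mono mult_right_mono mult_left_mono)
    show "real (card ?Z) \<le> X ^ 2 * (1 + 2 * C * (1 + ln X) ^ 2)"
      using card_S_zero[OF X] by simp
    show "real (card ?O) \<le> offdiag_bound M \<kappa> X L L1"
      using card_offdiagonal_le[OF X B L M k] unfolding offdiag_bound_def by (simp only: of_int_power)
  qed (use L in auto)
  finally show ?thesis .
qed

text \<open>The intervals are half-open so that consecutive blocks tile. Admitting only nonnegative
  arguments can only enlarge the set, which is safe because just upper bounds are wanted.\<close>

definition unrepresented :: "int \<Rightarrow> int \<Rightarrow> int set" where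
  "unrepresented A A' = {n\<in>{A<..A'}. \<not> (\<exists>i j k. 0 \<le> i \<and> 0 \<le> j \<and> 0 \<le> k \<and> n = G (i, j, k))}"

text \<open>The values of \<open>G\<close> on the box and the unrepresented numbers are disjoint and
  share an interval that exceeds the block only by the overspill
  \<open>C * X\<^sup>2 + a3 * L1\<close>. The subtracted quotient is the Cauchy-Schwarz lower bound
  for the number of values.\<close>

lemma card_unrepresented_block_le:
  fixes B X L L1 :: int and M :: nat and \<kappa> :: real
  assumes X: "1 \<le> X" and B: "0 \<le> B" "B \<le> X" and L: "C * X < L" "C * X\<^sup>2 \<le> B * L" "L < L1"
    and M: "M \<ge> 1" "\<And>p. prime p \<Longrightarrow> p \<le> int M \<Longrightarrow> p dvd V" and k: "\<kappa> > 0"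
    and bound: "(X ^ 2 * (1 + 2 * C * (1 + ln X) ^ 2)) * (L1 - L) + 2 * offdiag_bound M \<kappa> X L L1 \<le> \<sigma>" and \<sigma>: "\<sigma> > 0"
  shows "real (card (unrepresented (V * b3 * L\<^sup>2) (V * b3 * L1\<^sup>2)))
     \<le> V * b3 * (L1\<^sup>2 - L\<^sup>2) + C * X\<^sup>2 + a3 * L1 + 1 - ((X - B) ^ 2 * (L1 - L)) ^ 2 / \<sigma>"
proof -
  define Box where "Box = {B..<X} \<times> {B..<X} \<times> {L..<L1}"
  define A where "A = V * b3 * L\<^sup>2"
  define A1 where "A1 = V * b3 * L1\<^sup>2"
  define e where "e = C * X\<^sup>2 + a3 * L1"
  have C0: "C \<ge> 0" using a_nonneg V_pos b_pos by (simp add: C_def)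
  then have "C * X \<ge> 0" using X by simp
  then have L0: "L > 0" using L by linarith
  have e0: "e \<ge> 0" using C0 L0 L a_nonneg unfolding e_def by simp
  have AA1: "A \<le> A1" unfolding A_def A1_def using L0 L V_pos b_pos
    by (intro mult_left_mono power_mono) auto
  have finBox: "finite Box" by (simp add: Box_def)
  have "card Box = nat (X - B) * (nat (X - B) * nat (L1 - L))" by (simp add: Box_def card_cartesian_product)
  then have cardBox: "real (card Box) = (X - B) ^ 2 * (L1 - L)"
    using B L by (simp add: power2_eq_square)
  have range: "A \<le> G x \<and> G x \<le> A1 + e" if "x \<in> Box" for x
  proof -
    obtain i j k where x: "x = (i, j, k)" by (metis prod_cases3)
    have b: "0 \<le> i" "i \<le> X" "0 \<le> j" "j \<le> X" "L \<le> k" "k \<le> L1"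
      using that B by (auto simp: x Box_def)
    have Q: "0 \<le> Q i j" "Q i j \<le> C * X\<^sup>2" using Q_le[OF b(1-4) X] by auto
    have "L\<^sup>2 \<le> k\<^sup>2" "k\<^sup>2 \<le> L1\<^sup>2" using b L0 by (auto intro: power_mono)
    then have "V * b3 * L\<^sup>2 \<le> V * b3 * k\<^sup>2" "V * b3 * k\<^sup>2 \<le> V * b3 * L1\<^sup>2"
      using V_pos b_pos by (auto intro!: mult_left_mono)
    moreover have "0 \<le> a3 * k" "a3 * k \<le> a3 * L1" using a_nonneg b L0 by (auto intro!: mult_left_mono)
    ultimately show ?thesis using Q unfolding x G_def T_def A_def A1_def e_def by simp
  qed
  have "real (card Box) ^ 2 \<le> real (card (G ` Box)) * real (card {(x, y). x \<in> Box \<and> y \<in> Box \<and> G x = G y})"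
    by (rule card_square_le_collisions[OF finBox])
  also have "\<dots> \<le> real (card (G ` Box)) * \<sigma>"
    using second_moment_le[OF X B(1) L M k] bound unfolding Box_def by (intro mult_left_mono) auto
  finally have low: "((X - B) ^ 2 * (L1 - L)) ^ 2 / \<sigma> \<le> real (card (G ` Box))"
    unfolding cardBox using \<sigma> by (simp add: field_simps)
  have "G ` Box \<union> unrepresented A A1 \<subseteq> {A..A1 + e}"
    using range e0 AA1 by (auto simp: unrepresented_def)
  moreover have "G ` Box \<inter> unrepresented A A1 = {}"
  proof -
    have "G x \<notin> unrepresented A A1" if "x \<in> Box" for x
    proof -
      obtain i j k where x: "x = (i, j, k)" by (metis prod_cases3)
      have "0 \<le> i" "0 \<le> j" "0 \<le> k" using that B L0 by (auto simp: x Box_def)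
      then show ?thesis by (auto simp: x unrepresented_def)
    qed
    then show ?thesis by auto
  qed
  moreover have "finite (unrepresented A A1)"
    unfolding unrepresented_def by (rule finite_subset[of _ "{A<..A1}"]) auto
  ultimately have "card (G ` Box) + card (unrepresented A A1) \<le> card {A..A1 + e}"
    using finBox card_Un_disjoint[of "G ` Box" "unrepresented A A1"] card_mono[of "{A..A1 + e}"]
    by (metis finite_atLeastAtMost_int finite_imageI)
  also have "card {A..A1 + e} = nat (A1 + e - A + 1)" by simp
  finally have "int (card (G ` Box) + card (unrepresented A A1)) \<le> A1 + e - A + 1"
    using AA1 e0 by linarith
  then have "real_of_int (int (card (G ` Box) + card (unrepresented A A1))) \<le> real_of_int (A1 + e - A + 1)"
    by (simp only: of_int_le_iff)
  then have "real (card (G ` Box)) + real (card (unrepresented A A1)) \<le> real_of_int (A1 + e - A + 1)"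
    by simp
  moreover have "real_of_int (A1 + e - A + 1) = V * b3 * (L1\<^sup>2 - L\<^sup>2) + C * X\<^sup>2 + a3 * L1 + 1"
    unfolding A_def A1_def e_def by (simp add: algebra_simps)
  ultimately show ?thesis using low unfolding A_def A1_def by linarith
qed

end

section \<open>Asymptotics of the second moment\<close>

text \<open>The bound for the number of collisions with \<open>X = x^3\<close>, \<open>L = (q - 1) x^4\<close>, \<open>L1 = q x^4\<close> and \<open>\<kappa> = x\<close>.\<close>

definition moment_bound :: "real \<Rightarrow> real \<Rightarrow> real \<Rightarrow> real \<Rightarrow> real \<Rightarrow> real" where
  "moment_bound g q c a x = (x^3)^2 * (1 + 2 * c * (1 + ln (x^3))^2) * x^4
     + 2 * (1 / (2*g) * ((x^3)^4/2 * ((1 + 1/q) * ln ((a + 2*g*(q * x^4 + c * x^3)) / (2*g*((q-1)*x^4 - c * x^3))) + 3 / sqrt x)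
        + 2 * ((x^3)^3 * (1 + sqrt (x * (a + 2*g*(q * x^4 + c * x^3)))))))"

text \<open>Against \<open>x^12\<close>, the collisions with equal third variable are of size
  \<open>x^10 * (ln x)^2\<close>, the vectors with small difference contribute about
  \<open>x^(23/2)\<close>, and \<open>3 / sqrt x\<close> tends to 0. Only the logarithm survives,
  with \<open>s1 / s0\<close> tending to \<open>q / (q - 1)\<close>.\<close>

lemma moment_bound_asymptotics:
  fixes g q c a :: real
  assumes "g > 0" "q > 1" "c > 0"
  shows "((\<lambda>x. moment_bound g q c a x / x^12) \<longlongrightarrow> (1 + 1/q) * ln (q / (q-1)) / (2*g)) at_top"
proof -
  have "((\<lambda>x. moment_bound g q c a x / x^12) \<longlongrightarrow> (1 + 1/q) * ln (g * (q * (inverse g * inverse (q - 1)))) / (2*g)) at_top"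
    unfolding moment_bound_def using assms by real_asymp
  also have "g * (q * (inverse g * inverse (q - 1))) = q / (q - 1)"
    using assms by (simp add: field_simps)
  finally show ?thesis .
qed

lemma eventually_moment_bound_pos:
  fixes g q c a :: real
  assumes "g > 0" "q > 1" "c > 0"
  shows "eventually (\<lambda>x. moment_bound g q c a x > 0) at_top"
proof -
  have "(1 + 1/q) * ln (q / (q-1)) / (2*g) > 0"
    using assms by (auto intro!: divide_pos_pos mult_pos_pos add_pos_pos)
  from order_tendstoD(1)[OF moment_bound_asymptotics[OF assms] this] eventually_gt_at_top[of 0]
  show ?thesis by eventually_elim (simp add: zero_less_divide_iff)
qed

text \<open>With \<open>l\<close> the limit of the scaled moment, the values number about
  \<open>x^8 / l\<close>, and \<open>ln (q / (q - 1)) \<le> 1 / (q - 1)\<close> bounds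
  \<open>1 / l\<close> from below. Compared with the block length
  \<open>g * (2 * q - 1) * x^8\<close> the deficit is a fraction of order \<open>1 / q\<close>; the
  strict inequality between the limits absorbs all lower-order terms.\<close>

lemma eventually_block_bound:
  fixes g q c a :: real
  assumes g: "g > 0" and q: "q \<ge> 2" and c: "c > 0"
  shows "eventually (\<lambda>x. g * (2*q-1) * x^8 + c * x^6 + a * q * x^4 + 1
            - ((x^3 - c * x^2)^2 * x^4)^2 / moment_bound g q c a x \<le> 3 / q * (g * (2*q-1) * x^8)) at_top"
proof -
  define l where "l = (1 + 1/q) * ln (q / (q-1)) / (2*g)"
  have l0: "l > 0"
    unfolding l_def using g q by (auto intro!: divide_pos_pos mult_pos_pos add_pos_pos)
  have "ln (q / (q - 1)) \<le> q / (q - 1) - 1" using q by (intro ln_le_minus_one) auto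
  also have "\<dots> = 1 / (q - 1)" using q by (simp add: field_simps)
  finally have "l \<le> (1 + 1/q) * (1 / (q - 1)) / (2 * g)"
    unfolding l_def using g q by (intro divide_right_mono mult_left_mono) auto
  also have "\<dots> = (q + 1) / (2 * g * q * (q - 1))" using g q by (simp add: field_simps)
  finally have "1 / ((q + 1) / (2 * g * q * (q - 1))) \<le> 1 / l" using l0 by (intro divide_left_mono) (use g q in auto)
  then have inv_l: "2 * g * q * (q - 1) / (q + 1) \<le> 1 / l" by simp
  \<comment> \<open>The constant 3 arises here: the deficit per \<open>g * x^8\<close> is
    \<open>(3 * q - 1) / (q + 1) < 3\<close>, while \<open>3 / q\<close> of the block length is
    \<open>6 - 3 / q\<close>, which is at least 3.\<close>
  have "(2 * q - 1) - 2 * q * (q - 1) / (q + 1) < 3 / q * (2 * q - 1)"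
  proof -
    have "(2 * q - 1) - 2 * q * (q - 1) / (q + 1) = (3 * q - 1) / (q + 1)" using q by (simp add: field_simps)
    also have "\<dots> < 3" using q by (simp add: field_simps)
    also have "3 \<le> 3 / q * (2 * q - 1)" using q by (simp add: field_simps)
    finally show ?thesis .
  qed
  then have "g * ((2 * q - 1) - 2 * q * (q - 1) / (q + 1)) < g * (3 / q * (2 * q - 1))"
    using g by (rule mult_strict_left_mono)
  then have "g * (2 * q - 1) - 2 * g * q * (q - 1) / (q + 1) < 3 / q * (g * (2 * q - 1))"
    by (simp add: algebra_simps)
  with inv_l have less: "g * (2 * q - 1) - 1 / l < 3 / q * (g * (2 * q - 1))" by linarith
  have 1: "((\<lambda>x. (g * (2*q-1) * x^8 + c * x^6 + a * q * x^4 + 1) / x^8) \<longlongrightarrow> g * (2 * q - 1)) at_top"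
    using g q c by real_asymp
  have 2: "((\<lambda>x. ((x^3 - c * x^2)^2 * x^4)^2 / x^20) \<longlongrightarrow> 1) at_top"
    using c by real_asymp
  have 3: "((\<lambda>x. moment_bound g q c a x / x^12) \<longlongrightarrow> l) at_top"
    unfolding l_def using g q c by (intro moment_bound_asymptotics) auto
  have "((\<lambda>x. (g * (2*q-1) * x^8 + c * x^6 + a * q * x^4 + 1) / x^8
        - (((x^3 - c * x^2)^2 * x^4)^2 / x^20) / (moment_bound g q c a x / x^12)) \<longlongrightarrow> g * (2 * q - 1) - 1 / l) at_top"
    using l0 by (intro tendsto_diff tendsto_divide 1 2 3) auto
  from order_tendstoD(2)[OF this less] eventually_gt_at_top[of 0]
  show ?thesis
  proof eventually_elim
    case (elim x)
    define s where "s = moment_bound g q c a x"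
    define y where "y = ((x^3 - c * x^2)^2 * x^4)^2"
    define z where "z = g * (2*q-1) * x^8 + c * x^6 + a * q * x^4 + 1"
    have "(y / x^20) / (s / x^12) = y / s / x^8"
    proof -
      have "x ^ 20 = x ^ 12 * x ^ 8" by (simp flip: power_add)
      moreover have "(y / (p * r)) / (s / p) = y / s / r" if "p > 0" for p r :: real
        using that by (simp add: field_simps)
      from this[of "x ^ 12" "x ^ 8"] elim(2) have "(y / (x ^ 12 * x ^ 8)) / (s / x ^ 12) = y / s / x ^ 8"
        by (simp only: zero_less_power simp_thms)
      ultimately show ?thesis by (simp only:)
    qed
    then have "z / x^8 - y / s / x^8 < 3 / q * (g * (2 * q - 1))"
      using elim(1) by (simp only: s_def y_def z_def)
    then have "(z - y / s) / x^8 < 3 / q * (g * (2 * q - 1))" by (simp only: diff_divide_distrib)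
    then have "z - y / s < 3 / q * (g * (2 * q - 1)) * x^8" using elim(2) by (simp add: pos_divide_less_eq)
    then show ?case unfolding s_def y_def z_def by (simp add: mult.assoc)
  qed
qed

context qform
begin

lemma card_unrepresented_block_eventually_le:
  fixes M :: nat
  assumes M: "M \<ge> 2" "\<And>p. prime p \<Longrightarrow> p \<le> int M \<Longrightarrow> p dvd V"
  shows "eventually (\<lambda>K::nat. real (card (unrepresented (V * b3 * ((int M - 1) * int K ^ 4)\<^sup>2) (V * b3 * (int M * int K ^ 4)\<^sup>2)))
     \<le> 3 / M * (V * b3 * (2 * M - 1) * K ^ 8)) sequentially"
proof -
  define g where "g = real_of_int (V * b3)"
  \<comment> \<open>The same \<open>M\<close> controls the divisor sums and fixes the endpoints of
    the block, so both relative errors are of order \<open>1 / M\<close>, and the factor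
    \<open>1 + 1 / q\<close> in \<open>moment_bound\<close> is \<open>1 + 1 / M\<close>.\<close>
  define q where "q = real M"
  define c where "c = real_of_int C"
  define a where "a = real_of_int a3"
  have Vb: "V * b3 > 0" using V_pos b_pos by simp
  have C0: "C > 0" using a_nonneg V_pos b_pos by (simp add: C_def add_nonneg_pos add_pos_pos)
  have pos: "g > 0" "q \<ge> 2" "q > 1" "c > 0" using Vb C0 M(1) V_pos b_pos unfolding g_def q_def c_def by simp_all
  have ev1: "eventually (\<lambda>K::nat. moment_bound g q c a (real K) > 0) sequentially"
    using eventually_moment_bound_pos[OF pos(1,3,4)] filterlim_real_sequentially
    by (rule eventually_compose_filterlim)
  have ev2: "eventually (\<lambda>K::nat. g * (2*q-1) * real K^8 + c * real K^6 + a * q * real K^4 + 1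
            - ((real K^3 - c * real K^2)^2 * real K^4)^2 / moment_bound g q c a (real K)
            \<le> 3 / q * (g * (2*q-1) * real K^8)) sequentially"
    using eventually_block_bound[OF pos(1,2,4)] filterlim_real_sequentially
    by (rule eventually_compose_filterlim)
  show ?thesis using ev1 ev2 eventually_gt_at_top[of "nat C"]
  proof eventually_elim
    case (elim K)
    define X where "X = int K ^ 3"
    \<comment> \<open>With \<open>X\<close> of size \<open>K^3\<close> and \<open>L\<close> at least
      \<open>K^4\<close>, the requirement \<open>C * X\<^sup>2 \<le> B * L\<close> is met by a
      margin of order \<open>K^2\<close>, which is negligible against \<open>X\<close>.\<close>
    define B where "B = C * int K ^ 2"
    define L where "L = (int M - 1) * int K ^ 4"
    define L1 where "L1 = int M * int K ^ 4"
    have K: "int K > C" "int K \<ge> 1" using elim(3) C0 by linarith+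
    have X: "1 \<le> X" using K by (simp add: X_def)
    have B: "0 \<le> B" using C0 by (simp add: B_def)
    have "C * int K ^ 2 \<le> int K * int K ^ 2" using K by (intro mult_right_mono) auto
    then have BX: "B \<le> X" by (simp add: B_def X_def power3_eq_cube power2_eq_square)
    have "int K ^ 4 = 1 * int K ^ 4" by simp
    also have "\<dots> \<le> L" unfolding L_def using M(1) by (intro mult_right_mono) auto
    finally have KL: "int K ^ 4 \<le> L" .
    have "C * X < int K * X" using K X by (intro mult_strict_right_mono) auto
    also have "int K * X = int K ^ 4" by (simp add: X_def power_numeral_reduce)
    finally have L: "C * X < L" using KL by linarith
    have "C * X\<^sup>2 = B * int K ^ 4" by (simp add: X_def B_def flip: power_mult power_add)
    also have "\<dots> \<le> B * L" using KL B by (rule mult_left_mono)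
    finally have L': "C * X\<^sup>2 \<le> B * L" .
    have diff: "L1 - L = int K ^ 4" by (simp add: L1_def L_def algebra_simps)
    then have L1: "L < L1" using K by (smt (verit) zero_less_power)
    have k: "real K > 0" and M1: "M \<ge> 1" using K M by linarith+
    have "(real_of_int X ^ 2 * (1 + 2 * C * (1 + ln X) ^ 2)) * (L1 - L) + 2 * offdiag_bound M (real K) X L L1
        = moment_bound g q c a (real K)"
      using M(1) unfolding diff by (simp add: offdiag_bound_def moment_bound_def X_def L_def L1_def g_def q_def c_def a_def mult.assoc of_nat_diff)
    then have bound: "(real_of_int X ^ 2 * (1 + 2 * C * (1 + ln X) ^ 2)) * (L1 - L) + 2 * offdiag_bound M (real K) X L L1
        \<le> moment_bound g q c a (real K)" by simp
    have "real (card (unrepresented (V * b3 * L\<^sup>2) (V * b3 * L1\<^sup>2)))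
     \<le> V * b3 * (L1\<^sup>2 - L\<^sup>2) + C * X\<^sup>2 + a3 * L1 + 1 - ((X - B) ^ 2 * (L1 - L)) ^ 2 / moment_bound g q c a (real K)"
      using card_unrepresented_block_le[OF X B BX L L' L1 M1 M(2) k _ elim(1)] bound by simp
    also have "\<dots> = g * (2*q-1) * real K^8 + c * real K^6 + a * q * real K^4 + 1
            - ((real K^3 - c * real K^2)^2 * real K^4)^2 / moment_bound g q c a (real K)"
    proof -
      have "L1\<^sup>2 - L\<^sup>2 = (L1 - L) * (L1 + L)" by (simp add: power2_eq_square algebra_simps)
      also have "\<dots> = (2 * int M - 1) * int K ^ 8"
        unfolding diff L1_def L_def by (simp add: algebra_simps flip: power_add)
      finally have "real_of_int (L1\<^sup>2 - L\<^sup>2) = (2 * q - 1) * real K ^ 8" by (simp add: q_def)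
      moreover have "X\<^sup>2 = int K ^ 6" by (simp add: X_def flip: power_mult)
      ultimately show ?thesis unfolding diff
        by (simp add: g_def c_def a_def q_def X_def B_def L1_def)
    qed
    also have "\<dots> \<le> 3 / q * (g * (2*q-1) * real K^8)" by (rule elim(2))
    finally show ?case using M(1) unfolding L_def L1_def g_def q_def by (simp add: of_nat_diff)
  qed
qed


lemma card_unrepresented_le: "0 \<le> N \<Longrightarrow> real (card (unrepresented 0 N)) \<le> N"
proof -
  assume N: "0 \<le> N"
  have "card (unrepresented 0 N) \<le> card {0<..N}"
    by (rule card_mono) (auto simp: unrepresented_def)
  then have "int (card (unrepresented 0 N)) \<le> N" using N by simp
  then show ?thesis by linarith
qed

text \<open>Strong induction on \<open>N\<close>: choose \<open>K\<close> with
  \<open>A K \<le> N < A (Suc K)\<close> and descend to \<open>A' K\<close>. The block from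
  \<open>A' K\<close> to \<open>A K\<close> costs \<open>3 / M\<close> of its length. The tail from
  \<open>A K\<close> to \<open>N\<close> is counted trivially and charged another
  \<open>3 / M\<close> of that length. Hence \<open>6 / M\<close>.\<close>

lemma unrepresented_density_le:
  fixes M :: nat
  assumes M: "M \<ge> 2" "\<And>p. prime p \<Longrightarrow> p \<le> int M \<Longrightarrow> p dvd V"
  shows "\<exists>N0. \<forall>N\<ge>0. real (card (unrepresented 0 N)) \<le> 6 / M * N + N0"
proof -
  define A where "A K = V * b3 * (int M * int K ^ 4)\<^sup>2" for K
  define A' where "A' K = V * b3 * ((int M - 1) * int K ^ 4)\<^sup>2" for K
  define g where "g = real_of_int (V * b3)"
  define q where "q = real M"
  have Vb: "V * b3 > 0" using V_pos b_pos by simp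
  have g: "g > 0" using V_pos b_pos by (simp add: g_def)
  have q: "q \<ge> 2" using M(1) by (simp add: q_def)
  have A_eq: "real_of_int (A K) = g * q ^ 2 * real K ^ 8" for K
    by (simp add: A_def g_def q_def power_mult_distrib flip: power_mult)
  have A'_eq: "real_of_int (A' K) = g * (q - 1) ^ 2 * real K ^ 8" for K
    by (simp add: A'_def g_def q_def power_mult_distrib flip: power_mult)
  have AA': "g * (2 * q - 1) * real K ^ 8 = real_of_int (A K) - real_of_int (A' K)" for K
    unfolding A_eq A'_eq by (simp add: power2_eq_square algebra_simps)
  \<comment> \<open>Consecutive endpoints \<open>A K\<close> and \<open>A (Suc K)\<close> differ by
    a quantity of order \<open>K^7\<close>, while a block has length of order \<open>K^8\<close>;
    this is why the tail can be counted trivially.\<close>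
  have "((\<lambda>x. g * q ^ 2 * ((x + 1) ^ 8 - x ^ 8) / x ^ 8) \<longlongrightarrow> 0) at_top"
    using g q by real_asymp
  moreover have "0 < 3 / q * (g * (2 * q - 1))" using g q by simp
  ultimately have "eventually (\<lambda>x. g * q ^ 2 * ((x + 1) ^ 8 - x ^ 8) / x ^ 8 < 3 / q * (g * (2 * q - 1))) at_top"
    by (rule order_tendstoD(2))
  then have "eventually (\<lambda>x. g * q ^ 2 * ((x + 1) ^ 8 - x ^ 8) \<le> 3 / q * (g * (2 * q - 1)) * x ^ 8) at_top"
    using eventually_gt_at_top[of 0] by eventually_elim (simp add: pos_divide_less_eq)
  then have ev1: "eventually (\<lambda>K::nat. g * q ^ 2 * ((real K + 1) ^ 8 - real K ^ 8) \<le> 3 / q * (g * (2 * q - 1)) * real K ^ 8) sequentially"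
    using filterlim_real_sequentially by (rule eventually_compose_filterlim)
  have blk: "eventually (\<lambda>K::nat. real (card (unrepresented (A' K) (A K)))
     \<le> 3 / M * (V * b3 * (2 * M - 1) * K ^ 8)) sequentially"
    unfolding A_def A'_def by (rule card_unrepresented_block_eventually_le[OF M(1)]) (use M(2) in blast)
  have ev: "eventually (\<lambda>K. real_of_int (A (Suc K)) - A K \<le> 3 / q * (real_of_int (A K) - A' K) \<and>
      real (card (unrepresented (A' K) (A K))) \<le> 3 / q * (real_of_int (A K) - A' K)) sequentially"
    using ev1 blk
  proof eventually_elim
    case (elim K)
    have "real_of_int (A (Suc K)) - A K = g * q ^ 2 * ((real K + 1) ^ 8 - real K ^ 8)"
      unfolding A_eq by (simp add: algebra_simps)
    also have "\<dots> \<le> 3 / q * (g * (2 * q - 1) * real K ^ 8)" using elim(1) by (simp only: mult.assoc)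
    finally have 1: "real_of_int (A (Suc K)) - A K \<le> 3 / q * (real_of_int (A K) - A' K)" unfolding AA' .
    have "real_of_int (V * b3 * (2 * M - 1) * K ^ 8) = g * (2 * q - 1) * real K ^ 8"
      using M(1) by (simp add: g_def q_def of_nat_diff)
    then have "real (card (unrepresented (A' K) (A K))) \<le> 3 / q * (g * (2 * q - 1) * real K ^ 8)"
      using elim(2) unfolding q_def by (simp only:)
    then show ?case using 1 unfolding AA' by simp
  qed
  then obtain K0 where K0: "\<And>K. K \<ge> K0 \<Longrightarrow> real_of_int (A (Suc K)) - A K \<le> 3 / q * (real_of_int (A K) - A' K) \<and>
      real (card (unrepresented (A' K) (A K))) \<le> 3 / q * (real_of_int (A K) - A' K)"
    unfolding eventually_sequentially by blast
  define K1 where "K1 = max 1 K0"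
  have AK: "A K > A' K" "A' K \<ge> 0" "A K \<ge> int K" if "K \<ge> K1" for K
  proof -
    have K: "int K \<ge> 1" using that by (simp add: K1_def)
    then have "g * (2 * q - 1) * real K ^ 8 > 0" using g q by simp
    then show "A K > A' K" unfolding AA' by simp
    show "A' K \<ge> 0" unfolding A'_def using Vb by simp
    have "int K \<le> int K ^ 8" using K by (simp add: self_le_power)
    also have "\<dots> \<le> (V * b3 * (int M)\<^sup>2) * int K ^ 8"
    proof -
      have "V * b3 * (int M)\<^sup>2 > 0" using Vb M(1) by simp
      then have "1 \<le> V * b3 * (int M)\<^sup>2" by linarith
      from mult_right_mono[OF this, of "int K ^ 8"] show ?thesis by simp
    qed
    also have "\<dots> = A K" by (simp add: A_def power_mult_distrib mult.assoc flip: power_mult)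
    finally show "A K \<ge> int K" .
  qed
  have main: "real (card (unrepresented 0 N)) \<le> 6 / q * N + A K1" if "N \<ge> 0" for N
    using that
  proof (induction "nat N" arbitrary: N rule: less_induct)
    case less
    show ?case
    proof (cases "N < A K1")
      case True
      have "real (card (unrepresented 0 N)) \<le> N" by (rule card_unrepresented_le[OF less.prems])
      also have "\<dots> \<le> A K1" using True by simp
      also have "\<dots> \<le> 6 / q * N + A K1" using q less.prems by simp
      finally show ?thesis .
    next
      case False
      have "\<exists>K\<ge>K1. A K \<le> N \<and> N < A (Suc K)"
      proof (rule ccontr)
        assume neg: "\<not> ?thesis"
        have "A K \<le> N" if "K \<ge> K1" for K
          using that
        proof (induction K rule: dec_induct)
          case base then show ?case using False by simp
        next
          case (step K) then show ?case using neg by (meson linorder_not_less)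
        qed
        from this[of "K1 + nat (N + 1)"] AK(3)[of "K1 + nat (N + 1)"] less.prems show False by simp
      qed
      then obtain K where K: "K \<ge> K1" "A K \<le> N" "N < A (Suc K)" by blast
      have K': "K \<ge> K0" using K(1) by (simp add: K1_def)
      have fin: "finite (unrepresented a b)" for a b
        unfolding unrepresented_def by (rule finite_subset[of _ "{a<..b}"]) auto
      have "unrepresented 0 N \<subseteq> unrepresented 0 (A' K) \<union> (unrepresented (A' K) (A K) \<union> {A K<..N})"
        by (auto simp: unrepresented_def)
      then have "card (unrepresented 0 N) \<le> card (unrepresented 0 (A' K) \<union> (unrepresented (A' K) (A K) \<union> {A K<..N}))"
        using fin by (intro card_mono) auto
      also have "\<dots> \<le> card (unrepresented 0 (A' K)) + card (unrepresented (A' K) (A K) \<union> {A K<..N})"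
        by (rule card_Un_le)
      also have "\<dots> \<le> card (unrepresented 0 (A' K)) + (card (unrepresented (A' K) (A K)) + card {A K<..N})"
        by (intro add_left_mono card_Un_le)
      finally have "real (card (unrepresented 0 N)) \<le> real (card (unrepresented 0 (A' K)))
           + (real (card (unrepresented (A' K) (A K))) + real (card {A K<..N}))" by linarith
      also have "real (card {A K<..N}) = real_of_int N - A K" using K by simp
      also have "real (card (unrepresented 0 (A' K))) \<le> 6 / q * A' K + A K1"
        using AK[OF K(1)] K(2) by (intro less.hyps) auto
      also have "real (card (unrepresented (A' K) (A K))) \<le> 3 / q * (real_of_int (A K) - A' K)"
        using K0[OF K'] by simp
      also have "real_of_int N - A K \<le> 3 / q * (real_of_int (A K) - A' K)"
        using K0[OF K'] K(3) by linarith
      also have "6 / q * A' K + A K1 + (3 / q * (real_of_int (A K) - A' K) + 3 / q * (real_of_int (A K) - A' K))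
           = 6 / q * A K + A K1" by (simp add: algebra_simps diff_divide_distrib add_divide_distrib)
      also have "\<dots> \<le> 6 / q * N + A K1" using K(2) q by (intro add_right_mono mult_left_mono) auto
      finally show ?thesis by simp
    qed
  qed
  show ?thesis using main unfolding q_def by blast
qed

end

section \<open>Local obstructions\<close>

lemma double_triangular: "2 * triangular z = z * (z + 1)"
  unfolding triangular_def by (rule dvd_mult_div_cancel) simp

lemma eight_triangular: "8 * triangular z + 1 = (2 * z + 1)\<^sup>2"
proof -
  have "8 * triangular z + 1 = 4 * (2 * triangular z) + 1" by simp
  also have "\<dots> = (2 * z + 1)\<^sup>2" unfolding double_triangular by (simp add: power2_eq_square algebra_simps)
  finally show ?thesis .
qed

text \<open>A residue class modulo \<open>m\<close> missed by the form lies wholly in the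
  exceptional set and has density \<open>1 / m\<close>.\<close>

lemma asymptotically_universal_imp_cong:
  fixes f :: "int \<Rightarrow> int \<Rightarrow> int \<Rightarrow> int"
  assumes au: "asymptotically_universal f" and m: "m > 0"
  shows "\<exists>x y z. m dvd f x y z - r"
proof (rule ccontr)
  assume neg: "\<not> ?thesis"
  \<comment> \<open>The representative is taken from 1 to \<open>m\<close> instead of 0 to
    \<open>m - 1\<close>: then the \<open>k\<close> numbers \<open>s + m * j\<close> with
    \<open>j < k\<close> all lie in \<open>{1..m * k}\<close>, and the count is exact.\<close>
  define s where "s = (if r mod m = 0 then m else r mod m)"
  have s: "1 \<le> s" "s \<le> m" "m dvd s - r"
  proof -
    have b: "0 \<le> r mod m" "r mod m < m" using m by auto
    show "1 \<le> s"
    proof (cases "r mod m = 0")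
      case False
      with b(1) have "1 \<le> r mod m" by linarith
      with False show ?thesis by (simp add: s_def)
    qed (use m in \<open>simp add: s_def\<close>)
    show "s \<le> m" using b(2) by (simp add: s_def)
    have "m dvd r mod m - r" by (metis dvd_minus_mod dvd_diff_commute)
    then show "m dvd s - r" by (auto simp: s_def mod_eq_0_iff_dvd)
  qed
  have exc: "n \<in> exceptional_set f" if "m dvd int n - r" for n
  proof -
    have "f x y z \<noteq> int n" for x y z
    proof
      assume "f x y z = int n"
      then have "m dvd f x y z - r" using that by simp
      then show False using neg by blast
    qed
    then show ?thesis by (simp add: exceptional_set_def)
  qed
  have lower: "k \<le> card (exceptional_set f \<inter> {1..nat m * k})" for k
  proof -
    have "card {..<k} \<le> card (exceptional_set f \<inter> {1..nat m * k})"
    proof (rule card_inj_on_le[where f = "\<lambda>j. nat (s + m * int j)"])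
      show "inj_on (\<lambda>j. nat (s + m * int j)) {..<k}"
      proof (rule inj_onI)
        fix i j assume "nat (s + m * int i) = nat (s + m * int j)"
        moreover have "s + m * int i > 0" "s + m * int j > 0" using s(1) m by (auto intro: add_pos_nonneg)
        ultimately have "m * int i = m * int j" by linarith
        then show "i = j" using m by simp
      qed
      show "(\<lambda>j. nat (s + m * int j)) ` {..<k} \<subseteq> exceptional_set f \<inter> {1..nat m * k}"
      proof
        fix n assume "n \<in> (\<lambda>j. nat (s + m * int j)) ` {..<k}"
        then obtain j where j: "j < k" "n = nat (s + m * int j)" by auto
        have "m * int j \<ge> 0" using m by simp
        then have pos: "s + m * int j \<ge> 1" using s(1) by linarith
        have "s + m * int j \<le> m + m * int j" using s by simp
        also have "\<dots> = m * (int j + 1)" by (simp add: algebra_simps)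
        also have "\<dots> \<le> m * int k" using j m by (intro mult_left_mono) auto
        finally have le: "s + m * int j \<le> m * int k" .
        have "m dvd s + m * int j - r" 
          using dvd_add[OF s(3) dvd_triv_left[of m "int j"]] by (simp add: algebra_simps)
        then have "m dvd int n - r" using pos j by simp
        then have "n \<in> exceptional_set f" by (rule exc)
        moreover have "int n \<le> int (nat m * k)" using le pos j m by simp
        then have "n \<le> nat m * k" by (simp only: of_nat_le_iff)
        moreover have "1 \<le> n" using pos j by simp
        ultimately show "n \<in> exceptional_set f \<inter> {1..nat m * k}" by simp
      qed
    qed simp
    then show ?thesis by simp
  qed
  have "eventually (\<lambda>N. real (card (exceptional_set f \<inter> {1..N})) / real N < 1 / m) sequentially"
    using au m unfolding asymptotically_universal_def has_asymptotic_density_def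
    by (intro order_tendstoD(2)[where y = 0]) auto
  then obtain N0 where N0: "\<And>N. N \<ge> N0 \<Longrightarrow> real (card (exceptional_set f \<inter> {1..N})) / real N < 1 / m"
    unfolding eventually_sequentially by blast
  define k where "k = N0 + 1"
  have "1 * N0 \<le> nat m * k" unfolding k_def using m by (intro mult_mono) auto
  then have lt: "real (card (exceptional_set f \<inter> {1..nat m * k})) / real (nat m * k) < 1 / m"
    by (intro N0) simp
  have le: "real k / real (nat m * k) \<le> real (card (exceptional_set f \<inter> {1..nat m * k})) / real (nat m * k)"
    using lower[of k] by (intro divide_right_mono) auto
  have "real k > 0" by (simp add: k_def)
  then have eq: "real k / real (nat m * k) = 1 / m" using m by simp
  show False using order.strict_trans1[OF le lt] by (simp only: eq less_irrefl)
qed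

text \<open>A map of a finite set onto itself is injective, but 1 and \<open>p - 1\<close> have the
  same square modulo \<open>p\<close>. No condition on \<open>A\<close> enters, so the lemma also
  covers coefficients divisible by \<open>p\<close>.\<close>

lemma scaled_squares_miss_residue:
  fixes p A :: int
  assumes p: "prime p" "p \<noteq> 2"
  shows "\<exists>u. \<forall>x. \<not> p dvd A * x\<^sup>2 - u"
proof (rule ccontr)
  assume "\<not> ?thesis"
  then have all: "\<exists>x. p dvd A * x\<^sup>2 - u" for u by blast
  have p2: "p > 2" using p prime_ge_2_int[of p] by linarith
  define h where "h x = A * x\<^sup>2 mod p" for x
  have "{0..<p} \<subseteq> h ` {0..<p}"
  proof
    fix u assume u: "u \<in> {0..<p}"
    obtain x where "p dvd A * x\<^sup>2 - u" using all by blast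
    then have "A * x\<^sup>2 mod p = u mod p" by (simp add: mod_eq_dvd_iff)
    moreover have "h (x mod p) = A * x\<^sup>2 mod p"
    proof -
      have "[A * (x mod p)\<^sup>2 = A * x\<^sup>2] (mod p)"
        by (intro cong_scalar_left cong_pow) simp
      then show ?thesis by (simp only: h_def cong_iff_dvd_diff mod_eq_dvd_iff)
    qed
    ultimately have "u = h (x mod p)" using u by simp
    moreover have "x mod p \<in> {0..<p}" using p2 by simp
    ultimately show "u \<in> h ` {0..<p}" by (rule image_eqI)
  qed
  moreover have "h ` {0..<p} \<subseteq> {0..<p}" unfolding h_def using p2 by auto
  ultimately have "h ` {0..<p} = {0..<p}" by blast
  then have "inj_on h {0..<p}" by (intro eq_card_imp_inj_on) auto
  moreover have "h 1 = h (p - 1)"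
  proof -
    have "A * 1\<^sup>2 - A * (p - 1)\<^sup>2 = p * (A * (2 - p))" by (simp add: power2_eq_square algebra_simps)
    then have "p dvd A * 1\<^sup>2 - A * (p - 1)\<^sup>2" by (simp only: dvd_triv_left)
    then show ?thesis unfolding h_def mod_eq_dvd_iff .
  qed
  ultimately have "1 = p - 1" by (rule inj_onD) (use p2 in auto)
  then show False using p2 by simp
qed

lemma QuadRes_prime_cancel:
  fixes p t u :: int
  assumes p: "prime p" and t: "\<not> p dvd t" and q: "QuadRes p (t\<^sup>2 * u)"
  shows "QuadRes p u"
proof -
  obtain y where y: "[y\<^sup>2 = t\<^sup>2 * u] (mod p)" using q by (auto simp: QuadRes_def)
  have "coprime t p" using prime_imp_coprime[OF p t] by (simp add: coprime_commute)
  then obtain s where s: "[t * s = 1] (mod p)" using cong_solve_coprime_int by blast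
  have "[(y * s)\<^sup>2 = y\<^sup>2 * s\<^sup>2] (mod p)" by (simp add: power_mult_distrib)
  also have "[y\<^sup>2 * s\<^sup>2 = (t\<^sup>2 * u) * s\<^sup>2] (mod p)" using y by (rule cong_scalar_right)
  also have "(t\<^sup>2 * u) * s\<^sup>2 = (t * s)\<^sup>2 * u" by (simp add: power_mult_distrib)
  also have "[(t * s)\<^sup>2 * u = 1\<^sup>2 * u] (mod p)" by (intro cong_scalar_right cong_pow s)
  finally show ?thesis by (auto simp: QuadRes_def)
qed

lemma QuadRes_of_isotropic:
  fixes p A B x y :: int
  assumes p: "prime p" and y: "\<not> p dvd y" and d: "p dvd A * x\<^sup>2 + B * y\<^sup>2"
  shows "QuadRes p (- (A * B))"
proof (rule QuadRes_prime_cancel[OF p y])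
  have "(A * x)\<^sup>2 - y\<^sup>2 * - (A * B) = A * (A * x\<^sup>2 + B * y\<^sup>2)"
    by (simp add: power2_eq_square algebra_simps)
  then have "[(A * x)\<^sup>2 = y\<^sup>2 * - (A * B)] (mod p)" unfolding cong_iff_dvd_diff using d by simp
  then show "QuadRes p (y\<^sup>2 * - (A * B))" by (auto simp: QuadRes_def)
qed

text \<open>If \<open>p\<close> divided a second coefficient, the form modulo \<open>p\<close> would
  be a single scaled square. If \<open>- (B * C)\<close> were a nonresidue,
  \<open>B * y\<^sup>2 + C * w\<^sup>2\<close> would be divisible by \<open>p\<close> only when
  \<open>y\<close> and \<open>w\<close> are, hence by \<open>p^2\<close>. The targets
  \<open>p * u\<close> modulo \<open>p^2\<close> would then have to come from
  \<open>A * x\<^sup>2\<close> alone, and \<open>(A div p) * x\<^sup>2\<close> misses some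
  \<open>u\<close> modulo \<open>p\<close>.\<close>

lemma universal_form_imp_QuadRes:
  fixes p A B C :: int
  assumes p: "prime p" "p \<noteq> 2" and A: "p dvd A"
    and univ: "\<And>m r. odd m \<Longrightarrow> m > 0 \<Longrightarrow> \<exists>x y w. m dvd A * x\<^sup>2 + B * y\<^sup>2 + C * w\<^sup>2 - r"
  shows "\<not> p dvd B \<and> \<not> p dvd C \<and> QuadRes p (- (B * C))"
proof -
  have p0: "p > 0" "odd p" using p prime_ge_2_int[of p] prime_odd_int[of p] by linarith+
  have notdvd: "\<not> p dvd D" if all: "\<And>r. \<exists>x y w. p dvd A * x\<^sup>2 + D * y\<^sup>2 + E * w\<^sup>2 - r" for D E
  proof
    assume D: "p dvd D"
    obtain u where u: "\<And>x. \<not> p dvd E * x\<^sup>2 - u" using scaled_squares_miss_residue[OF p, of E] by blast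
    obtain x y w where "p dvd A * x\<^sup>2 + D * y\<^sup>2 + E * w\<^sup>2 - u" using all[of u] by blast
    moreover have "p dvd A * x\<^sup>2 + D * y\<^sup>2" using A D by simp
    ultimately have "p dvd (A * x\<^sup>2 + D * y\<^sup>2 + E * w\<^sup>2 - u) - (A * x\<^sup>2 + D * y\<^sup>2)"
      by (rule dvd_diff)
    then show False using u[of w] by simp
  qed
  have B: "\<not> p dvd B" by (rule notdvd[of B C]) (rule univ[OF p0(2,1)])
  have C: "\<not> p dvd C"
  proof (rule notdvd[of C B])
    fix r
    show "\<exists>x y w. p dvd A * x\<^sup>2 + C * y\<^sup>2 + B * w\<^sup>2 - r"
    proof -
      obtain x y w where "p dvd A * x\<^sup>2 + B * y\<^sup>2 + C * w\<^sup>2 - r"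
        using univ[OF p0(2,1), of r] by blast
      then show ?thesis by (intro exI[of _ x] exI[of _ w] exI[of _ y]) (simp add: algebra_simps)
    qed
  qed
  moreover have "QuadRes p (- (B * C))"
  proof (rule ccontr)
    assume nq: "\<not> QuadRes p (- (B * C))"
    obtain A' where A': "A = p * A'" using A by auto
    obtain u where u: "\<And>x. \<not> p dvd A' * x\<^sup>2 - u" using scaled_squares_miss_residue[OF p, of A'] by blast
    have "odd (p ^ 2)" "p ^ 2 > 0" using p0 by auto
    from univ[OF this, of "p * u"] obtain x y w
      where xyw: "p ^ 2 dvd A * x\<^sup>2 + B * y\<^sup>2 + C * w\<^sup>2 - p * u" by blast
    have "p dvd A * x\<^sup>2 + B * y\<^sup>2 + C * w\<^sup>2 - p * u"
      using xyw by (rule dvd_trans[rotated]) (simp add: power2_eq_square)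
    moreover have "p dvd A * x\<^sup>2 - p * u" using A by simp
    ultimately have "p dvd (A * x\<^sup>2 + B * y\<^sup>2 + C * w\<^sup>2 - p * u) - (A * x\<^sup>2 - p * u)"
      by (rule dvd_diff)
    then have iso: "p dvd B * y\<^sup>2 + C * w\<^sup>2" by simp
    have w: "p dvd w" using QuadRes_of_isotropic[OF p(1) _ iso] nq by blast
    have "p dvd y"
    proof (rule ccontr)
      assume y: "\<not> p dvd y"
      have "p dvd C * w\<^sup>2 + B * y\<^sup>2" using iso by (simp only: add.commute)
      from QuadRes_of_isotropic[OF p(1) y this] nq show False by (simp only: mult.commute)
    qed
    then have "p ^ 2 dvd B * y\<^sup>2 + C * w\<^sup>2" using w by (intro dvd_add dvd_mult) auto
    with xyw have "p ^ 2 dvd (A * x\<^sup>2 + B * y\<^sup>2 + C * w\<^sup>2 - p * u) - (B * y\<^sup>2 + C * w\<^sup>2)"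
      by (rule dvd_diff)
    also have "(A * x\<^sup>2 + B * y\<^sup>2 + C * w\<^sup>2 - p * u) - (B * y\<^sup>2 + C * w\<^sup>2) = p * (A' * x\<^sup>2 - u)"
      by (simp add: A' algebra_simps)
    finally have "p dvd A' * x\<^sup>2 - u" using p0 by (simp add: power2_eq_square)
    then show False using u by blast
  qed
  ultimately show ?thesis using B by blast
qed

text \<open>One prime \<open>p\<close> is split off at a time. If it still divides the cofactor
  \<open>n\<close>, the root modulo \<open>n\<close> is lifted in the manner of Hensel; otherwise
  roots modulo \<open>p\<close> and \<open>n\<close> are combined by the Chinese remainder
  theorem.\<close>

lemma QuadRes_odd_modulus:
  fixes m u :: int
  assumes "odd m" "m > 0" and "\<And>p. prime p \<Longrightarrow> p dvd m \<Longrightarrow> \<not> p dvd u \<and> QuadRes p u"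
  shows "QuadRes m u"
  using assms
proof (induction "nat m" arbitrary: m rule: less_induct)
  case less
  show ?case
  proof (cases "m = 1")
    case True
    then show ?thesis by (auto simp: QuadRes_def)
  next
    case False
    then obtain p where p: "prime p" "p dvd m" using less.prems prime_divisor_exists[of m] by auto
    obtain n where n: "m = p * n" using p by auto
    have p0: "p > 1" using p prime_gt_1_int by blast
    have n0: "n > 0" using n less.prems p0 by (simp add: zero_less_mult_iff)
    have "n < m" using n n0 p0 by simp
    moreover have "odd n" "odd p" using n less.prems by auto
    ultimately have "QuadRes n u" using less.hyps[of n] less.prems n n0 by simp
    then obtain s where s: "[s\<^sup>2 = u] (mod n)" by (auto simp: QuadRes_def)
    have pu: "\<not> p dvd u" "QuadRes p u" using less.prems p by auto
    show ?thesis
    proof (cases "p dvd n")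
      case True
      have "n dvd s\<^sup>2 - u" using s by (simp add: cong_iff_dvd_diff)
      then obtain t where "s\<^sup>2 - u = n * t" by (rule dvdE)
      then have t: "s\<^sup>2 = u + n * t" by simp
      have "\<not> p dvd s"
      proof
        assume "p dvd s"
        then have "p dvd s\<^sup>2 - n * t" using True by (intro dvd_diff) (auto simp: power2_eq_square)
        then show False using t pu by simp
      qed
      moreover have "\<not> p dvd 2" using primes_dvd_imp_eq[OF p(1), of 2] \<open>odd p\<close> by auto
      ultimately have np: "\<not> p dvd 2 * s" using p by (simp add: prime_dvd_mult_iff)
      have "coprime (2 * s) p" using prime_imp_coprime[OF p(1) np] by (simp only: coprime_commute)
      then obtain v where v: "[2 * s * v = 1] (mod p)" using cong_solve_coprime_int by blast
      \<comment> \<open>This solves the linearized equation \<open>2 * s * k + t = 0\<close> modulo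
        \<open>p\<close>; the quadratic term drops out because \<open>p\<close> divides
        \<open>n\<close>.\<close>
      define k where "k = - t * v"
      have "p dvd 2 * s * v - 1" using v by (simp add: cong_iff_dvd_diff)
      then have "p dvd - t * (2 * s * v - 1)" by (rule dvd_mult)
      then have pk: "p dvd 2 * s * k + t" by (simp add: k_def algebra_simps)
      have "(s + n * k)\<^sup>2 - u = n * (2 * s * k + t) + n * n * k\<^sup>2"
        using t by (simp add: power2_eq_square algebra_simps)
      moreover have "m dvd n * (2 * s * k + t)" using pk n by (simp add: mult.commute mult_dvd_mono)
      moreover have "m dvd n * n * k\<^sup>2" using True n by (simp add: mult_dvd_mono)
      ultimately have "[(s + n * k)\<^sup>2 = u] (mod m)" by (simp add: cong_iff_dvd_diff)
      then show ?thesis by (auto simp: QuadRes_def)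
    next
      case False
      then have cop: "coprime p n" using p by (simp add: prime_imp_coprime)
      obtain r where r: "[r\<^sup>2 = u] (mod p)" using pu by (auto simp: QuadRes_def)
      obtain x where x: "[x = r] (mod p)" "[x = s] (mod n)"
        using binary_chinese_remainder_int[OF cop] by blast
      have "[x\<^sup>2 = u] (mod p)" "[x\<^sup>2 = u] (mod n)"
        using cong_trans[OF cong_pow[OF x(1)] r] cong_trans[OF cong_pow[OF x(2)] s] by auto
      then have "[x\<^sup>2 = u] (mod m)" unfolding n using cop by (intro coprime_cong_mult)
      then show ?thesis by (auto simp: QuadRes_def)
    qed
  qed
qed

lemma odd_part_props:
  fixes a :: int
  assumes "a > 0"
  shows "odd (odd_part a)" "odd_part a > 0" "odd_part a dvd a"
    "\<And>p. prime p \<Longrightarrow> p \<noteq> 2 \<Longrightarrow> p dvd odd_part a \<longleftrightarrow> p dvd a"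
proof -
  have eq: "a = 2 ^ v2 a * odd_part a"
    unfolding odd_part_def by (simp add: multiplicity_dvd)
  show odd: "odd (odd_part a)"
    using multiplicity_decompose[of a 2] assms by (simp add: odd_part_def)
  define k where "k = v2 a"
  define r where "r = odd_part a"
  have ar: "a = 2 ^ k * r" using eq by (simp only: k_def r_def)
  show "odd_part a > 0" using assms ar unfolding r_def[symmetric] by (simp add: zero_less_mult_iff)
  show "odd_part a dvd a" unfolding r_def[symmetric] by (simp add: ar)
  show "p dvd odd_part a \<longleftrightarrow> p dvd a" if p: "prime p" "p \<noteq> 2" for p
  proof -
    have "\<not> p dvd 2 ^ k" using p prime_dvd_power_int[of p 2] primes_dvd_imp_eq[of p 2] by auto
    then show ?thesis unfolding r_def[symmetric] using p by (simp add: ar prime_dvd_mult_iff)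
  qed
qed

section \<open>Local solutions\<close>

lemma prime_inverse_mod:
  fixes p a :: int
  assumes "prime p" "\<not> p dvd a"
  obtains b where "p dvd a * b - 1"
proof -
  have "coprime a p" using prime_imp_coprime[OF assms] by (simp only: coprime_commute)
  then obtain b where "[a * b = 1] (mod p)" using cong_solve_coprime_int by blast
  then show thesis using that by (simp add: cong_iff_dvd_diff)
qed

lemma odd_prime_not_dvd_2:
  fixes p :: int
  assumes "prime p" "p \<noteq> 2"
  shows "\<not> p dvd 2"
  using primes_dvd_imp_eq[OF assms(1), of 2] assms(2) by auto

text \<open>With \<open>t\<^sup>2 = - (A * B)\<close> modulo \<open>p\<close>, \<open>A\<close>
  times the form factors as \<open>(A * x - t * y) * (A * x + t * y)\<close>. Prescribing the first
  factor as \<open>r\<close> and the second as \<open>s = A * k / r\<close> parametrizes the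
  solutions by units \<open>r\<close>. The two side conditions are \<open>r = - s\<close> and
  \<open>r = s\<close> rewritten; they serve to choose \<open>r\<close> so that a given variable is
  a unit.\<close>

lemma hyperbolic_representation:
  fixes p A B k r :: int
  assumes p: "prime p" "p \<noteq> 2" and A: "\<not> p dvd A" and B: "\<not> p dvd B"
    and qr: "QuadRes p (- (A * B))" and r: "\<not> p dvd r"
  shows "\<exists>x y. p dvd A * x\<^sup>2 + B * y\<^sup>2 - k \<and> (p dvd x \<longrightarrow> p dvd r\<^sup>2 + A * k) \<and> (p dvd y \<longrightarrow> p dvd r\<^sup>2 - A * k)"
proof -
  obtain t where t: "p dvd t\<^sup>2 + A * B" using qr by (auto simp: QuadRes_def cong_iff_dvd_diff)
  have nt: "\<not> p dvd t"
  proof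
    assume "p dvd t"
    then have "p dvd t\<^sup>2" by (simp add: power2_eq_square)
    then have "p dvd A * B" using t by (simp add: dvd_add_right_iff)
    then show False using p A B by (simp add: prime_dvd_mult_iff)
  qed
  obtain h where h: "p dvd 2 * h - 1" using prime_inverse_mod[OF p(1) odd_prime_not_dvd_2[OF p]] .
  obtain r' where r': "p dvd r * r' - 1" using prime_inverse_mod[OF p(1) r] .
  obtain A' where A': "p dvd A * A' - 1" using prime_inverse_mod[OF p(1) A] .
  obtain t' where t': "p dvd t * t' - 1" using prime_inverse_mod[OF p(1) nt] .
  define s where "s = A * k * r'"
  define x where "x = A' * h * (r + s)"
  define y where "y = t' * h * (s - r)"
  have h': "[2 * h = 1] (mod p)" and A'': "[A * A' = 1] (mod p)" and t'': "[t * t' = 1] (mod p)"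
    and r'': "[r * r' = 1] (mod p)" and tt: "[t\<^sup>2 = - (A * B)] (mod p)"
    using h A' t' r' t by (auto simp: cong_iff_dvd_diff)
  have "2 * (A * x) = (2 * h) * (A * A') * (r + s)" by (simp add: x_def)
  also have "[\<dots> = 1 * 1 * (r + s)] (mod p)" by (intro cong_mult cong_refl h' A'')
  finally have ax: "[2 * (A * x) = r + s] (mod p)" by simp
  have "2 * (t * y) = (2 * h) * (t * t') * (s - r)" by (simp add: y_def)
  also have "[\<dots> = 1 * 1 * (s - r)] (mod p)" by (intro cong_mult cong_refl h' t'')
  finally have ty: "[2 * (t * y) = s - r] (mod p)" by simp
  have "r * s = A * k * (r * r')" by (simp add: s_def)
  also have "[\<dots> = A * k * 1] (mod p)" by (intro cong_mult cong_refl r'')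
  finally have rs: "[r * s = A * k] (mod p)" by simp
  have "4 * A * (A * x\<^sup>2 + B * y\<^sup>2) = (2 * (A * x))\<^sup>2 - 4 * (- (A * B)) * y\<^sup>2"
    by (simp add: power2_eq_square algebra_simps)
  also have "[\<dots> = (r + s)\<^sup>2 - 4 * t\<^sup>2 * y\<^sup>2] (mod p)"
    by (intro cong_diff cong_pow cong_mult cong_refl ax cong_sym[OF tt])
  also have "(r + s)\<^sup>2 - 4 * t\<^sup>2 * y\<^sup>2 = (r + s)\<^sup>2 - (2 * (t * y))\<^sup>2" by (simp add: power2_eq_square)
  also have "[\<dots> = (r + s)\<^sup>2 - (s - r)\<^sup>2] (mod p)" by (intro cong_diff cong_pow cong_refl ty)
  also have "(r + s)\<^sup>2 - (s - r)\<^sup>2 = 4 * (r * s)" by (simp add: power2_eq_square algebra_simps)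
  also have "[\<dots> = 4 * (A * k)] (mod p)" by (intro cong_mult cong_refl rs)
  finally have "p dvd 4 * A * (A * x\<^sup>2 + B * y\<^sup>2) - 4 * (A * k)" by (simp add: cong_iff_dvd_diff)
  also have "4 * A * (A * x\<^sup>2 + B * y\<^sup>2) - 4 * (A * k) = 2 * (2 * (A * (A * x\<^sup>2 + B * y\<^sup>2 - k)))"
    by (simp add: algebra_simps)
  finally have main: "p dvd A * x\<^sup>2 + B * y\<^sup>2 - k"
    using A odd_prime_not_dvd_2[OF p] unfolding prime_dvd_mult_iff[OF p(1)] by blast
  have "p dvd r\<^sup>2 + A * k" if "p dvd x"
  proof -
    have "p dvd 2 * (A * x) - (r + s)" using ax by (simp add: cong_iff_dvd_diff)
    moreover have "p dvd 2 * (A * x)" using that by simp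
    ultimately have "p dvd 2 * (A * x) - (2 * (A * x) - (r + s))" by (rule dvd_diff[rotated])
    then have "p dvd r * (r + s)" by simp
    moreover have "p dvd r * s - A * k" using rs by (simp add: cong_iff_dvd_diff)
    ultimately have "p dvd r * (r + s) - (r * s - A * k)" by (rule dvd_diff)
    then show ?thesis by (simp add: power2_eq_square algebra_simps)
  qed
  moreover have "p dvd r\<^sup>2 - A * k" if "p dvd y"
  proof -
    have "p dvd 2 * (t * y) - (s - r)" using ty by (simp add: cong_iff_dvd_diff)
    moreover have "p dvd 2 * (t * y)" using that by simp
    ultimately have "p dvd 2 * (t * y) - (2 * (t * y) - (s - r))" by (rule dvd_diff[rotated])
    then have "p dvd r * (s - r)" by simp
    moreover have "p dvd r * s - A * k" using rs by (simp add: cong_iff_dvd_diff)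
    ultimately have "p dvd (r * s - A * k) - r * (s - r)" by (rule dvd_diff[rotated])
    then show ?thesis by (simp add: power2_eq_square algebra_simps)
  qed
  ultimately show ?thesis using main by blast
qed

lemma hyperbolic_nontrivial:
  fixes p A B k :: int
  assumes p: "prime p" "p \<noteq> 2" and A: "\<not> p dvd A" and B: "\<not> p dvd B" and qr: "QuadRes p (- (A * B))"
  shows "\<exists>x y. p dvd A * x\<^sup>2 + B * y\<^sup>2 - k \<and> (\<not> p dvd x \<or> \<not> p dvd y)"
proof -
  have p1: "\<not> p dvd 1" using p(1) not_prime_unit by blast
  obtain x y where xy: "p dvd A * x\<^sup>2 + B * y\<^sup>2 - k" "p dvd x \<Longrightarrow> p dvd 1\<^sup>2 + A * k" "p dvd y \<Longrightarrow> p dvd 1\<^sup>2 - A * k"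
    using hyperbolic_representation[OF assms p1, of k] by blast
  have "\<not> (p dvd x \<and> p dvd y)"
  proof
    assume d: "p dvd x \<and> p dvd y"
    have "p dvd (1\<^sup>2 + A * k) + (1\<^sup>2 - A * k)"
      by (rule dvd_add[OF xy(2) xy(3)]) (use d in blast)+
    then show False using odd_prime_not_dvd_2[OF p] by simp
  qed
  then show ?thesis using xy(1) by blast
qed

text \<open>If \<open>y\<close> vanished for both \<open>r = 1\<close> and \<open>r = 2\<close>,
  then 1 and 4 would agree modulo \<open>p\<close>, so \<open>p\<close> would be 3. Modulo 3 all
  units have square 1 and the choice of \<open>r\<close> gives no freedom:
  \<open>y\<^sup>2 - w\<^sup>2 = 1\<close> forces \<open>w = 0\<close> there.\<close>

lemma hyperbolic_second_unit:
  fixes p A B k :: int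
  assumes p: "prime p" "p \<noteq> 2" "p \<noteq> 3" and A: "\<not> p dvd A" and B: "\<not> p dvd B" and qr: "QuadRes p (- (A * B))"
  shows "\<exists>x y. p dvd A * x\<^sup>2 + B * y\<^sup>2 - k \<and> \<not> p dvd y"
proof (rule ccontr)
  assume neg: "\<not> ?thesis"
  have *: "p dvd r\<^sup>2 - A * k" if r: "\<not> p dvd r" for r
    using hyperbolic_representation[OF p(1,2) A B qr r, of k] neg by blast
  have "p dvd 1\<^sup>2 - A * k" by (rule *) (use p(1) not_prime_unit in blast)
  moreover have "p dvd 2\<^sup>2 - A * k" by (rule *) (rule odd_prime_not_dvd_2[OF p(1,2)])
  ultimately have "p dvd (2\<^sup>2 - A * k) - (1\<^sup>2 - A * k)" by (rule dvd_diff[rotated])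
  then have "p dvd 3" by simp
  moreover have "prime (3 :: int)" by simp
  ultimately show False using p primes_dvd_imp_eq by blast
qed

text \<open>Pigeonhole: \<open>A * x\<^sup>2\<close> and \<open>k - B * y\<^sup>2\<close> each take
  \<open>(p + 1) / 2\<close> values modulo \<open>p\<close>, so they share one.\<close>

lemma binary_representation:
  fixes p A B k :: int
  assumes p: "prime p" "p \<noteq> 2" and A: "\<not> p dvd A" and B: "\<not> p dvd B"
  shows "\<exists>x y. p dvd A * x\<^sup>2 + B * y\<^sup>2 - k"
proof -
  have p2: "p > 2" using p prime_ge_2_int[of p] by linarith
  have "odd p" using prime_odd_int[of p] p p2 by simp
  then obtain h where h: "p = 2 * h + 1" by (rule oddE)
  have h0: "h \<ge> 1" using h p2 by simp
  define F where "F x = A * x\<^sup>2 mod p" for x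
  define H where "H y = (k - B * y\<^sup>2) mod p" for y
  have sq: "x = y" if "p dvd D * x\<^sup>2 - D * y\<^sup>2" "\<not> p dvd D" "x \<in> {0..h}" "y \<in> {0..h}" for D x y
  proof -
    have "D * x\<^sup>2 - D * y\<^sup>2 = D * ((x - y) * (x + y))" by (simp add: power2_eq_square algebra_simps)
    then have "p dvd x - y \<or> p dvd x + y" using that(1,2) p(1) by (simp add: prime_dvd_mult_iff)
    then show ?thesis
    proof
      assume d: "p dvd x - y"
      show ?thesis
      proof (rule ccontr)
        assume "x \<noteq> y"
        then have "p \<le> \<bar>x - y\<bar>" using d p2 dvd_imp_le_int[of "x - y" p] by simp
        then show False using that(3,4) h by auto
      qed
    next
      assume d: "p dvd x + y"
      show ?thesis
      proof (rule ccontr)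
        assume "x \<noteq> y"
        then have "x + y > 0" using that(3,4) by auto
        then have "p \<le> x + y" using d by (intro zdvd_imp_le) auto
        then show False using that(3,4) h by auto
      qed
    qed
  qed
  have "inj_on F {0..h}"
  proof (rule inj_onI)
    fix x y assume xy: "x \<in> {0..h}" "y \<in> {0..h}" "F x = F y"
    then have "p dvd A * x\<^sup>2 - A * y\<^sup>2" by (simp add: F_def mod_eq_dvd_iff)
    then show "x = y" using A xy by (intro sq) auto
  qed
  moreover have "inj_on H {0..h}"
  proof (rule inj_onI)
    fix x y assume xy: "x \<in> {0..h}" "y \<in> {0..h}" "H x = H y"
    then have "p dvd (k - B * x\<^sup>2) - (k - B * y\<^sup>2)" by (simp add: H_def mod_eq_dvd_iff)
    then have "p dvd B * y\<^sup>2 - B * x\<^sup>2" by (simp add: algebra_simps)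
    then have "y = x" using B xy by (intro sq[of B]) auto
    then show "x = y" by simp
  qed
  ultimately have cards: "card (F ` {0..h}) = nat (h + 1)" "card (H ` {0..h}) = nat (h + 1)"
    by (simp_all add: card_image)
  have "F ` {0..h} \<inter> H ` {0..h} \<noteq> {}"
  proof
    assume dis: "F ` {0..h} \<inter> H ` {0..h} = {}"
    have "card (F ` {0..h} \<union> H ` {0..h}) \<le> card {0..<p}"
      using p2 by (intro card_mono) (auto simp: F_def H_def)
    moreover have "card (F ` {0..h} \<union> H ` {0..h}) = nat (h + 1) + nat (h + 1)"
      using card_Un_disjoint[OF _ _ dis] cards by simp
    ultimately show False using h h0 by simp
  qed
  then obtain x y where "F x = H y" by auto
  then have "p dvd A * x\<^sup>2 - (k - B * y\<^sup>2)" by (simp add: F_def H_def mod_eq_dvd_iff)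
  then show ?thesis by (auto simp: algebra_simps)
qed

section \<open>Regular solutions modulo an odd prime\<close>

text \<open>\<open>m\<close> has a representation modulo \<open>p\<close> at which the gradient of
  \<open>A x\<^sup>2 + B y\<^sup>2 + C w\<^sup>2\<close> does not point in the direction of \<open>y\<close> only.\<close>

definition regular_mod :: "int \<Rightarrow> int \<Rightarrow> int \<Rightarrow> int \<Rightarrow> int \<Rightarrow> bool" where
  "regular_mod p A B C m \<longleftrightarrow> (\<exists>x y w. p dvd A * x\<^sup>2 + B * y\<^sup>2 + C * w\<^sup>2 - m \<and> (\<not> p dvd A * x \<or> \<not> p dvd C * w))"

lemma regular_modI:
  assumes "prime p" "p dvd A * x\<^sup>2 + B * y\<^sup>2 + C * w\<^sup>2 - m"
    "\<not> p dvd A \<and> \<not> p dvd x \<or> \<not> p dvd C \<and> \<not> p dvd w"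
  shows "regular_mod p A B C m"
  unfolding regular_mod_def using assms by (intro exI[of _ x] exI[of _ y] exI[of _ w]) (auto simp: prime_dvd_mult_iff)

text \<open>Choosing \<open>y\<close> as 0 or 1 makes \<open>m - B * y\<^sup>2\<close> nonzero
  modulo \<open>p\<close>, so \<open>x\<close> and \<open>w\<close> cannot both vanish.\<close>

lemma regular_mod_unramified:
  assumes p: "prime p" "p \<noteq> 2" and n: "\<not> p dvd A" "\<not> p dvd B" "\<not> p dvd C"
  shows "regular_mod p A B C m"
proof -
  define y :: int where "y = (if p dvd m then 1 else 0)"
  have k: "\<not> p dvd m - B * y\<^sup>2" using n(2) by (auto simp: y_def dvd_diff_right_iff)
  obtain x w where xw: "p dvd A * x\<^sup>2 + C * w\<^sup>2 - (m - B * y\<^sup>2)"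
    using binary_representation[OF p n(1,3)] by blast
  have "\<not> (p dvd x \<and> p dvd w)"
  proof
    assume "p dvd x \<and> p dvd w"
    then have "p dvd A * x\<^sup>2 + C * w\<^sup>2" by (auto simp: power2_eq_square)
    then have "p dvd (A * x\<^sup>2 + C * w\<^sup>2) - (A * x\<^sup>2 + C * w\<^sup>2 - (m - B * y\<^sup>2))" using xw by (rule dvd_diff)
    then show False using k by simp
  qed
  moreover have "p dvd A * x\<^sup>2 + B * y\<^sup>2 + C * w\<^sup>2 - m" using xw by (simp add: algebra_simps)
  ultimately show ?thesis using p(1) n by (intro regular_modI[of p A x B y C w]) auto
qed

lemma regular_mod_middle:
  assumes p: "prime p" "p \<noteq> 2" and n: "\<not> p dvd A" "\<not> p dvd C" "QuadRes p (- (A * C))"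
  shows "regular_mod p A B C m"
proof -
  obtain x w where "p dvd A * x\<^sup>2 + C * w\<^sup>2 - m" "\<not> p dvd x \<or> \<not> p dvd w"
    using hyperbolic_nontrivial[OF p n] by blast
  then show ?thesis using p(1) n by (intro regular_modI[of p A x B 0 C w]) auto
qed

text \<open>If \<open>p\<close> divides \<open>A\<close>, the only gradient component that can help
  is that of \<open>w\<close>, so a solution with \<open>w\<close> a unit is needed and the prime 3
  has to be excluded. In \<open>regular_mod_middle\<close> either of two variables may be the unit,
  and 3 causes no trouble.\<close>

lemma regular_mod_first:
  assumes p: "prime p" "p \<noteq> 2" "p \<noteq> 3" and n: "\<not> p dvd B" "\<not> p dvd C" "QuadRes p (- (B * C))"
  shows "regular_mod p A B C m"
proof -
  obtain y w where "p dvd B * y\<^sup>2 + C * w\<^sup>2 - m" "\<not> p dvd w"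
    using hyperbolic_second_unit[OF p n] by blast
  then show ?thesis using p(1) n by (intro regular_modI[of p A 0 B y C w]) auto
qed

lemma regular_mod_last:
  assumes p: "prime p" "p \<noteq> 2" "p \<noteq> 3" and n: "\<not> p dvd B" "\<not> p dvd A" "QuadRes p (- (B * A))"
  shows "regular_mod p A B C m"
proof -
  obtain y x where "p dvd B * y\<^sup>2 + A * x\<^sup>2 - m" "\<not> p dvd x"
    using hyperbolic_second_unit[OF p n] by blast
  then show ?thesis using p(1) n by (intro regular_modI[of p A x B y C 0]) (auto simp: add.commute)
qed

text \<open>For odd \<open>p\<close> this is what universality modulo odd moduli forces through
  \<open>universal_form_imp_QuadRes\<close>. It is vacuous when \<open>p\<close> divides no
  coefficient, where a ternary form is isotropic anyway.\<close>

definition isotropic_at :: "int \<Rightarrow> int \<Rightarrow> int \<Rightarrow> int \<Rightarrow> bool" where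
  "isotropic_at p A B C \<longleftrightarrow>
     (p dvd A \<longrightarrow> \<not> p dvd B \<and> \<not> p dvd C \<and> QuadRes p (- (B * C))) \<and>
     (p dvd B \<longrightarrow> \<not> p dvd A \<and> \<not> p dvd C \<and> QuadRes p (- (A * C))) \<and>
     (p dvd C \<longrightarrow> \<not> p dvd A \<and> \<not> p dvd B \<and> QuadRes p (- (A * B)))"

lemma isotropic_at_swap: "isotropic_at p A B C \<longleftrightarrow> isotropic_at p B A C"
  unfolding isotropic_at_def by (auto simp: mult.commute)

lemma regular_mod_if_isotropic:
  assumes "prime p" "p \<noteq> 2" "p \<noteq> 3" "isotropic_at p A B C"
  shows "regular_mod p A B C m"
  using assms regular_mod_unramified regular_mod_middle regular_mod_first regular_mod_last
  unfolding isotropic_at_def by (metis mult.commute)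

text \<open>If 3 divides \<open>A\<close> or \<open>B\<close>, making that coefficient the middle
  one reduces to \<open>regular_mod_middle\<close>. If it divides \<open>C\<close>, a nontrivial
  solution with \<open>w = 0\<close> has \<open>x\<close> or \<open>y\<close> as a unit, and this
  decides the order.\<close>

lemma regular_mod_3:
  assumes iso: "isotropic_at 3 A B C"
  shows "regular_mod 3 A B C m \<or> regular_mod 3 B A C m"
proof -
  have p: "prime (3 :: int)" "(3 :: int) \<noteq> 2" by simp_all
  consider "3 dvd A" | "3 dvd B" | "3 dvd C" | "\<not> 3 dvd A" "\<not> 3 dvd B" "\<not> 3 dvd C" by blast
  then show ?thesis
  proof cases
    case 1
    then show ?thesis using iso regular_mod_middle[OF p, of B C A m] by (simp add: isotropic_at_def)
  next
    case 2
    then show ?thesis using iso regular_mod_middle[OF p, of A C B m] by (simp add: isotropic_at_def)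
  next
    case 3
    then have n: "\<not> 3 dvd A" "\<not> 3 dvd B" "QuadRes 3 (- (A * B))" using iso by (auto simp: isotropic_at_def)
    obtain x y where xy: "3 dvd A * x\<^sup>2 + B * y\<^sup>2 - m" "\<not> 3 dvd x \<or> \<not> 3 dvd y"
      using hyperbolic_nontrivial[OF p n] by blast
    from xy(2) show ?thesis
    proof
      assume "\<not> 3 dvd x"
      then show ?thesis using xy n by (intro disjI1 regular_modI[of 3 A x B y C 0]) auto
    next
      assume "\<not> 3 dvd y"
      moreover have "3 dvd B * y\<^sup>2 + A * x\<^sup>2 + C * 0\<^sup>2 - m" using xy(1) by (simp add: algebra_simps)
      ultimately have "regular_mod 3 B A C m" using n by (intro regular_modI[of 3 B y A x C 0]) auto
      then show ?thesis ..
    qed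
  next
    case 4
    then show ?thesis using regular_mod_unramified[OF p] by blast
  qed
qed

section \<open>The prime 2\<close>

lemma odd_square_cong_1: "odd (c :: int) \<Longrightarrow> 8 dvd c * c - 1"
proof -
  assume "odd c"
  then obtain k where "c = 2 * k + 1" by (rule oddE)
  then have "c * c - 1 = 4 * (k * (k + 1))" by (simp add: algebra_simps)
  moreover have "4 * 2 dvd 4 * (k * (k + 1))" by (intro mult_dvd_mono) auto
  ultimately show ?thesis by simp
qed

lemma triangular_mod_8: "\<exists>z. 8 dvd c * triangular z - r" if c: "odd c" for c r :: int
proof -
  have surj: "\<exists>z. 8 dvd triangular z - s" for s
  proof -
    have t: "triangular 0 = 0" "triangular 1 = 1" "triangular 2 = 3" "triangular 3 = 6" "triangular 4 = 10"
      "triangular 5 = 15" "triangular 6 = 21" "triangular 7 = 28" by (simp_all add: triangular_def)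
    have "8 dvd 0 - s \<or> 8 dvd 1 - s \<or> 8 dvd 3 - s \<or> 8 dvd 6 - s \<or> 8 dvd 10 - s \<or> 8 dvd 15 - s \<or> 8 dvd 21 - s \<or> 8 dvd 28 - s"
      by presburger
    then show ?thesis by (metis t)
  qed
  \<comment> \<open>An odd \<open>c\<close> is its own inverse modulo 8, so the target for the
    triangular number is \<open>c * r\<close>.\<close>
  obtain z where "8 dvd triangular z - c * r" using surj by blast
  then have "8 dvd c * (triangular z - c * r) + (c * c - 1) * r"
    using odd_square_cong_1[OF c] by (intro dvd_add dvd_mult dvd_mult2)
  then show ?thesis by (auto simp: algebra_simps)
qed

text \<open>Since triangular numbers cover all residues modulo 8, it is enough that
  \<open>a * x\<^sup>2 + b * y\<^sup>2\<close> reaches \<open>n\<close> modulo the exact power 1, 2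
  or 4 of 2 in \<open>c\<close>. For 4 this is where the condition on \<open>a * b\<close>
  enters.\<close>

lemma two_adic_solution:
  fixes a b c n :: int
  assumes ab: "odd a \<or> odd b \<or> odd c"
    and c: "\<not> 4 dvd c \<or> (4 dvd c \<and> \<not> 8 dvd c \<and> even (a * b) \<and> \<not> 4 dvd a * b)"
  shows "\<exists>x y z. 8 dvd a * x\<^sup>2 + b * y\<^sup>2 + c * triangular z - n"
proof -
  consider "odd c" | c1 where "c = 2 * c1" "odd c1" | c1 where "c = 4 * c1" "odd c1"
  proof (cases "odd c")
    case False
    then obtain c1 where c1: "c = 2 * c1" by blast
    show thesis
    proof (cases "odd c1")
      case False
      then obtain c2 where c2: "c = 4 * c2" using c1 by (auto elim!: evenE)
      then have "odd c2" using c by auto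
      with c2 show thesis using that by blast
    qed (use that c1 in blast)
  qed (use that in blast)
  then show ?thesis
  proof cases
    case 1
    obtain z where "8 dvd c * triangular z - n" using triangular_mod_8[OF 1] by blast
    then show ?thesis by (intro exI[of _ 0] exI[of _ z]) simp
  next
    case 2
    have "\<exists>x y. even (n - a * x\<^sup>2 - b * y\<^sup>2)"
    proof (cases "even n")
      case True then show ?thesis by (intro exI[of _ 0]) simp
    next
      case False
      have "odd a \<or> odd b" using ab 2 by auto
      then show ?thesis
      proof
        assume "odd a" then show ?thesis using False by (intro exI[of _ 1] exI[of _ 0]) simp
      next
        assume "odd b" then show ?thesis using False by (intro exI[of _ 0] exI[of _ 1]) simp
      qed
    qed
    then obtain x y k where k: "n - a * x\<^sup>2 - b * y\<^sup>2 = 2 * k" by blast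
    obtain z where "8 dvd c1 * triangular z - k" using triangular_mod_8[OF 2(2)] by blast
    then have "8 dvd 2 * (c1 * triangular z - k)" by (rule dvd_mult)
    also have "2 * (c1 * triangular z - k) = a * x\<^sup>2 + b * y\<^sup>2 + c * triangular z - n"
      using k 2(1) by (simp add: algebra_simps)
    finally show ?thesis by blast
  next
    case 3
    then have nc: "even (a * b)" "\<not> 4 dvd a * b" using c by auto
    \<comment> \<open>One coefficient is odd and the other is 2 modulo 4, so 0, \<open>a\<close>,
      \<open>b\<close>, \<open>a + b\<close> already run through all residues modulo 4, and
      \<open>x\<close>, \<open>y\<close> can be taken from 0 and 1.\<close>
    have step: "\<exists>x y. 4 dvd n - a * x\<^sup>2 - b * y\<^sup>2" if "odd a" "even b" "\<not> 4 dvd b" for a b :: int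
    proof -
      have "4 dvd n \<or> 4 dvd n - a \<or> 4 dvd n - b \<or> 4 dvd n - a - b" using that by presburger
      then consider "4 dvd n - a * 0\<^sup>2 - b * 0\<^sup>2" | "4 dvd n - a * 1\<^sup>2 - b * 0\<^sup>2"
        | "4 dvd n - a * 0\<^sup>2 - b * 1\<^sup>2" | "4 dvd n - a * 1\<^sup>2 - b * 1\<^sup>2" by auto
      then show ?thesis by cases blast+
    qed
    have "\<exists>x y. 4 dvd n - a * x\<^sup>2 - b * y\<^sup>2"
    proof (cases "even a")
      case True
      have "odd b"
      proof
        assume "even b"
        then have "2 * 2 dvd a * b" using True by (intro mult_dvd_mono)
        then show False using nc by simp
      qed
      moreover have "\<not> 4 dvd a" using nc by auto
      ultimately obtain y x where "4 dvd n - b * y\<^sup>2 - a * x\<^sup>2" using step[of b a] True by blast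
      then show ?thesis by (intro exI[of _ x] exI[of _ y]) (simp add: algebra_simps)
    next
      case False
      then have "even b" "\<not> 4 dvd b" using nc by auto
      then show ?thesis using step[of a b] False by blast
    qed
    then obtain x y k where k: "n - a * x\<^sup>2 - b * y\<^sup>2 = 4 * k" by blast
    obtain z where "8 dvd c1 * triangular z - k" using triangular_mod_8[OF 3(2)] by blast
    then have "8 dvd 4 * (c1 * triangular z - k)" by (rule dvd_mult)
    also have "4 * (c1 * triangular z - k) = a * x\<^sup>2 + b * y\<^sup>2 + c * triangular z - n"
      using k 3(1) by (simp add: algebra_simps)
    finally show ?thesis by blast
  qed
qed

section \<open>Gluing local solutions and the density of exceptions in one residue class\<close>

lemma chinese_remainder_nonneg:
  fixes m u :: "'i \<Rightarrow> int"
  assumes fin: "finite I" and pos: "\<And>i. i \<in> I \<Longrightarrow> m i > 0"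
    and cop: "\<And>i j. i \<in> I \<Longrightarrow> j \<in> I \<Longrightarrow> i \<noteq> j \<Longrightarrow> coprime (m i) (m j)"
  shows "\<exists>x\<ge>0. \<forall>i\<in>I. m i dvd x - u i"
proof -
  have "\<exists>x. \<forall>i\<in>I. [x = nat (u i mod m i)] (mod nat (m i))"
  proof (rule chinese_remainder_nat[OF fin])
    show "\<forall>i\<in>I. \<forall>j\<in>I. i \<noteq> j \<longrightarrow> coprime (nat (m i)) (nat (m j))"
    proof (intro ballI impI)
      fix i j assume ij: "i \<in> I" "j \<in> I" "i \<noteq> j"
      have "coprime (int (nat (m i))) (int (nat (m j)))"
        using cop[OF ij] pos[OF ij(1)] pos[OF ij(2)] by simp
      then show "coprime (nat (m i)) (nat (m j))" by (simp only: coprime_int_iff)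
    qed
  qed
  then obtain x where x: "\<And>i. i \<in> I \<Longrightarrow> [x = nat (u i mod m i)] (mod nat (m i))" by blast
  have "m i dvd int x - u i" if i: "i \<in> I" for i
  proof -
    have "[int x = int (nat (u i mod m i))] (mod int (nat (m i)))" using x[OF i] by (simp only: cong_int_iff)
    then have "m i dvd int x - u i mod m i" using pos[OF i] by (simp add: cong_iff_dvd_diff)
    moreover have "m i dvd u i - u i mod m i" by (rule dvd_minus_mod)
    ultimately have "m i dvd (int x - u i mod m i) - (u i - u i mod m i)" by (rule dvd_diff)
    then show ?thesis by simp
  qed
  then show ?thesis by (intro exI[of _ "int x"]) simp
qed

lemma prod_primes_dvd:
  fixes P :: "int set"
  assumes "finite P" "\<And>p. p \<in> P \<Longrightarrow> prime p" "\<And>p. p \<in> P \<Longrightarrow> p dvd n" "e dvd n" "\<And>p. p \<in> P \<Longrightarrow> coprime e p"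
  shows "e * \<Prod>P dvd n"
  using assms
proof (induction P rule: finite_induct)
  case (insert p P)
  have "e * \<Prod>P dvd n" using insert by auto
  moreover have "coprime (e * \<Prod>P) p"
  proof -
    have "coprime q p" if "q \<in> P" for q
      using that insert primes_coprime[of q p] by auto
    then have "coprime (\<Prod>P) p" by (rule prod_coprime_left)
    then show ?thesis using insert by simp
  qed
  moreover have "p dvd n" using insert by auto
  ultimately have "e * \<Prod>P * p dvd n" using divides_mult by blast
  then show ?case using insert by (simp add: mult_ac)
qed simp

lemma triangular_cong:
  assumes "odd m" "m dvd z - w"
  shows "m dvd triangular z - triangular w"
proof -
  have "2 * (triangular z - triangular w) = (z - w) * (z + w + 1)"
    using double_triangular[of z] double_triangular[of w] by (simp add: algebra_simps)
  then have "m dvd 2 * (triangular z - triangular w)" using assms(2) by simp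
  moreover have "coprime m 2" using assms(1) by simp
  ultimately show ?thesis using coprime_dvd_mult_right_iff by blast
qed

text \<open>The halving in the triangular number costs one power of 2, hence 16 in the
  hypothesis.\<close>

lemma triangular_cong_8:
  assumes "16 dvd z - w"
  shows "8 dvd triangular z - triangular w"
proof -
  have "2 * (triangular z - triangular w) = (z - w) * (z + w + 1)"
    using double_triangular[of z] double_triangular[of w] by (simp add: algebra_simps)
  then have "2 * 8 dvd 2 * (triangular z - triangular w)" using assms by simp
  then show ?thesis by (simp only: dvd_mult_cancel_left) simp
qed

lemma diagonal_cong:
  fixes x y u v :: int
  assumes "m dvd x - u" "m dvd y - v" "m dvd s - t"
  shows "m dvd (a * x\<^sup>2 + b * y\<^sup>2 + c * s) - (a * u\<^sup>2 + b * v\<^sup>2 + c * t)"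
proof -
  have "[a * x\<^sup>2 + b * y\<^sup>2 + c * s = a * u\<^sup>2 + b * v\<^sup>2 + c * t] (mod m)"
    using assms by (intro cong_add cong_mult cong_pow cong_refl) (auto simp: cong_iff_dvd_diff)
  then show ?thesis by (simp add: cong_iff_dvd_diff)
qed

text \<open>\<open>y\<close> becomes the third variable of \<^locale>\<open>qform\<close>, and \<open>u\<close> is \<open>8 / 2^v2 c\<close>.\<close>

lemma class_density:
  fixes a b c c1 u r :: int and M :: nat
  assumes abc: "a > 0" "b > 0" "c1 > 0" "odd c1" "u > 0" "8 * c1 = u * c" "u dvd 8"
    and M: "M \<ge> 2" "2 * a * b * c < int M"
    and P_def: "P = {p. prime p \<and> p \<noteq> 2 \<and> p \<le> int M}" and V_def: "V = 2 * \<Prod>P"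
    and good: "\<And>p. p \<in> P \<Longrightarrow> regular_mod p (8 * a) (8 * b) c (8 * r + c)"
    and two: "\<exists>x y z. 8 dvd a * x\<^sup>2 + b * y\<^sup>2 + c * triangular z - r"
  shows "\<exists>D. \<forall>N::nat. real (card {n\<in>exceptional_set (\<lambda>x y z. a * x\<^sup>2 + b * y\<^sup>2 + c * triangular z) \<inter> {1..N}. 4 * V dvd int n - r})
            \<le> 6 / real M * (real N / real_of_int (4 * V)) + D"
proof -
  let ?f = "\<lambda>x y z. a * x\<^sup>2 + b * y\<^sup>2 + c * triangular z"
  have "u * c > 0" using abc(3,6) by linarith
  then have c0: "c > 0" using abc(5) by (rule zero_less_mult_pos)
  have finP: "finite P" unfolding P_def by (rule finite_subset[of _ "{0..int M}"]) (auto simp: prime_ge_0_int)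
  have P: "prime p" "p > 2" "odd p" if "p \<in> P" for p
    using that prime_ge_2_int[of p] prime_odd_int[of p] by (auto simp: P_def)
  have prodP: "\<Prod>P > 0" using P by (intro prod_pos) force
  have V: "V > 0" using prodP by (simp add: V_def)
  have "\<exists>x y z. p dvd ?f x y z - r \<and> (\<not> p dvd a * x \<or> \<not> p dvd c1 * (2 * z + 1))" if p: "p \<in> P" for p
  proof -
    obtain x y w where xyw: "p dvd (8 * a) * x\<^sup>2 + (8 * b) * y\<^sup>2 + c * w\<^sup>2 - (8 * r + c)"
      "\<not> p dvd (8 * a) * x \<or> \<not> p dvd c * w" using good[OF p] unfolding regular_mod_def by blast
    obtain h where h: "p = 2 * h + 1" using P(3)[OF p] by (rule oddE)
    \<comment> \<open>\<open>h + 1\<close> is the inverse of 2 modulo \<open>p = 2 * h + 1\<close>,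
      so \<open>2 * z + 1\<close> is congruent to \<open>w\<close>.\<close>
    define z where "z = (w - 1) * (h + 1)"
    have "2 * z + 1 - w = p * (w - 1)" unfolding z_def h by (simp add: algebra_simps)
    then have zw: "p dvd (2 * z + 1) - w" by simp
    have E: "8 * (?f x y z - r) = (8 * a) * x\<^sup>2 + (8 * b) * y\<^sup>2 + c * (2 * z + 1)\<^sup>2 - (8 * r + c)"
      unfolding eight_triangular[symmetric] by (simp add: algebra_simps)
    have "p dvd ((8 * a) * x\<^sup>2 + (8 * b) * y\<^sup>2 + c * (2 * z + 1)\<^sup>2) - ((8 * a) * x\<^sup>2 + (8 * b) * y\<^sup>2 + c * w\<^sup>2)"
    proof -
      have "(2 * z + 1)\<^sup>2 - w\<^sup>2 = ((2 * z + 1) - w) * ((2 * z + 1) + w)" by (simp add: power2_eq_square algebra_simps)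
      then have "p dvd (2 * z + 1)\<^sup>2 - w\<^sup>2" using zw by simp
      then show ?thesis by (intro diagonal_cong) auto
    qed
    then have "[(8 * a) * x\<^sup>2 + (8 * b) * y\<^sup>2 + c * (2 * z + 1)\<^sup>2 = (8 * a) * x\<^sup>2 + (8 * b) * y\<^sup>2 + c * w\<^sup>2] (mod p)"
      by (simp only: cong_iff_dvd_diff)
    also have "[(8 * a) * x\<^sup>2 + (8 * b) * y\<^sup>2 + c * w\<^sup>2 = 8 * r + c] (mod p)"
      using xyw(1) by (simp only: cong_iff_dvd_diff)
    finally have "p dvd 8 * (?f x y z - r)" by (simp only: E cong_iff_dvd_diff)
    moreover have "coprime p 8" using P(3)[OF p] coprime_power_right_iff[of p 2 3] by simp
    ultimately have 1: "p dvd ?f x y z - r" using coprime_dvd_mult_right_iff by blast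
    have "\<not> p dvd a * x \<or> \<not> p dvd c1 * (2 * z + 1)"
    proof (rule ccontr)
      assume "\<not> ?thesis"
      then have d: "p dvd a * x" "p dvd c1 * (2 * z + 1)" by auto
      have "p dvd 8 * (a * x)" using d(1) by (rule dvd_mult)
      then have "p dvd (8 * a) * x" by (simp only: mult.assoc)
      moreover have "p dvd c * w"
      proof -
        have "p dvd 8 * (c1 * (2 * z + 1)) - (8 * c1) * ((2 * z + 1) - w)"
          by (rule dvd_diff[OF dvd_mult[OF d(2)] dvd_mult[OF zw]])
        also have "8 * (c1 * (2 * z + 1)) - (8 * c1) * ((2 * z + 1) - w) = (8 * c1) * w" by (simp add: algebra_simps)
        also have "\<dots> = u * (c * w)" using abc by simp
        finally have "p dvd u * (c * w)" .
        moreover have "\<not> p dvd u"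
        proof
          assume "p dvd u"
          then have "p dvd 8" using abc by (meson dvd_trans)
          moreover have "p dvd p" by simp
          ultimately have "is_unit p" using \<open>coprime p 8\<close> coprime_common_divisor by blast
          then show False using P(1)[OF p] not_prime_unit by blast
        qed
        ultimately show ?thesis using P(1)[OF p] prime_dvd_mult_iff by blast
      qed
      ultimately show False using xyw(2) by blast
    qed
    with 1 show ?thesis by blast
  qed
  then have "\<exists>xp. \<forall>p\<in>P. \<exists>y z. p dvd ?f (xp p) y z - r \<and> (\<not> p dvd a * xp p \<or> \<not> p dvd c1 * (2 * z + 1))"
    by (intro bchoice) blast
  then obtain xp where "\<forall>p\<in>P. \<exists>y z. p dvd ?f (xp p) y z - r \<and> (\<not> p dvd a * xp p \<or> \<not> p dvd c1 * (2 * z + 1))" ..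
  from bchoice[OF this] obtain yp
    where "\<forall>p\<in>P. \<exists>z. p dvd ?f (xp p) (yp p) z - r \<and> (\<not> p dvd a * xp p \<or> \<not> p dvd c1 * (2 * z + 1))" ..
  from bchoice[OF this] obtain zp
    where zp: "\<forall>p\<in>P. p dvd ?f (xp p) (yp p) (zp p) - r \<and> (\<not> p dvd a * xp p \<or> \<not> p dvd c1 * (2 * zp p + 1))" ..
  then have loc: "\<And>p. p \<in> P \<Longrightarrow> p dvd ?f (xp p) (yp p) (zp p) - r"
     "\<And>p. p \<in> P \<Longrightarrow> \<not> p dvd a * xp p \<or> \<not> p dvd c1 * (2 * zp p + 1)" by blast+
  obtain x2 y2 z2 where loc2: "8 dvd ?f x2 y2 z2 - r" using two by blast
  \<comment> \<open>The modulus at 2 is 16 rather than 8, as \<open>triangular_cong_8\<close>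
    demands.\<close>
  define mm where "mm p = (if p = 2 then 16 else p)" for p :: int
  have crt: "\<exists>x\<ge>0. \<forall>p\<in>insert 2 P. mm p dvd x - t p" for t
  proof (rule chinese_remainder_nonneg)
    show "finite (insert 2 P)" using finP by simp
    show "mm p > 0" if "p \<in> insert 2 P" for p using that P(2)[of p] by (cases "p = 2") (auto simp: mm_def)
    have c16: "coprime 16 p" if "p \<in> P" for p using P(3)[OF that] coprime_power_left_iff[of 2 4 p] by simp
    show "coprime (mm p) (mm q)" if "p \<in> insert 2 P" "q \<in> insert 2 P" "p \<noteq> q" for p q
      using that c16[of p] c16[of q] primes_coprime[OF P(1)[of p] P(1)[of q]]
      by (cases "p = 2"; cases "q = 2") (simp_all add: mm_def coprime_commute)
  qed
  have P2: "2 \<notin> P" by (simp add: P_def)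
  have crt': "\<exists>x\<ge>0. (\<forall>p\<in>P. p dvd x - t p) \<and> 16 dvd x - s" for t s
  proof -
    obtain x where x: "x \<ge> 0" "\<forall>p\<in>insert 2 P. mm p dvd x - (if p = 2 then s else t p)"
      using crt[of "\<lambda>p. if p = 2 then s else t p"] by blast
    have "p dvd x - t p" if p: "p \<in> P" for p
    proof -
      have "p \<noteq> 2" using p P2 by blast
      then show ?thesis using bspec[OF x(2), of p] p by (simp add: mm_def)
    qed
    moreover have "16 dvd x - s" using bspec[OF x(2), of 2] by (simp add: mm_def)
    ultimately show ?thesis using x(1) by blast
  qed
  obtain x0 where x0: "x0 \<ge> 0" "\<And>p. p \<in> P \<Longrightarrow> p dvd x0 - xp p" "16 dvd x0 - x2"
    using crt'[of xp x2] by blast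
  obtain y0 where y0: "y0 \<ge> 0" "\<And>p. p \<in> P \<Longrightarrow> p dvd y0 - yp p" "16 dvd y0 - y2"
    using crt'[of yp y2] by blast
  obtain z0 where z0: "z0 \<ge> 0" "\<And>p. p \<in> P \<Longrightarrow> p dvd z0 - zp p" "16 dvd z0 - z2"
    using crt'[of zp z2] by blast
  define n0 where "n0 = ?f x0 y0 z0"
  have n0r: "4 * V dvd n0 - r"
  proof -
    have "p dvd n0 - r" if p: "p \<in> P" for p
    proof -
      have "p dvd n0 - ?f (xp p) (yp p) (zp p)"
        unfolding n0_def using x0(2)[OF p] y0(2)[OF p] z0(2)[OF p] P(3)[OF p]
        by (intro diagonal_cong triangular_cong)
      then have "p dvd (n0 - ?f (xp p) (yp p) (zp p)) + (?f (xp p) (yp p) (zp p) - r)"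
        using loc(1)[OF p] by (rule dvd_add)
      then show ?thesis by simp
    qed
    moreover have "8 dvd n0 - r"
    proof -
      have "8 dvd n0 - ?f x2 y2 z2"
        unfolding n0_def using x0(3) y0(3) triangular_cong_8[OF z0(3)]
        by (intro diagonal_cong) (auto intro: dvd_trans[of 8 16])
      then have "8 dvd (n0 - ?f x2 y2 z2) + (?f x2 y2 z2 - r)" using loc2 by (rule dvd_add)
      then show ?thesis by simp
    qed
    moreover have "coprime 8 p" if "p \<in> P" for p using P(3)[OF that] coprime_power_left_iff[of 2 3 p] by simp
    ultimately have "8 * \<Prod>P dvd n0 - r" using finP P(1) by (intro prod_primes_dvd) auto
    then show ?thesis by (simp add: V_def)
  qed
  have primeV: "p dvd V" if "prime p" "p \<le> int M" for p
  proof (cases "p = 2")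
    case False
    then have "p dvd \<Prod>P" using that finP by (intro dvd_prodI) (auto simp: P_def)
    then show ?thesis by (simp add: V_def)
  qed (simp add: V_def)
  have a0: "2 * a * b * c > 0" using abc c0 by simp
  \<comment> \<open>The gradient variables \<open>x\<close> and \<open>z\<close> come first. At
    primes of \<open>P\<close> their coprimality is the regularity of the local solutions; at 2 it
    holds because \<open>c1 * (2 * z0 + 1)\<close> is odd. The bound
    \<open>2 * a * b * c < M\<close> puts every prime dividing the leading coefficients into
    \<open>V\<close>.\<close>
  interpret qform V "a * x0" "c1 * (2 * z0 + 1)" "b * y0" a "u * c1" b
  proof
    show "coprime (gcd (a * x0) (c1 * (2 * z0 + 1))) V"
    proof (rule ccontr)
      assume "\<not> ?thesis"
      then obtain d where d: "d dvd gcd (a * x0) (c1 * (2 * z0 + 1))" "d dvd V" "\<not> is_unit d" by (rule not_coprimeE)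
      have "d \<noteq> 0" using d(2) V by auto
      then obtain p where p: "prime p" "p dvd d" using d(3) prime_divisor_exists by blast
      have "d dvd a * x0" "d dvd c1 * (2 * z0 + 1)" using d(1) by simp_all
      then have pd: "p dvd a * x0" "p dvd c1 * (2 * z0 + 1)" "p dvd V" using dvd_trans[OF p(2)] d(2) by blast+
      show False
      proof (cases "p = 2")
        case True
        then show False using pd(2) abc(4) by simp
      next
        case False
        have "p dvd 2 * \<Prod>P" using pd(3) by (simp only: V_def)
        then have "p dvd \<Prod>P"
          using prime_dvd_mult_iff[OF p(1), of 2 "\<Prod>P"] odd_prime_not_dvd_2[OF p(1) False] by blast
        then obtain q where q: "q \<in> P" "p dvd q" using prime_dvd_prod_iff[OF finP p(1), of "\<lambda>x. x"] by blast
        have "p = q" using primes_dvd_imp_eq[OF p(1) P(1)[OF q(1)] q(2)] .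
        then have pP: "p \<in> P" using q(1) by simp
        have "p dvd a * x0 - a * (x0 - xp p)" by (rule dvd_diff[OF pd(1) dvd_mult[OF x0(2)[OF pP]]])
        moreover have "p dvd c1 * (2 * z0 + 1) - 2 * c1 * (z0 - zp p)" by (rule dvd_diff[OF pd(2) dvd_mult[OF z0(2)[OF pP]]])
        ultimately show False using loc(2)[OF pP] by (simp add: algebra_simps)
      qed
    qed
    fix p assume p: "prime p" "p dvd 2 * a * (u * c1) * b"
    have "2 * a * (u * c1) * b dvd 2 * a * (8 * c1) * b" using abc(7) by (intro mult_dvd_mono) auto
    with p(2) have "p dvd 2 * a * (8 * c1) * b" by (rule dvd_trans)
    also have "2 * a * (8 * c1) * b = u * (2 * a * b * c)" using abc(6) by simp
    finally have "p dvd u * (2 * a * b * c)" .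
    then have "p dvd u \<or> p dvd 2 * a * b * c" using prime_dvd_mult_iff[OF p(1)] by blast
    then have "p dvd 2 ^ 3 \<or> p dvd 2 * a * b * c"
      using dvd_trans[OF _ abc(7), of p] by auto
    then have "p dvd 2 \<or> p dvd 2 * a * b * c" using p(1) prime_dvd_power by blast
    then have "p dvd 2 * a * b * c" by auto
    then have "p \<le> 2 * a * b * c" using a0 by (intro zdvd_imp_le)
    then show "p dvd V" using M p(1) by (intro primeV) auto
  qed (use V abc x0 y0 z0 in auto)
  \<comment> \<open>The step lengths \<open>2 * V\<close>, \<open>2 * V\<close> and
    \<open>V * u\<close> are chosen so that each increment of the form is \<open>4 * V\<close> times
    a polynomial of the shape required by \<open>qform\<close>. For the triangular variable this
    uses \<open>u * c = 8 * c1\<close>.\<close>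
  have G_eq: "n0 + 4 * V * G (i, j, k) = ?f (x0 + 2 * V * i) (y0 + 2 * V * k) (z0 + V * u * j)" for i j k
  proof -
    have "u * (2 * (c * triangular (z0 + V * u * j) - c * triangular z0))
       = (u * c) * (2 * triangular (z0 + V * u * j) - 2 * triangular z0)"
      by (simp add: algebra_simps)
    also have "\<dots> = (8 * c1) * ((z0 + V * u * j) * (z0 + V * u * j + 1) - z0 * (z0 + 1))"
      by (simp only: abc(6)[symmetric] double_triangular)
    also have "\<dots> = u * (2 * (4 * V * (c1 * (2 * z0 + 1) * j + V * (u * c1) * j\<^sup>2)))"
      by (simp add: power2_eq_square algebra_simps)
    finally have "u * (2 * (c * triangular (z0 + V * u * j) - c * triangular z0))
       = u * (2 * (4 * V * (c1 * (2 * z0 + 1) * j + V * (u * c1) * j\<^sup>2)))" .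
    from this abc(5) have "c * triangular (z0 + V * u * j) - c * triangular z0 = 4 * V * (c1 * (2 * z0 + 1) * j + V * (u * c1) * j\<^sup>2)"
      by simp
    moreover have "G (i, j, k) = a * x0 * i + V * a * i\<^sup>2 + c1 * (2 * z0 + 1) * j + V * (u * c1) * j\<^sup>2
        + (b * y0 * k + V * b * k\<^sup>2)"
      unfolding G_def Q_def T_def by (simp only: prod.case)
    ultimately show ?thesis
      by (simp only: n0_def) (simp add: power2_eq_square algebra_simps)
  qed
  obtain N0 where N0: "\<And>N. N \<ge> 0 \<Longrightarrow> real (card (unrepresented 0 N)) \<le> 6 / M * N + N0"
    using unrepresented_density_le[OF M(1) primeV] by blast
  have n0: "n0 \<ge> 0" unfolding n0_def using abc c0 triangular_def z0 by (simp add: triangular_def pos_imp_zdiv_nonneg_iff)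
  show ?thesis
  proof (intro exI[of _ "real (card {..nat n0}) + N0"] allI)
    fix N :: nat
    \<comment> \<open>Members of the class up to \<open>n0\<close> are absorbed in the constant.
      Beyond \<open>n0\<close>, an exceptional number \<open>n0 + 4 * V * t\<close> yields an
      unrepresented \<open>t\<close>.\<close>
    let ?E = "{n\<in>exceptional_set ?f \<inter> {1..N}. 4 * V dvd int n - r}"
    have fin: "finite (unrepresented 0 m)" for m
      unfolding unrepresented_def by (rule finite_subset[of _ "{0<..m}"]) auto
    have "?E \<subseteq> {..nat n0} \<union> {n\<in>?E. int n > n0}" by auto
    then have "card ?E \<le> card ({..nat n0} \<union> {n\<in>?E. int n > n0})" by (intro card_mono) auto
    also have "\<dots> \<le> card {..nat n0} + card {n\<in>?E. int n > n0}" by (rule card_Un_le)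
    also have "card {n\<in>?E. int n > n0} \<le> card (unrepresented 0 (int N div (4 * V)))"
    proof (rule card_inj_on_le[where f = "\<lambda>n. (int n - n0) div (4 * V)"])
      have dv: "4 * V dvd int n - n0" if "n \<in> ?E" for n
      proof -
        have "4 * V dvd int n - r" using that by simp
        then have "4 * V dvd (int n - r) - (n0 - r)" using n0r by (rule dvd_diff)
        then show ?thesis by simp
      qed
      show "inj_on (\<lambda>n. (int n - n0) div (4 * V)) {n\<in>?E. int n > n0}"
      proof (rule inj_onI)
        fix m n assume mn: "m \<in> {n\<in>?E. int n > n0}" "n \<in> {n\<in>?E. int n > n0}"
          "(int m - n0) div (4 * V) = (int n - n0) div (4 * V)"
        have "4 * V dvd int m - n0" "4 * V dvd int n - n0" using dv mn by blast+
        then have "int m - n0 = int n - n0" using mn(3) by (metis dvd_div_mult_self)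
        then show "m = n" by simp
      qed
      show "(\<lambda>n. (int n - n0) div (4 * V)) ` {n\<in>?E. int n > n0} \<subseteq> unrepresented 0 (int N div (4 * V))"
      proof
        fix t assume "t \<in> (\<lambda>n. (int n - n0) div (4 * V)) ` {n\<in>?E. int n > n0}"
        then obtain n where n: "n \<in> ?E" "int n > n0" and t: "t = (int n - n0) div (4 * V)" by auto
        have nt: "int n = n0 + 4 * V * t" using dv[OF n(1)] t by (metis add_diff_cancel_left' diff_add_cancel dvd_mult_div_cancel add.commute)
        have "4 * V * t > 0" using nt n(2) by simp
        then have t0: "t > 0" using V by (simp add: zero_less_mult_iff)
        have "t \<le> int N div (4 * V)" unfolding t using V n n0 by (intro zdiv_mono1) auto
        moreover have "t \<noteq> G (i, j, k)" for i j k
        proof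
          assume "t = G (i, j, k)"
          then have "?f (x0 + 2 * V * i) (y0 + 2 * V * k) (z0 + V * u * j) = int n" using nt G_eq by simp
          then show False using n(1) by (auto simp: exceptional_set_def)
        qed
        ultimately show "t \<in> unrepresented 0 (int N div (4 * V))" using t0 by (auto simp: unrepresented_def)
      qed
    qed (rule fin)
    finally have "real (card ?E) \<le> real (card {..nat n0}) + real (card (unrepresented 0 (int N div (4 * V))))" by linarith
    also have "\<dots> \<le> real (card {..nat n0}) + (6 / real M * real_of_int (int N div (4 * V)) + N0)"
      using V by (intro add_left_mono N0) (simp add: pos_imp_zdiv_nonneg_iff)
    also have "\<dots> \<le> real (card {..nat n0}) + (6 / real M * (real N / real_of_int (4 * V)) + N0)"
      using real_of_int_div4[of "int N" "4 * V"] by (intro add_left_mono add_right_mono mult_left_mono) auto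
    finally show "real (card ?E) \<le> 6 / real M * (real N / real_of_int (4 * V)) + (real (card {..nat n0}) + N0)" by simp
  qed
qed

section \<open>The characterization\<close>

lemma exceptional_set_swap:
  "exceptional_set (\<lambda>x y z. b * x\<^sup>2 + a * y\<^sup>2 + c * triangular z)
   = exceptional_set (\<lambda>x y z. a * x\<^sup>2 + b * y\<^sup>2 + c * triangular z)"
proof -
  have "(\<exists>x y z. b * x\<^sup>2 + a * y\<^sup>2 + c * triangular z = int n) \<longleftrightarrow>
        (\<exists>x y z. a * x\<^sup>2 + b * y\<^sup>2 + c * triangular z = int n)" for n
  proof -
    have "(\<exists>x y z. b * x\<^sup>2 + a * y\<^sup>2 + c * triangular z = int n) \<longleftrightarrow>
        (\<exists>y x z. b * x\<^sup>2 + a * y\<^sup>2 + c * triangular z = int n)" by blast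
    then show ?thesis by (simp only: add.commute[of "b * _" "a * _"])
  qed
  then show ?thesis unfolding exceptional_set_def by simp
qed

text \<open>Each residue class modulo \<open>4 * V\<close> decides for itself which of
  \<open>x\<close> and \<open>y\<close> is distinguished. The classes together recover the
  proportion \<open>6 / M\<close>, and their finitely many constants add up to
  \<open>D\<close>.\<close>

lemma exceptional_density_le:
  fixes a b c :: int and M :: nat
  assumes abc: "a > 0" "b > 0" "c > 0" and ab: "odd a \<or> odd b \<or> odd c"
    and c2: "\<not> 4 dvd c \<or> (4 dvd c \<and> \<not> 8 dvd c \<and> even (a * b) \<and> \<not> 4 dvd a * b)"
    and iso: "\<And>p. prime p \<Longrightarrow> p \<noteq> 2 \<Longrightarrow> isotropic_at p (8 * a) (8 * b) c"
    and M: "M \<ge> 2" "2 * a * b * c < int M"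
  defines "f \<equiv> (\<lambda>x y z. a * x\<^sup>2 + b * y\<^sup>2 + c * triangular z)"
  shows "\<exists>D. \<forall>N. real (card (exceptional_set f \<inter> {1..N})) \<le> 6 / real M * real N + D"
proof -
  obtain c1 u where c1: "c1 > 0" "odd c1" "u > 0" "8 * c1 = u * c" "u dvd (8 :: int)"
  proof (cases "odd c")
    case True
    then show thesis using that[of c 8] abc by simp
  next
    case False
    then obtain d where d: "c = 2 * d" by blast
    show thesis
    proof (cases "odd d")
      case True
      then show thesis using that[of d 4] abc d by simp
    next
      case False
      then obtain e where e: "c = 4 * e" using d by (auto elim!: evenE)
      then have "odd e" using c2 by auto
      then show thesis using that[of e 2] abc e by simp
    qed
  qed
  define P where "P = {p :: int. prime p \<and> p \<noteq> 2 \<and> p \<le> int M}"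
  define V where "V = 2 * \<Prod>P"
  have "p > 0" if "p \<in> P" for p using that by (simp add: P_def prime_gt_0_int)
  then have V: "V > 0" by (simp add: V_def prod_pos)
  have cls: "\<exists>D. \<forall>N. real (card {n\<in>exceptional_set f \<inter> {1..N}. 4 * V dvd int n - r})
       \<le> 6 / real M * (real N / real_of_int (4 * V)) + D" for r
  proof (cases "\<forall>p\<in>P. regular_mod p (8 * a) (8 * b) c (8 * r + c)")
    case True
    show ?thesis unfolding f_def
      by (rule class_density[OF abc(1,2) c1 M P_def V_def _ two_adic_solution[OF ab c2]]) (use True in blast)
  next
    case False
    then obtain q where q: "q \<in> P" "\<not> regular_mod q (8 * a) (8 * b) c (8 * r + c)" by blast
    \<comment> \<open>Only 3 can obstruct regularity. By \<open>regular_mod_3\<close> the reversed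
      order is then regular at 3, and at all other primes either order is.\<close>
    have q3: "q = 3" using q regular_mod_if_isotropic[of q "8 * a" "8 * b" c "8 * r + c"] iso[of q] by (auto simp: P_def)
    have swapped: "regular_mod p (8 * b) (8 * a) c (8 * r + c)" if p: "p \<in> P" for p
    proof (cases "p = 3")
      case True
      then show ?thesis using regular_mod_3[of "8 * a" "8 * b" c "8 * r + c"] iso[of 3] q(2) q3 by simp
    next
      case False
      then show ?thesis using p iso[of p] regular_mod_if_isotropic[of p "8 * b" "8 * a" c]
        by (simp add: P_def isotropic_at_swap)
    qed
    have ab': "odd b \<or> odd a \<or> odd c" using ab by blast
    have c2': "\<not> 4 dvd c \<or> (4 dvd c \<and> \<not> 8 dvd c \<and> even (b * a) \<and> \<not> 4 dvd b * a)"
      using c2 by (simp only: mult.commute[of b a])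
    have M': "2 * b * a * c < int M" using M(2) by (simp only: mult_ac)
    show ?thesis unfolding f_def exceptional_set_swap[of b a c, symmetric]
      by (rule class_density[OF abc(2,1) c1 M(1) M' P_def V_def swapped two_adic_solution[OF ab' c2']])
  qed
  then obtain D where D: "\<And>r N. real (card {n\<in>exceptional_set f \<inter> {1..N}. 4 * V dvd int n - r})
       \<le> 6 / real M * (real N / real_of_int (4 * V)) + D r" by metis
  show ?thesis
  proof (intro exI[of _ "\<Sum>r\<in>{0..<4 * V}. D r"] allI)
    fix N
    let ?E = "\<lambda>r. {n\<in>exceptional_set f \<inter> {1..N}. 4 * V dvd int n - r}"
    have "exceptional_set f \<inter> {1..N} \<subseteq> (\<Union>r\<in>{0..<4 * V}. ?E r)"
    proof
      fix n assume n: "n \<in> exceptional_set f \<inter> {1..N}"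
      have "4 * V dvd int n - int n mod (4 * V)" by (rule dvd_minus_mod)
      moreover have "int n mod (4 * V) \<in> {0..<4 * V}" using V by simp
      ultimately show "n \<in> (\<Union>r\<in>{0..<4 * V}. ?E r)" using n by blast
    qed
    then have "card (exceptional_set f \<inter> {1..N}) \<le> card (\<Union>r\<in>{0..<4 * V}. ?E r)"
      by (intro card_mono) auto
    also have "\<dots> \<le> (\<Sum>r\<in>{0..<4 * V}. card (?E r))" by (rule card_UN_le) simp
    finally have "real (card (exceptional_set f \<inter> {1..N})) \<le> (\<Sum>r\<in>{0..<4 * V}. real (card (?E r)))"
      by (simp only: of_nat_sum[symmetric] of_nat_le_iff)
    also have "\<dots> \<le> (\<Sum>r\<in>{0..<4 * V}. 6 / real M * (real N / real_of_int (4 * V)) + D r)"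
      by (intro sum_mono D)
    also have "\<dots> = 6 / real M * real N + (\<Sum>r\<in>{0..<4 * V}. D r)"
      using V by (simp add: sum.distrib)
    finally show "real (card (exceptional_set f \<inter> {1..N})) \<le> 6 / real M * real N + (\<Sum>r\<in>{0..<4 * V}. D r)" .
  qed
qed

lemma isotropic_imp_asymptotically_universal:
  fixes a b c :: int
  assumes "a > 0" "b > 0" "c > 0" "odd a \<or> odd b \<or> odd c"
    and "\<not> 4 dvd c \<or> (4 dvd c \<and> \<not> 8 dvd c \<and> even (a * b) \<and> \<not> 4 dvd a * b)"
    and "\<And>p. prime p \<Longrightarrow> p \<noteq> 2 \<Longrightarrow> isotropic_at p (8 * a) (8 * b) c"
  shows "asymptotically_universal (\<lambda>x y z. a * x\<^sup>2 + b * y\<^sup>2 + c * triangular z)"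
  unfolding asymptotically_universal_def has_asymptotic_density_def
proof (rule LIMSEQ_I)
  fix e :: real assume e: "e > 0"
  let ?f = "\<lambda>x y z. a * x\<^sup>2 + b * y\<^sup>2 + c * triangular z"
  obtain M0 :: nat where M0: "12 / e < real M0" using reals_Archimedean2 by blast
  \<comment> \<open>\<open>M0\<close> makes \<open>6 / M < e / 2\<close>, and the term
    \<open>2 * a * b * c\<close> lets \<open>V\<close> contain all primes dividing the
    coefficients.\<close>
  define M where "M = M0 + nat (2 * a * b * c) + 2"
  have M: "M \<ge> 2" "2 * a * b * c < int M" "12 / e < real M" using M0 by (auto simp: M_def)
  obtain D where D: "\<And>N. real (card (exceptional_set ?f \<inter> {1..N})) \<le> 6 / real M * real N + D"
    using exceptional_density_le[OF assms M(1,2)] by blast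
  obtain N0 :: nat where N0: "2 * \<bar>D\<bar> / e < real N0" using reals_Archimedean2 by blast
  have "norm (real (card (exceptional_set ?f \<inter> {1..N})) / real N - 0) < e" if N: "N \<ge> N0 + 1" for N
  proof -
    have N1: "real N > 0" "2 * \<bar>D\<bar> / e < real N" using N N0 by auto
    then have D1: "\<bar>D\<bar> < e / 2 * real N" using e by (simp add: field_simps)
    have "6 / real M < e / 2" using M(1,3) e by (simp add: field_simps)
    then have "6 / real M * real N \<le> e / 2 * real N" using N1 by (intro mult_right_mono) auto
    then have "real (card (exceptional_set ?f \<inter> {1..N})) < e * real N" using D[of N] D1 by linarith
    then show ?thesis using N1 by (simp add: pos_divide_less_eq)
  qed
  then show "\<exists>no. \<forall>n\<ge>no. norm (real (card (exceptional_set ?f \<inter> {1..n})) / real n - 0) < e" by blast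
qed

section \<open>Necessity, and the residue conditions prime by prime\<close>

lemma two_power_exact_iff:
  assumes "n \<noteq> 0"
  shows "two_power_exact k n \<longleftrightarrow> 2 ^ k dvd n \<and> \<not> 2 ^ Suc k dvd n"
  using assms power_dvd_iff_le_multiplicity[where p = 2 and x = n and n = k]
    power_dvd_iff_le_multiplicity[where p = 2 and x = n and n = "Suc k"]
  unfolding two_power_exact_def by auto

text \<open>For an odd modulus prime to \<open>u\<close>, being a square can be tested modulo each
  prime divisor; \<open>QuadRes_odd_modulus\<close> supplies the lifting.\<close>

lemma R_rel_odd_part_iff:
  assumes a: "a > 0"
  shows "R_rel u (odd_part a) \<longleftrightarrow> (\<forall>p. prime p \<longrightarrow> p \<noteq> 2 \<longrightarrow> p dvd a \<longrightarrow> \<not> p dvd u \<and> QuadRes p u)"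
    (is "?R \<longleftrightarrow> ?P")
proof
  assume R: ?R
  show ?P
  proof (intro allI impI)
    fix p :: int assume p: "prime p" "p \<noteq> 2" "p dvd a"
    have pd: "p dvd odd_part a" using odd_part_props(4)[OF a p(1,2)] p(3) by blast
    have "\<not> p dvd u"
    proof
      assume "p dvd u"
      then have "p dvd gcd u (odd_part a)" using pd by simp
      then show False using R p(1) not_prime_unit unfolding R_rel_def by fastforce
    qed
    moreover obtain y where "[y\<^sup>2 = u] (mod odd_part a)" using R by (auto simp: R_rel_def QuadRes_def)
    then have "[y\<^sup>2 = u] (mod p)" using pd by (rule cong_dvd_modulus)
    ultimately show "\<not> p dvd u \<and> QuadRes p u" by (auto simp: QuadRes_def)
  qed
next
  assume P: ?P
  have *: "\<not> p dvd u \<and> QuadRes p u" if "prime p" "p dvd odd_part a" for p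
  proof -
    have "p \<noteq> 2" using that odd_part_props(1)[OF a] by blast
    then show ?thesis using P that odd_part_props(4)[OF a] by blast
  qed
  have "coprime u (odd_part a)"
  proof (rule ccontr)
    assume "\<not> ?thesis"
    then obtain d where d: "d dvd u" "d dvd odd_part a" "\<not> is_unit d" by (rule not_coprimeE)
    have "d \<noteq> 0" using d(2) odd_part_props(2)[OF a] by auto
    then obtain p where p: "prime p" "p dvd d" using d(3) prime_divisor_exists by blast
    then show False using *[OF p(1) dvd_trans[OF p(2) d(2)]] dvd_trans[OF p(2) d(1)] by blast
  qed
  moreover have "QuadRes (odd_part a) u"
    using odd_part_props(1,2)[OF a] * by (intro QuadRes_odd_modulus) auto
  ultimately show ?R by (simp add: R_rel_def coprime_iff_gcd_eq_1)
qed

lemma QuadRes_square_mult: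
  assumes "QuadRes p u"
  shows "QuadRes p (t\<^sup>2 * u)"
proof -
  obtain y where "[y\<^sup>2 = u] (mod p)" using assms by (auto simp: QuadRes_def)
  then have "[t\<^sup>2 * y\<^sup>2 = t\<^sup>2 * u] (mod p)" by (rule cong_scalar_left)
  then have "[(t * y)\<^sup>2 = t\<^sup>2 * u] (mod p)" by (simp add: power_mult_distrib)
  then show ?thesis by (auto simp: QuadRes_def)
qed

text \<open>The two sides differ by square factors that are units at odd \<open>p\<close>:
  \<open>8 * b * c\<close> is \<open>2\<^sup>2\<close> times \<open>2 * b * c\<close>, and
  \<open>8 * a * (8 * b)\<close> is \<open>8\<^sup>2\<close> times \<open>a * b\<close>. The
  coprimality in \<open>R_rel\<close> says that \<open>p\<close> divides only one
  coefficient.\<close>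

lemma R_rel_iff_isotropic:
  fixes a b c :: int
  assumes abc: "a > 0" "b > 0" "c > 0"
  shows "R_rel (- 2 * b * c) (odd_part a) \<and> R_rel (- 2 * a * c) (odd_part b) \<and> R_rel (- (a * b)) (odd_part c)
     \<longleftrightarrow> (\<forall>p. prime p \<longrightarrow> p \<noteq> 2 \<longrightarrow> isotropic_at p (8 * a) (8 * b) c)"
proof -
  have "isotropic_at p (8 * a) (8 * b) c \<longleftrightarrow>
     (p dvd a \<longrightarrow> \<not> p dvd - 2 * b * c \<and> QuadRes p (- 2 * b * c)) \<and>
     (p dvd b \<longrightarrow> \<not> p dvd - 2 * a * c \<and> QuadRes p (- 2 * a * c)) \<and>
     (p dvd c \<longrightarrow> \<not> p dvd - (a * b) \<and> QuadRes p (- (a * b)))" if p: "prime p" "p \<noteq> 2" for p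
  proof -
    have n2: "\<not> p dvd 2" by (rule odd_prime_not_dvd_2[OF p])
    have n8: "\<not> p dvd 8"
    proof
      assume "p dvd 8"
      then have "p dvd 2 ^ 3" by simp
      then show False using n2 prime_dvd_power[OF p(1)] by blast
    qed
    have q2: "QuadRes p (- (8 * x * y)) \<longleftrightarrow> QuadRes p (- 2 * x * y)" for x y
    proof -
      have eq: "- (8 * x * y) = 2\<^sup>2 * (- 2 * x * y)" by simp
      show ?thesis unfolding eq
        using QuadRes_prime_cancel[OF p(1) n2, of "- 2 * x * y"] QuadRes_square_mult[of p "- 2 * x * y" 2] by blast
    qed
    have q8: "QuadRes p (- (8 * a * (8 * b))) \<longleftrightarrow> QuadRes p (- (a * b))"
    proof -
      have eq: "- (8 * a * (8 * b)) = 8\<^sup>2 * (- (a * b))" by simp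
      show ?thesis unfolding eq
        using QuadRes_prime_cancel[OF p(1) n8, of "- (a * b)"] QuadRes_square_mult[of p "- (a * b)" 8] by blast
    qed
    have d8: "p dvd 8 * x \<longleftrightarrow> p dvd x" for x using n8 by (simp add: prime_dvd_mult_iff[OF p(1)])
    have d2: "p dvd - 2 * x * y \<longleftrightarrow> p dvd x \<or> p dvd y" for x y
    proof -
      have "p dvd - 2 * x * y \<longleftrightarrow> p dvd 2 * (x * y)" by (simp add: mult.assoc)
      then show ?thesis using n2 by (simp only: prime_dvd_mult_iff[OF p(1)]) blast
    qed
    have dab: "p dvd - (a * b) \<longleftrightarrow> p dvd a \<or> p dvd b" by (simp add: prime_dvd_mult_iff[OF p(1)])
    show ?thesis unfolding isotropic_at_def d8 d2 dab q8 unfolding q2 by blast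
  qed
  then show ?thesis unfolding R_rel_odd_part_iff[OF abc(1)] R_rel_odd_part_iff[OF abc(2)] R_rel_odd_part_iff[OF abc(3)]
    by blast
qed

text \<open>Multiplying by 8 and adding \<open>c\<close> completes the square, with
  \<open>w = 2 * z + 1\<close>. As 8 is invertible modulo odd \<open>m\<close>, the diagonal form
  meets every residue modulo \<open>m\<close>, and each coefficient in turn can take the place of
  \<open>A\<close> in \<open>universal_form_imp_QuadRes\<close>.\<close>

lemma asymptotically_universal_imp_isotropic:
  fixes a b c :: int
  assumes au: "asymptotically_universal (\<lambda>x y z. a * x\<^sup>2 + b * y\<^sup>2 + c * triangular z)"
    and p: "prime p" "p \<noteq> 2"
  shows "isotropic_at p (8 * a) (8 * b) c"
proof -
  have univ: "\<exists>x y w. m dvd (8 * a) * x\<^sup>2 + (8 * b) * y\<^sup>2 + c * w\<^sup>2 - r" if m: "odd m" "m > 0" for m r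
  proof -
    have "coprime 8 m" using m(1) coprime_power_left_iff[of 2 3 m] by simp
    then obtain i where i: "[8 * i = 1] (mod m)" using cong_solve_coprime_int by blast
    obtain x y z where xyz: "m dvd (a * x\<^sup>2 + b * y\<^sup>2 + c * triangular z) - i * (r - c)"
      using asymptotically_universal_imp_cong[OF au m(2)] by blast
    have "m dvd 8 * i - 1" using i by (simp add: cong_iff_dvd_diff)
    then have "m dvd 8 * ((a * x\<^sup>2 + b * y\<^sup>2 + c * triangular z) - i * (r - c)) + (8 * i - 1) * (r - c)"
      using xyz by (intro dvd_add dvd_mult dvd_mult2)
    also have "8 * ((a * x\<^sup>2 + b * y\<^sup>2 + c * triangular z) - i * (r - c)) + (8 * i - 1) * (r - c)
        = (8 * a) * x\<^sup>2 + (8 * b) * y\<^sup>2 + c * (2 * z + 1)\<^sup>2 - r"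
      unfolding eight_triangular[symmetric] by (simp add: algebra_simps)
    finally show ?thesis by blast
  qed
  have univ2: "\<exists>x y w. m dvd (8 * b) * x\<^sup>2 + (8 * a) * y\<^sup>2 + c * w\<^sup>2 - r" if m: "odd m" "m > 0" for m r
  proof -
    obtain x y w where "m dvd (8 * a) * x\<^sup>2 + (8 * b) * y\<^sup>2 + c * w\<^sup>2 - r" using univ[OF m] by blast
    then have "m dvd (8 * b) * y\<^sup>2 + (8 * a) * x\<^sup>2 + c * w\<^sup>2 - r" by (simp only: add.commute[of "8 * a * x\<^sup>2"])
    then show ?thesis by blast
  qed
  have univ3: "\<exists>x y w. m dvd c * x\<^sup>2 + (8 * a) * y\<^sup>2 + (8 * b) * w\<^sup>2 - r" if m: "odd m" "m > 0" for m r
  proof -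
    obtain x y w where "m dvd (8 * a) * x\<^sup>2 + (8 * b) * y\<^sup>2 + c * w\<^sup>2 - r" using univ[OF m] by blast
    also have "(8 * a) * x\<^sup>2 + (8 * b) * y\<^sup>2 + c * w\<^sup>2 - r = c * w\<^sup>2 + (8 * a) * x\<^sup>2 + (8 * b) * y\<^sup>2 - r" by simp
    finally show ?thesis by blast
  qed
  show ?thesis unfolding isotropic_at_def
    using universal_form_imp_QuadRes[OF p _ univ] universal_form_imp_QuadRes[OF p _ univ2]
      universal_form_imp_QuadRes[OF p _ univ3] by blast
qed

lemma asymptotically_universal_imp_two_adic:
  fixes a b c :: int
  assumes au: "asymptotically_universal (\<lambda>x y z. a * x\<^sup>2 + b * y\<^sup>2 + c * triangular z)" and c4: "4 dvd c"
  shows "\<not> 8 dvd c \<and> even (a * b) \<and> \<not> 4 dvd a * b"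
proof -
  have sq4: "4 dvd x\<^sup>2 - 0 \<or> 4 dvd x\<^sup>2 - 1" for x :: int
  proof (cases "even x")
    case True
    then obtain k where "x = 2 * k" by blast
    then show ?thesis by (simp add: power2_eq_square)
  next
    case False
    then obtain k where "x = 2 * k + 1" by (rule oddE)
    then have "x\<^sup>2 - 1 = 4 * (k * k + k)" by (simp add: power2_eq_square algebra_simps)
    then have "4 dvd x\<^sup>2 - 1" by (simp only: dvd_triv_left)
    then show ?thesis ..
  qed
  have vals: "4 dvd - r \<or> 4 dvd a - r \<or> 4 dvd b - r \<or> 4 dvd a + b - r" for r
  proof -
    obtain x y z where xyz: "4 dvd (a * x\<^sup>2 + b * y\<^sup>2 + c * triangular z) - r"
      using asymptotically_universal_imp_cong[OF au, of 4 r] by auto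
    obtain e f :: int where ef: "e \<in> {0, 1}" "4 dvd x\<^sup>2 - e" "f \<in> {0, 1}" "4 dvd y\<^sup>2 - f"
      using sq4[of x] sq4[of y] by blast
    have "4 dvd ((a * x\<^sup>2 + b * y\<^sup>2 + c * triangular z) - r) - (a * (x\<^sup>2 - e) + b * (y\<^sup>2 - f) + c * triangular z)"
      by (rule dvd_diff[OF xyz]) (use ef c4 in auto)
    then have "4 dvd a * e + b * f - r" by (simp add: algebra_simps)
    then show ?thesis using ef(1,3) by auto
  qed
  \<comment> \<open>The value 0 is always available, so \<open>a\<close>, \<open>b\<close>,
    \<open>a + b\<close> must be 1, 2, 3 modulo 4 in some order. The sum of the residues 1 and 3 is
    0, so 2 is the residue of \<open>a\<close> or of \<open>b\<close>.\<close>
  have par: "odd a \<and> even b \<and> \<not> 4 dvd b \<or> odd b \<and> even a \<and> \<not> 4 dvd a"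
    using vals[of 1] vals[of 2] vals[of 3] by presburger
  have sub: "even (a * b) \<and> \<not> 4 dvd a * b"
  proof -
    have "\<not> 4 dvd a * b" if "odd a" "\<not> 4 dvd b" for a b :: int
    proof -
      have "coprime 4 a" using that(1) coprime_power_left_iff[of 2 2 a] by simp
      then show ?thesis using that(2) coprime_dvd_mult_right_iff by blast
    qed
    from this[of a b] this[of b a] par show ?thesis by (auto simp: mult.commute)
  qed
  moreover have "\<not> 8 dvd c"
  proof
    assume c8: "8 dvd c"
    have sq8: "8 dvd x\<^sup>2 - 0 \<or> 8 dvd x\<^sup>2 - 1 \<or> 8 dvd x\<^sup>2 - 4" for x :: int
    proof (cases "even x")
      case True
      then obtain k where k: "x = 2 * k" by blast
      show ?thesis
      proof (cases "even k")
        case True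
        then obtain l where "k = 2 * l" by blast
        then have "x\<^sup>2 = 8 * (2 * (l * l))" using k by (simp add: power2_eq_square)
        then show ?thesis by simp
      next
        case False
        then obtain l where "k = 2 * l + 1" by (rule oddE)
        then have "x\<^sup>2 - 4 = 8 * (2 * (l * l + l))" using k by (simp add: power2_eq_square algebra_simps)
        then have "8 dvd x\<^sup>2 - 4" by (simp only: dvd_triv_left)
        then show ?thesis by blast
      qed
    next
      case False
      then show ?thesis using odd_square_cong_1[of x] by (simp add: power2_eq_square)
    qed
    have key: False if au: "\<And>r. \<exists>x y z. 8 dvd (a * x\<^sup>2 + b * y\<^sup>2 + c * triangular z) - r"
      and ab: "odd a" "even b" "\<not> 4 dvd b" for a b
    proof -
      \<comment> \<open>Without help from \<open>c\<close>, the odd values modulo 8 are only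
        \<open>a\<close> and \<open>a + b\<close>. The residue \<open>a + 4\<close> is neither of
        them, because \<open>b\<close> is 2 modulo 4.\<close>
      obtain x y z where xyz: "8 dvd (a * x\<^sup>2 + b * y\<^sup>2 + c * triangular z) - (a + 4)" using au by blast
      obtain e f :: int where ef: "e \<in> {0, 1, 4}" "8 dvd x\<^sup>2 - e" "f \<in> {0, 1, 4}" "8 dvd y\<^sup>2 - f"
        using sq8[of x] sq8[of y] by blast
      have "8 dvd ((a * x\<^sup>2 + b * y\<^sup>2 + c * triangular z) - (a + 4)) - (a * (x\<^sup>2 - e) + b * (y\<^sup>2 - f) + c * triangular z)"
        by (rule dvd_diff[OF xyz]) (use ef c8 in auto)
      then have "8 dvd a * e + b * f - (a + 4)" by (simp add: algebra_simps)
      then show False using ef(1,3) ab by (elim insertE emptyE) (hypsubst, presburger)+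
    qed
    have u8: "\<exists>x y z. 8 dvd (a * x\<^sup>2 + b * y\<^sup>2 + c * triangular z) - r" for r
      using asymptotically_universal_imp_cong[OF au, of 8 r] by simp
    have u8': "\<exists>x y z. 8 dvd (b * x\<^sup>2 + a * y\<^sup>2 + c * triangular z) - r" for r
    proof -
      obtain x y z where "8 dvd (a * x\<^sup>2 + b * y\<^sup>2 + c * triangular z) - r" using u8 by blast
      then have "8 dvd (b * y\<^sup>2 + a * x\<^sup>2 + c * triangular z) - r" by (simp only: add.commute[of "a * x\<^sup>2"])
      then show ?thesis by blast
    qed
    show False using par key[OF u8] key[OF u8'] by blast
  qed
  ultimately show ?thesis by blast
qed

theorem theorem1p1:
  fixes a b c :: int
  assumes "a > 0" and "b > 0" and "c > 0"
    and "gcd a (gcd b c) = 1"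
  shows "asymptotically_universal (\<lambda>x y z. a * x\<^sup>2 + b * y\<^sup>2 + c * triangular z) \<longleftrightarrow>
    (R_rel (- 2 * b * c) (odd_part a) \<and> R_rel (- 2 * a * c) (odd_part b) \<and>
      R_rel (- (a * b)) (odd_part c)) \<and>
    (\<not> 4 dvd c \<or> (two_power_exact 2 c \<and> two_power_exact 1 (a * b)))"
proof -
  have ab: "a * b \<noteq> 0" "c \<noteq> 0" using assms by auto
  have two: "(\<not> 4 dvd c \<or> (two_power_exact 2 c \<and> two_power_exact 1 (a * b))) \<longleftrightarrow>
     (\<not> 4 dvd c \<or> (4 dvd c \<and> \<not> 8 dvd c \<and> even (a * b) \<and> \<not> 4 dvd a * b))"
    unfolding two_power_exact_iff[OF ab(1)] two_power_exact_iff[OF ab(2)] by simp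
  have odd: "odd a \<or> odd b \<or> odd c"
  proof (rule ccontr)
    assume "\<not> ?thesis"
    then have "2 dvd gcd a (gcd b c)" by simp
    then show False using assms(4) by simp
  qed
  show ?thesis
    unfolding two R_rel_iff_isotropic[OF assms(1-3)]
    using isotropic_imp_asymptotically_universal[OF assms(1-3) odd]
      asymptotically_universal_imp_isotropic asymptotically_universal_imp_two_adic
    by blast
qed

end
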